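(* Let $\mathbb{F}$ be a field and $R\subseteq\mathbb{F}$ a subring with $\mathbb{F}=\mathrm{Frac}(R)$. Let $T$ be a complete theory in a language $\mathcal{L}$ extending the language of $\mathbb{F}$-vector spaces, such that $T$ expands the theory of $\mathbb{F}$-vector spaces, has quantifier elimination in $\mathcal{L}$, eliminates $\exists^\infty$, and satisfies $\mathrm{dcl}(\vec a)=\mathrm{acl}(\vec a)=\mathrm{span}_{\mathbb{F}}(\vec a)$ for every finite tuple $\vec a$ in a model of $T$. If $T$ is stable, then $T^G$ is stable. If $T$ is NIP, then so is $T^G$.
   Context: $\mathcal{L}_0=\{+,0,(\lambda\cdot)_{\lambda\in\mathbb{F}}\}$ is the language of vector spaces over $\mathbb{F}$ and $\mathcal{L}\supseteq\mathcal{L}_0$. $\mathcal{L}_{R\text{-mod}}=\{+,0,(r\cdot)_{r\in R}\}$ is the language of $R$-modules. $\mathcal{L}_G$ is the expansion of $\mathcal{L}$ by a new unary predicate $G$ and, for each $\mathcal{L}_{R\text{-mod}}$-formula $\phi(\vec x)$, a new predicate $P_\phi(\vec x)$. For a tuple $\vec x$, $G(\vec x)$ means that all its coordinates lie in $G$. $T^G$ is the $\mathcal{L}_G$-theory of pairs $(V,G)$ with $V\models T$ satisfying (universal closures of) the following schemes: (A) $G$ is an $R$-submodule of $V$, and for every $\mathcal{L}_{R\text{-mod}}$-formula $\phi(\vec x)$: $P_\phi(\vec x)\to G(\vec x)$ and $G(\vec x)\to(P_\phi(\vec x)\leftrightarrow\hat\phi(\vec x))$, where $\hat\phi$ is the relativization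 of $\phi$ to $G$ (i.e. $P_\phi(\vec a)$ holds iff $\vec a\in G$ and $G\models\phi(\vec a)$ as an $R$-module). (B) (Density) For every $r\in R\setminus\{0\}$ and every $\mathcal{L}$-formula $\phi(x,\vec y)$: $\exists^\infty x\,\phi(x,\vec y)\to\exists x(\phi(x,\vec y)\wedge x\in rG)$. (C) (Extension/co-density) For all $\mathcal{L}$-formulas $\phi(x,\vec y)$, $\psi(x,\vec y,\vec z)$ and $n\ge1$: $(\exists^\infty x\,\phi(x,\vec y)\wedge\forall\vec z\,\exists^{\le n}x\,\psi(x,\vec y,\vec z))\to\exists x(\phi(x,\vec y)\wedge\forall\vec z(G(\vec z)\to\neg\psi(x,\vec y,\vec z)))$. A theory is stable (resp. NIP) if in every model of it no formula has the order property (resp. the independence property). *)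

theory Defs
  imports Main
begin

section \<open>First-order logic with equality\<close>

datatype 'f tm = Var nat | Fn 'f "'f tm list"

datatype ('f, 'p) fm =
    Bot
  | Eq "'f tm" "'f tm"
  | Rel 'p "'f tm list"
  | Imp "('f, 'p) fm" "('f, 'p) fm"
  | Forall nat "('f, 'p) fm"

abbreviation Neg :: "('f, 'p) fm \<Rightarrow> ('f, 'p) fm" where "Neg \<phi> \<equiv> Imp \<phi> Bot"
abbreviation Or :: "('f, 'p) fm \<Rightarrow> ('f, 'p) fm \<Rightarrow> ('f, 'p) fm" where "Or \<phi> \<psi> \<equiv> Imp (Neg \<phi>) \<psi>"
abbreviation And :: "('f, 'p) fm \<Rightarrow> ('f, 'p) fm \<Rightarrow> ('f, 'p) fm" where "And \<phi> \<psi> \<equiv> Neg (Imp \<phi> (Neg \<psi>))"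
abbreviation Iff :: "('f, 'p) fm \<Rightarrow> ('f, 'p) fm \<Rightarrow> ('f, 'p) fm" where "Iff \<phi> \<psi> \<equiv> And (Imp \<phi> \<psi>) (Imp \<psi> \<phi>)"
abbreviation Exists :: "nat \<Rightarrow> ('f, 'p) fm \<Rightarrow> ('f, 'p) fm" where "Exists x \<phi> \<equiv> Neg (Forall x (Neg \<phi>))"

definition Conjs :: "('f, 'p) fm list \<Rightarrow> ('f, 'p) fm" where "Conjs \<phi>s = foldr And \<phi>s (Neg Bot)"
definition Disjs :: "('f, 'p) fm list \<Rightarrow> ('f, 'p) fm" where "Disjs \<phi>s = foldr Or \<phi>s Bot"

primrec fv_tm :: "'f tm \<Rightarrow> nat set" where
  "fv_tm (Var x) = {x}"
| "fv_tm (Fn f ts) = \<Union> (set (map fv_tm ts))"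

primrec fv :: "('f, 'p) fm \<Rightarrow> nat set" where
  "fv Bot = {}"
| "fv (Eq s t) = fv_tm s \<union> fv_tm t"
| "fv (Rel p ts) = \<Union> (set (map fv_tm ts))"
| "fv (Imp \<phi> \<psi>) = fv \<phi> \<union> fv \<psi>"
| "fv (Forall x \<phi>) = fv \<phi> - {x}"

primrec quantifier_free :: "('f, 'p) fm \<Rightarrow> bool" where
  "quantifier_free Bot = True"
| "quantifier_free (Eq s t) = True"
| "quantifier_free (Rel p ts) = True"
| "quantifier_free (Imp \<phi> \<psi>) = (quantifier_free \<phi> \<and> quantifier_free \<psi>)"
| "quantifier_free (Forall x \<phi>) = False"

definition univ_closure :: "('f, 'p) fm \<Rightarrow> ('f, 'p) fm" where
  "univ_closure \<phi> = foldr Forall (sorted_list_of_set (fv \<phi>)) \<phi>"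

text \<open>
  A language assigns arities to the symbols that belong to it; \<open>None\<close> marks an element of the
  symbol type that is not a symbol of the language.
\<close>

record ('f, 'p) lang =
  fun_ar :: "'f \<Rightarrow> nat option"
  rel_ar :: "'p \<Rightarrow> nat option"

primrec wf_tm :: "('f, 'p) lang \<Rightarrow> 'f tm \<Rightarrow> bool" where
  "wf_tm L (Var x) = True"
| "wf_tm L (Fn f ts) = (fun_ar L f = Some (length ts) \<and> list_all id (map (wf_tm L) ts))"

primrec wf_fm :: "('f, 'p) lang \<Rightarrow> ('f, 'p) fm \<Rightarrow> bool" where
  "wf_fm L Bot = True"
| "wf_fm L (Eq s t) = (wf_tm L s \<and> wf_tm L t)"
| "wf_fm L (Rel p ts) = (rel_ar L p = Some (length ts) \<and> list_all (wf_tm L) ts)"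
| "wf_fm L (Imp \<phi> \<psi>) = (wf_fm L \<phi> \<and> wf_fm L \<psi>)"
| "wf_fm L (Forall x \<phi>) = wf_fm L \<phi>"

definition sentence :: "('f, 'p) lang \<Rightarrow> ('f, 'p) fm \<Rightarrow> bool" where
  "sentence L \<sigma> \<longleftrightarrow> wf_fm L \<sigma> \<and> fv \<sigma> = {}"

record ('f, 'p, 'u) struc =
  carr :: "'u set"
  fun_int :: "'f \<Rightarrow> 'u list \<Rightarrow> 'u"
  rel_int :: "'p \<Rightarrow> 'u list \<Rightarrow> bool"

definition is_struc :: "('f, 'p) lang \<Rightarrow> ('f, 'p, 'u) struc \<Rightarrow> bool" where
  "is_struc L M \<longleftrightarrow> carr M \<noteq> {} \<and>
     (\<forall>f as. fun_ar L f = Some (length as) \<longrightarrow> set as \<subseteq> carr M \<longrightarrow> fun_int M f as \<in> carr M)"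

primrec eval_tm :: "('f, 'p, 'u) struc \<Rightarrow> (nat \<Rightarrow> 'u) \<Rightarrow> 'f tm \<Rightarrow> 'u" where
  "eval_tm M e (Var x) = e x"
| "eval_tm M e (Fn f ts) = fun_int M f (map (eval_tm M e) ts)"

primrec sat :: "('f, 'p, 'u) struc \<Rightarrow> (nat \<Rightarrow> 'u) \<Rightarrow> ('f, 'p) fm \<Rightarrow> bool" where
  "sat M e Bot = False"
| "sat M e (Eq s t) = (eval_tm M e s = eval_tm M e t)"
| "sat M e (Rel p ts) = rel_int M p (map (eval_tm M e) ts)"
| "sat M e (Imp \<phi> \<psi>) = (sat M e \<phi> \<longrightarrow> sat M e \<psi>)"
| "sat M e (Forall x \<phi>) = (\<forall>a \<in> carr M. sat M (e(x := a)) \<phi>)"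

definition assignment :: "('f, 'p, 'u) struc \<Rightarrow> (nat \<Rightarrow> 'u) \<Rightarrow> bool" where
  "assignment M e \<longleftrightarrow> range e \<subseteq> carr M"

definition solutions :: "('f, 'p, 'u) struc \<Rightarrow> (nat \<Rightarrow> 'u) \<Rightarrow> nat \<Rightarrow> ('f, 'p) fm \<Rightarrow> 'u set" where
  "solutions M e x \<phi> = {a \<in> carr M. sat M (e(x := a)) \<phi>}"


section \<open>Theories\<close>

definition is_theory :: "('f, 'p) lang \<Rightarrow> ('f, 'p) fm set \<Rightarrow> bool" where
  "is_theory L T \<longleftrightarrow> (\<forall>\<sigma> \<in> T. sentence L \<sigma>)"

definition models :: "('f, 'p) lang \<Rightarrow> ('f, 'p, 'u) struc \<Rightarrow> ('f, 'p) fm set \<Rightarrow> bool" where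
  "models L M T \<longleftrightarrow> is_struc L M \<and> (\<forall>\<sigma> \<in> T. \<forall>e. assignment M e \<longrightarrow> sat M e \<sigma>)"

text \<open>
  A HOL formula cannot quantify over types, so every notion that refers to all models of a theory
  takes the type \<open>'u\<close> from which the universes of the models are drawn.
  A type that admits an injection from the set of formulas contains a copy of some elementary
  substructure of every structure (Loewenheim-Skolem), so there the notions below
  do not depend on the choice of the type.
\<close>

definition large_type :: "'u itself \<Rightarrow> ('f, 'p) lang \<Rightarrow> bool" where
  "large_type U (L :: ('f, 'p) lang) \<longleftrightarrow> (\<exists>j :: ('f, 'p) fm \<Rightarrow> 'u. inj j)"

definition entails :: "'u itself \<Rightarrow> ('f, 'p) lang \<Rightarrow> ('f, 'p) fm set \<Rightarrow> ('f, 'p) fm \<Rightarrow> bool" where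
  "entails U L T \<phi> \<longleftrightarrow>
     (\<forall>M :: ('f, 'p, 'u) struc. models L M T \<longrightarrow> (\<forall>e. assignment M e \<longrightarrow> sat M e \<phi>))"

definition complete_theory :: "'u itself \<Rightarrow> ('f, 'p) lang \<Rightarrow> ('f, 'p) fm set \<Rightarrow> bool" where
  "complete_theory U L T \<longleftrightarrow> is_theory L T \<and> (\<exists>M :: ('f, 'p, 'u) struc. models L M T) \<and>
     (\<forall>\<sigma>. sentence L \<sigma> \<longrightarrow> entails U L T \<sigma> \<or> entails U L T (Neg \<sigma>))"

definition has_qe :: "'u itself \<Rightarrow> ('f, 'p) lang \<Rightarrow> ('f, 'p) fm set \<Rightarrow> bool" where
  "has_qe U L T \<longleftrightarrow> (\<forall>\<phi>. wf_fm L \<phi> \<longrightarrow>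
     (\<exists>\<psi>. wf_fm L \<psi> \<and> quantifier_free \<psi> \<and> fv \<psi> \<subseteq> fv \<phi> \<and> entails U L T (Iff \<phi> \<psi>)))"

text \<open>\<open>\<theta>\<close> expresses \<open>\<exists>\<^sup>\<infinity>x. \<phi>\<close> modulo \<open>T\<close>.\<close>

definition expresses_inf ::
  "'u itself \<Rightarrow> ('f, 'p) lang \<Rightarrow> ('f, 'p) fm set \<Rightarrow> nat \<Rightarrow> ('f, 'p) fm \<Rightarrow> ('f, 'p) fm \<Rightarrow> bool" where
  "expresses_inf U L T x \<phi> \<theta> \<longleftrightarrow> wf_fm L \<theta> \<and> fv \<theta> \<subseteq> fv \<phi> - {x} \<and>
     (\<forall>M :: ('f, 'p, 'u) struc. models L M T \<longrightarrow>
        (\<forall>e. assignment M e \<longrightarrow> (sat M e \<theta> \<longleftrightarrow> infinite (solutions M e x \<phi>))))"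

definition eliminates_inf :: "'u itself \<Rightarrow> ('f, 'p) lang \<Rightarrow> ('f, 'p) fm set \<Rightarrow> bool" where
  "eliminates_inf U L T \<longleftrightarrow> (\<forall>\<phi> x. wf_fm L \<phi> \<longrightarrow> (\<exists>\<theta>. expresses_inf U L T x \<phi> \<theta>))"

definition acl :: "('f, 'p) lang \<Rightarrow> ('f, 'p, 'u) struc \<Rightarrow> 'u set \<Rightarrow> 'u set" where
  "acl L M A = {b. \<exists>\<phi> x e. wf_fm L \<phi> \<and> e ` (fv \<phi> - {x}) \<subseteq> A \<and>
     b \<in> solutions M e x \<phi> \<and> finite (solutions M e x \<phi>)}"

definition dcl :: "('f, 'p) lang \<Rightarrow> ('f, 'p, 'u) struc \<Rightarrow> 'u set \<Rightarrow> 'u set" where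
  "dcl L M A = {b. \<exists>\<phi> x e. wf_fm L \<phi> \<and> e ` (fv \<phi> - {x}) \<subseteq> A \<and> solutions M e x \<phi> = {b}}"


section \<open>Stability and NIP\<close>

text \<open>
  The variables of \<open>\<phi>\<close> are split into object variables (those in \<open>X\<close>) and parameter variables
  (the others); \<open>override_on b a X\<close> takes the former from \<open>a\<close> and the latter from \<open>b\<close>.
  Both properties are stated in Shelah's form with arbitrarily long finite configurations. By
  compactness, a theory has a model with such configurations iff it has one with an infinite one.
\<close>

definition order_property :: "('f, 'p, 'u) struc \<Rightarrow> ('f, 'p) fm \<Rightarrow> nat set \<Rightarrow> bool" where
  "order_property M \<phi> X \<longleftrightarrow> (\<forall>n. \<exists>a b :: nat \<Rightarrow> nat \<Rightarrow> 'u.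
     (\<forall>i < n. assignment M (a i) \<and> assignment M (b i)) \<and>
     (\<forall>i < n. \<forall>j < n. sat M (override_on (b j) (a i) X) \<phi> \<longleftrightarrow> i < j))"

definition independence_property :: "('f, 'p, 'u) struc \<Rightarrow> ('f, 'p) fm \<Rightarrow> nat set \<Rightarrow> bool" where
  "independence_property M \<phi> X \<longleftrightarrow>
     (\<forall>n. \<exists>(a :: nat \<Rightarrow> nat \<Rightarrow> 'u) (b :: nat set \<Rightarrow> nat \<Rightarrow> 'u).
       (\<forall>i < n. assignment M (a i)) \<and> (\<forall>S \<subseteq> {..<n}. assignment M (b S)) \<and>
       (\<forall>i < n. \<forall>S \<subseteq> {..<n}. sat M (override_on (b S) (a i) X) \<phi> \<longleftrightarrow> i \<in> S))"

definition stable_theory :: "'u itself \<Rightarrow> ('f, 'p) lang \<Rightarrow> ('f, 'p) fm set \<Rightarrow> bool" where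
  "stable_theory U L T \<longleftrightarrow> (\<forall>(M :: ('f, 'p, 'u) struc) \<phi> X.
     models L M T \<longrightarrow> wf_fm L \<phi> \<longrightarrow> \<not> order_property M \<phi> X)"

definition NIP_theory :: "'u itself \<Rightarrow> ('f, 'p) lang \<Rightarrow> ('f, 'p) fm set \<Rightarrow> bool" where
  "NIP_theory U L T \<longleftrightarrow> (\<forall>(M :: ('f, 'p, 'u) struc) \<phi> X.
     models L M T \<longrightarrow> wf_fm L \<phi> \<longrightarrow> \<not> independence_property M \<phi> X)"


section \<open>Modules and vector spaces\<close>

definition is_subring :: "'k::field set \<Rightarrow> bool" where
  "is_subring R \<longleftrightarrow> 0 \<in> R \<and> 1 \<in> R \<and> (\<forall>a \<in> R. \<forall>b \<in> R. a + b \<in> R \<and> a * b \<in> R \<and> - a \<in> R)"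

definition frac_is_everything :: "'k::field set \<Rightarrow> bool" where
  "frac_is_everything R \<longleftrightarrow> (\<forall>c. \<exists>a \<in> R. \<exists>b \<in> R. b \<noteq> 0 \<and> c = a / b)"

datatype 'k msym = Add | Zero | Scal 'k

fun module_ar :: "'k set \<Rightarrow> 'k msym \<Rightarrow> nat option" where
  "module_ar R Add = Some 2"
| "module_ar R Zero = Some 0"
| "module_ar R (Scal r) = (if r \<in> R then Some 1 else None)"

text \<open>There are no relation symbols, so the type of relation symbols is irrelevant.\<close>

definition module_lang :: "'k set \<Rightarrow> ('k msym, unit) lang" where
  "module_lang R = \<lparr>fun_ar = module_ar R, rel_ar = (\<lambda>_. None)\<rparr>"

text \<open>
  A language containing that of vector spaces over \<open>'k\<close> has function symbols in
  \<open>'k msym + 'f\<close>, where \<open>'f\<close> hosts the additional ones.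
\<close>

definition extends_vs_lang :: "('k msym + 'f, 'p) lang \<Rightarrow> bool" where
  "extends_vs_lang L \<longleftrightarrow> (\<forall>s. fun_ar L (Inl s) = module_ar UNIV s)"

abbreviation plus_tm :: "('k msym + 'f) tm \<Rightarrow> ('k msym + 'f) tm \<Rightarrow> ('k msym + 'f) tm"
  where "plus_tm s t \<equiv> Fn (Inl Add) [s, t]"
abbreviation zero_tm :: "('k msym + 'f) tm" where "zero_tm \<equiv> Fn (Inl Zero) []"
abbreviation scal_tm :: "'k \<Rightarrow> ('k msym + 'f) tm \<Rightarrow> ('k msym + 'f) tm"
  where "scal_tm c t \<equiv> Fn (Inl (Scal c)) [t]"

definition vs_axioms :: "('k::field msym + 'f, 'p) fm set" where
  "vs_axioms = (let x = Var 0; y = Var 1; z = Var 2 in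
     univ_closure ` (
       {Eq (plus_tm (plus_tm x y) z) (plus_tm x (plus_tm y z)),
        Eq (plus_tm x y) (plus_tm y x),
        Eq (plus_tm x zero_tm) x,
        Exists 1 (Eq (plus_tm x y) zero_tm),
        Eq (scal_tm 1 x) x} \<union>
       {Eq (scal_tm c (plus_tm x y)) (plus_tm (scal_tm c x) (scal_tm c y)) | c. True} \<union>
       {Eq (scal_tm (c + d) x) (plus_tm (scal_tm c x) (scal_tm d x)) | c d. True} \<union>
       {Eq (scal_tm (c * d) x) (scal_tm c (scal_tm d x)) | c d. True}))"

definition expands_vs ::
  "'u itself \<Rightarrow> ('k::field msym + 'f, 'p) lang \<Rightarrow> ('k msym + 'f, 'p) fm set \<Rightarrow> bool" where
  "expands_vs U L T \<longleftrightarrow> (\<forall>\<sigma> \<in> vs_axioms. entails U L T \<sigma>)"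

inductive_set vspan :: "('k msym + 'f, 'p, 'u) struc \<Rightarrow> 'u set \<Rightarrow> 'u set"
  for M :: "('k msym + 'f, 'p, 'u) struc" and A :: "'u set" where
  base: "a \<in> A \<Longrightarrow> a \<in> vspan M A"
| zero: "fun_int M (Inl Zero) [] \<in> vspan M A"
| plus: "a \<in> vspan M A \<Longrightarrow> b \<in> vspan M A \<Longrightarrow> fun_int M (Inl Add) [a, b] \<in> vspan M A"
| scal: "a \<in> vspan M A \<Longrightarrow> fun_int M (Inl (Scal c)) [a] \<in> vspan M A"

definition closures_are_span ::
  "'u itself \<Rightarrow> ('k msym + 'f, 'p) lang \<Rightarrow> ('k msym + 'f, 'p) fm set \<Rightarrow> bool" where
  "closures_are_span U L T \<longleftrightarrow> (\<forall>M :: ('k msym + 'f, 'p, 'u) struc. models L M T \<longrightarrow>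
     (\<forall>A. finite A \<longrightarrow> A \<subseteq> carr M \<longrightarrow> dcl L M A = acl L M A \<and> acl L M A = vspan M A))"


section \<open>The expansion by a predicate for a submodule\<close>

text \<open>
  \<open>Pred xs \<phi>\<close> is the predicate attached to the module formula \<open>\<phi>(xs)\<close>, where
  \<open>xs\<close> is a tuple of distinct variables containing the free ones of \<open>\<phi>\<close>.
\<close>

datatype ('k, 'p) grel = Old 'p | InG | Pred "nat list" "('k msym, unit) fm"

definition formula_in :: "'k set \<Rightarrow> nat list \<Rightarrow> ('k msym, unit) fm \<Rightarrow> bool" where
  "formula_in R xs \<phi> \<longleftrightarrow> wf_fm (module_lang R) \<phi> \<and> distinct xs \<and> fv \<phi> \<subseteq> set xs"

fun G_rel_ar :: "('k msym + 'f, 'p) lang \<Rightarrow> 'k set \<Rightarrow> ('k, 'p) grel \<Rightarrow> nat option" where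
  "G_rel_ar L R (Old p) = rel_ar L p"
| "G_rel_ar L R InG = Some 1"
| "G_rel_ar L R (Pred xs \<phi>) = (if formula_in R xs \<phi> then Some (length xs) else None)"

definition G_lang ::
  "('k msym + 'f, 'p) lang \<Rightarrow> 'k set \<Rightarrow> ('k msym + 'f, ('k, 'p) grel) lang" where
  "G_lang L R = \<lparr>fun_ar = fun_ar L, rel_ar = G_rel_ar L R\<rparr>"

abbreviation old :: "('k msym + 'f, 'p) fm \<Rightarrow> ('k msym + 'f, ('k, 'p) grel) fm" where
  "old \<equiv> map_fm id Old"

abbreviation in_G :: "('k msym + 'f) tm \<Rightarrow> ('k msym + 'f, ('k, 'p) grel) fm" where
  "in_G t \<equiv> Rel InG [t]"

definition all_in_G :: "nat list \<Rightarrow> ('k msym + 'f, ('k, 'p) grel) fm" where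
  "all_in_G xs = Conjs (map (\<lambda>x. in_G (Var x)) xs)"

definition in_rG :: "'k \<Rightarrow> nat \<Rightarrow> ('k msym + 'f, ('k, 'p) grel) fm" where
  "in_rG r x = Exists (Suc x) (And (in_G (Var (Suc x))) (Eq (Var x) (scal_tm r (Var (Suc x)))))"

primrec relativize :: "('k msym, unit) fm \<Rightarrow> ('k msym + 'f, ('k, 'p) grel) fm" where
  "relativize Bot = Bot"
| "relativize (Eq s t) = Eq (map_tm Inl s) (map_tm Inl t)"
| "relativize (Rel p ts) = Bot"  \<comment> \<open>does not occur in module formulas\<close>
| "relativize (Imp \<phi> \<psi>) = Imp (relativize \<phi>) (relativize \<psi>)"
| "relativize (Forall x \<phi>) = Forall x (Imp (in_G (Var x)) (relativize \<phi>))"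

text \<open>\<open>\<exists>\<^sup>\<le>\<^sup>nx. \<psi>\<close>, written with fresh variables as \<open>\<exists>w\<^sub>1 \<dots> w\<^sub>n. \<forall>x. \<psi> \<longrightarrow> x = w\<^sub>1 \<or> \<dots> \<or> x = w\<^sub>n\<close>.\<close>

definition at_most :: "nat \<Rightarrow> nat \<Rightarrow> ('f, 'p) fm \<Rightarrow> ('f, 'p) fm" where
  "at_most n x \<psi> = (let k = Suc (Max (insert x (fv \<psi>))); ws = [k..<k + n] in
     foldr Exists ws (Forall x (Imp \<psi> (Disjs (map (\<lambda>w. Eq (Var x) (Var w)) ws)))))"

definition submodule_axioms :: "'k set \<Rightarrow> ('k msym + 'f, ('k, 'p) grel) fm set" where
  "submodule_axioms R = (let x = Var 0; y = Var 1 in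
     {in_G zero_tm, Imp (And (in_G x) (in_G y)) (in_G (plus_tm x y))} \<union>
     {Imp (in_G x) (in_G (scal_tm r x)) | r. r \<in> R})"

definition predicate_axioms :: "'k set \<Rightarrow> ('k msym + 'f, ('k, 'p) grel) fm set" where
  "predicate_axioms R =
     {Imp (Rel (Pred xs \<phi>) (map Var xs)) (all_in_G xs) | xs \<phi>. formula_in R xs \<phi>} \<union>
     {Imp (all_in_G xs) (Iff (Rel (Pred xs \<phi>) (map Var xs)) (relativize \<phi>)) | xs \<phi>.
        formula_in R xs \<phi>}"

text \<open>
  In the next two schemes \<open>\<theta>\<close> stands for \<open>\<exists>\<^sup>\<infinity>x. \<phi>\<close>: there is one axiom for each
  formula \<open>\<theta>\<close> expressing this quantifier modulo \<open>T\<close>, and these are all equivalent modulo \<open>T\<close>.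
\<close>

definition density_axioms ::
  "'u itself \<Rightarrow> ('k::field msym + 'f, 'p) lang \<Rightarrow> 'k set \<Rightarrow> ('k msym + 'f, 'p) fm set \<Rightarrow>
   ('k msym + 'f, ('k, 'p) grel) fm set" where
  "density_axioms U L R T =
     {Imp (old \<theta>) (Exists x (And (old \<phi>) (in_rG r x))) | r x \<phi> \<theta>.
        r \<in> R - {0} \<and> wf_fm L \<phi> \<and> expresses_inf U L T x \<phi> \<theta>}"

definition codensity_axioms ::
  "'u itself \<Rightarrow> ('k::field msym + 'f, 'p) lang \<Rightarrow> ('k msym + 'f, 'p) fm set \<Rightarrow>
   ('k msym + 'f, ('k, 'p) grel) fm set" where
  "codensity_axioms U L T =
     {Imp (And (old \<theta>) (foldr Forall zs (old (at_most n x \<psi>))))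
        (Exists x (And (old \<phi>) (foldr Forall zs (Imp (all_in_G zs) (Neg (old \<psi>)))))) | n x zs \<phi> \<psi> \<theta>.
        n \<ge> 1 \<and> distinct zs \<and> x \<notin> set zs \<and> set zs \<inter> fv \<phi> = {} \<and>
        wf_fm L \<phi> \<and> wf_fm L \<psi> \<and> expresses_inf U L T x \<phi> \<theta>}"

definition G_theory ::
  "'u itself \<Rightarrow> ('k::field msym + 'f, 'p) lang \<Rightarrow> 'k set \<Rightarrow> ('k msym + 'f, 'p) fm set \<Rightarrow>
   ('k msym + 'f, ('k, 'p) grel) fm set" where
  "G_theory U L R T = old ` T \<union>
     univ_closure ` (submodule_axioms R \<union> predicate_axioms R \<union>
                density_axioms U L R T \<union> codensity_axioms U L T)"

end

theory Submission
  imports Defs "HOL-Library.Ramsey"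
begin

text \<open>
  Let \<open>M\<close> be a model of \<open>T\<^sup>G\<close>, with universe \<open>V\<close>. Call a condition on tuples basic if it is
  definable in the language of \<open>T\<close>, or if it is primitive positive in the \<open>'k\<close>-vector space \<open>V\<close>
  with a predicate for the \<open>R\<close>-submodule \<open>G\<close>. Every formula of the expanded language is a Boolean
  combination of basic conditions: if \<open>b\<close> and \<open>b'\<close> satisfy the same ones of a suitable finite set
  and \<open>a\<close> is given, then either \<open>a\<close> is one of finitely many linear terms in \<open>b\<close> (finitely many
  suffice by compactness, since algebraic closure is linear span), or the relevant definable set
  over \<open>b'\<close> is infinite. In the latter case the argument of Baur and Monk for modules gives a
  point with the right primitive positive conditions. These conditions are invariant under \<open>r G\<close>
  for some nonzero \<open>r\<close>, because \<open>'k\<close> is the fraction field of \<open>R\<close>, so density moves the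
  point into the definable set. Primitive positive conditions define subgroups, which
  have neither long order patterns nor long independence patterns. By Ramsey's theorem and the
  Sauer-Shelah lemma, long patterns for a Boolean combination give long patterns for one of its
  constituents.
\<close>

section \<open>Semantics\<close>

text \<open>Density concerns infinite sets definable in the old language, but a witness for a
  quantifier must also meet conditions on \<open>G\<close>. The way out is a dichotomy for a
  primitive positive condition and one variable: either the condition determines the variable as a
  linear term in the others, or every fibre is a union of cosets of \<open>r G\<close>. Conditions
  of the first kind fail once finitely many terms have been removed from the definable set; those of
  the second kind survive the shift by \<open>r G\<close>. Quantifiers of primitive positive
  conditions range over \<open>V\<close>; the predicates \<open>Pred\<close> reduce to quantifiers
  over \<open>V\<close> guarded by \<open>G\<close>.

  Elimination is semantic: a condition is \<open>nice\<close> if finitely many basic conditions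
  decide it, so no normal forms are computed.

  The hypotheses on \<open>T\<close> quantify over models in the type \<open>'u\<close>, whereas the
  pair lives in \<open>'w\<close> and compactness uses ultrapowers in a third type. Each hypothesis
  is carried over by pulling countably many elements back to an elementary submodel in
  \<open>'u\<close>. Countably many are enough: an assignment, an infinite subset of a solution set,
  or patterns of all finite lengths.\<close>

lemma finite_fv_tm [simp]: "finite (fv_tm t)"
  by (induction t) auto

lemma finite_fv [simp]: "finite (fv \<phi>)"
  by (induction \<phi>) auto

lemma eval_tm_cong: "(\<And>x. x \<in> fv_tm t \<Longrightarrow> e x = e' x) \<Longrightarrow> eval_tm M e t = eval_tm M e' t"
proof (induction t)
  case (Fn f ts)
  then have "map (eval_tm M e) ts = map (eval_tm M e') ts" by (intro map_cong) auto
  then show ?case by (metis eval_tm.simps(2))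
qed simp

lemma sat_cong: "(\<And>x. x \<in> fv \<phi> \<Longrightarrow> e x = e' x) \<Longrightarrow> sat M e \<phi> = sat M e' \<phi>"
proof (induction \<phi> arbitrary: e e')
  case (Eq s t)
  then have "eval_tm M e s = eval_tm M e' s" "eval_tm M e t = eval_tm M e' t"
    by (auto intro!: eval_tm_cong)
  then show ?case by simp
next
  case (Rel p ts)
  then have "map (eval_tm M e) ts = map (eval_tm M e') ts"
    by (auto intro!: eval_tm_cong)
  then show ?case by (metis sat.simps(3))
next
  case (Imp \<phi> \<psi>)
  then show ?case by (metis UnCI fv.simps(4) sat.simps(4))
next
  case (Forall x \<phi>)
  have "sat M (e(x := a)) \<phi> = sat M (e'(x := a)) \<phi>" for a
    by (rule Forall.IH) (use Forall.prems in auto)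
  then show ?case by simp
qed simp

lemma assignment_upd: "assignment M e \<Longrightarrow> a \<in> carr M \<Longrightarrow> assignment M (e(x := a))"
  by (auto simp: assignment_def)

lemma assignment_in: "assignment M e \<Longrightarrow> e x \<in> carr M"
  by (auto simp: assignment_def)

lemma eval_tm_in_carr:
  assumes "is_struc L M" "assignment M e" "wf_tm L t"
  shows "eval_tm M e t \<in> carr M"
  using assms(3)
proof (induction t)
  case (Var x)
  then show ?case using assms(2) by (simp add: assignment_in)
next
  case (Fn f ts)
  then have "set (map (eval_tm M e) ts) \<subseteq> carr M"
    by (auto simp: list_all_iff)
  moreover have "fun_ar L f = Some (length (map (eval_tm M e) ts))" using Fn.prems by simp
  ultimately show ?case using assms(1) unfolding is_struc_def eval_tm.simps by blast
qed

lemma sat_foldr_Forall: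
  assumes "carr M \<noteq> {}"
  shows "(\<forall>e. assignment M e \<longrightarrow> sat M e (foldr Forall xs \<phi>)) \<longleftrightarrow> (\<forall>e. assignment M e \<longrightarrow> sat M e \<phi>)"
proof (induction xs)
  case (Cons x xs)
  have "(\<forall>e. assignment M e \<longrightarrow> sat M e (Forall x \<psi>)) \<longleftrightarrow> (\<forall>e. assignment M e \<longrightarrow> sat M e \<psi>)" for \<psi>
    by (metis assignment_in assignment_upd fun_upd_triv sat.simps(5))
  with Cons show ?case by simp
qed simp

lemma sat_univ_closure:
  assumes "carr M \<noteq> {}"
  shows "(\<forall>e. assignment M e \<longrightarrow> sat M e (univ_closure \<phi>)) \<longleftrightarrow> (\<forall>e. assignment M e \<longrightarrow> sat M e \<phi>)"
  unfolding univ_closure_def by (rule sat_foldr_Forall[OF assms])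

lemma sat_Conjs: "sat M e (Conjs \<phi>s) \<longleftrightarrow> (\<forall>\<phi> \<in> set \<phi>s. sat M e \<phi>)"
  unfolding Conjs_def by (induction \<phi>s) auto

section \<open>Reducts to the old language\<close>

definition reduct :: "('f, ('k, 'p) grel, 'u) struc \<Rightarrow> ('f, 'p, 'u) struc" where
  "reduct M = \<lparr>carr = carr M, fun_int = fun_int M, rel_int = (\<lambda>p. rel_int M (Old p))\<rparr>"

lemma carr_reduct [simp]: "carr (reduct M) = carr M"
  and fun_int_reduct [simp]: "fun_int (reduct M) = fun_int M"
  by (simp_all add: reduct_def)

lemma assignment_reduct [simp]: "assignment (reduct M) e = assignment M e"
  by (simp add: assignment_def)

lemma eval_tm_reduct [simp]: "eval_tm (reduct M) e t = eval_tm M e t"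
  by (induction t) (auto intro!: arg_cong[where f = "fun_int M _"])

lemma sat_old: "sat M e (old \<phi>) = sat (reduct M) e \<phi>"
proof (induction \<phi> arbitrary: e)
  case (Rel p ts)
  have "map (eval_tm (reduct M) e) ts = map (eval_tm M e) ts" by simp
  moreover have "rel_int (reduct M) p as = rel_int M (Old p) as" for as by (simp add: reduct_def)
  ultimately show ?case by (simp only: sat.simps fm.map tm.map_id0) simp
qed (simp_all add: tm.map_id0)


section \<open>Downward Loewenheim-Skolem\<close>

text \<open>Terms for the Skolem hull of a sequence: \<open>Base n\<close> names its
  \<open>n\<close>-th member, and \<open>Wit \<phi> x ts\<close> names a solution of
  \<open>\<phi>\<close> in \<open>x\<close>, where variable \<open>i\<close> takes the value of the
  \<open>i\<close>-th term of \<open>ts\<close>.\<close>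

datatype ('f, 'p) skolem = Base nat | Wit "('f, 'p) fm" nat "('f, 'p) skolem list"

text \<open>Skolem terms are coded by formulas because an injection from formulas is what
  \<open>large_type\<close> provides; this works for languages of any cardinality. The outermost
  connective separates the two constructors, and \<open>Bot\<close> marks the end of the argument
  list.\<close>

primrec code :: "('f, 'p) skolem \<Rightarrow> ('f, 'p) fm" where
  "code (Base n) = Forall n Bot"
| "code (Wit \<phi> x ts) = Imp \<phi> (Forall x (foldr Imp (map code ts) Bot))"

lemma code_inject: "code s = code t \<Longrightarrow> s = t"
proof (induction s arbitrary: t)
  case (Base n)
  then show ?case by (cases t) auto
next
  case (Wit \<phi> x ss)
  then obtain ts where t: "t = Wit \<phi> x ts"
    and eq: "foldr Imp (map code ss) Bot = foldr Imp (map code ts) Bot"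
    by (cases t) auto
  have "ss = ts" using Wit.IH eq
  proof (induction ss arbitrary: ts)
    case Nil
    then show ?case by (cases ts) auto
  next
    case (Cons s ss)
    then show ?case by (cases ts) auto
  qed
  with t show ?case by simp
qed

definition list_env :: "'u \<Rightarrow> 'u list \<Rightarrow> nat \<Rightarrow> 'u" where
  "list_env d as i = (if i < length as then as ! i else d)"

text \<open>Missing variables and unsatisfiable formulas both fall back to \<open>c 0\<close>, so
  every term has a value in the carrier.\<close>

primrec skolem_val :: "('f, 'p, 'u) struc \<Rightarrow> (nat \<Rightarrow> 'u) \<Rightarrow> ('f, 'p) skolem \<Rightarrow> 'u" where
  "skolem_val M c (Base n) = c n"
| "skolem_val M c (Wit \<phi> x ts) =
     (let e = list_env (c 0) (map (skolem_val M c) ts) in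
      if \<exists>a \<in> carr M. sat M (e(x := a)) \<phi> then SOME a. a \<in> carr M \<and> sat M (e(x := a)) \<phi> else c 0)"

lemma skolem_val_in_carr:
  assumes "range c \<subseteq> carr M"
  shows "skolem_val M c t \<in> carr M"
proof (cases t)
  case (Base n)
  then show ?thesis using assms by auto
next
  case (Wit \<phi> x ts)
  let ?e = "list_env (c 0) (map (skolem_val M c) ts)"
  show ?thesis
  proof (cases "\<exists>a \<in> carr M. sat M (?e(x := a)) \<phi>")
    case True
    then have "(SOME a. a \<in> carr M \<and> sat M (?e(x := a)) \<phi>) \<in> carr M"
      by (metis (mono_tags, lifting) someI_ex)
    then show ?thesis using Wit True by (simp add: Let_def)
  next
    case False
    then show ?thesis using Wit assms by (auto simp: Let_def)
  qed
qed

text \<open>The Tarski-Vaught test for the hull. All values of \<open>e\<close> are values of terms,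
  and finitely many of these terms suffice, since \<open>n\<close> bounds the free variables of
  \<open>\<phi>\<close>.\<close>

lemma skolem_witness:
  assumes "range e \<subseteq> range (skolem_val M c)" "a \<in> carr M" "sat M (e(x := a)) \<phi>"
  obtains b where "b \<in> range (skolem_val M c)" "b \<in> carr M" "sat M (e(x := b)) \<phi>"
proof -
  have "\<exists>t. skolem_val M c t = e i" for i
  proof -
    have "e i \<in> range (skolem_val M c)" using assms(1) by blast
    then show ?thesis by (auto simp: image_iff)
  qed
  then obtain g where g: "\<And>i. skolem_val M c (g i) = e i" by metis
  define n where "n = Suc (Max (insert 0 (fv \<phi>)))"
  define ts where "ts = map g [0..<n]"
  let ?e = "list_env (c 0) (map (skolem_val M c) ts)"
  have "i < n" if "i \<in> fv \<phi>" for i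
    using that unfolding n_def by (simp add: le_imp_less_Suc)
  then have e: "?e i = e i" if "i \<in> fv \<phi>" for i
    using that g by (simp add: list_env_def ts_def)
  have sat: "sat M (?e(x := b)) \<phi> = sat M (e(x := b)) \<phi>" for b
    by (rule sat_cong) (simp add: e)
  have ex: "\<exists>a \<in> carr M. sat M (?e(x := a)) \<phi>" using assms(2,3) sat by blast
  let ?b = "SOME a. a \<in> carr M \<and> sat M (?e(x := a)) \<phi>"
  have b: "?b \<in> carr M \<and> sat M (?e(x := ?b)) \<phi>"
    by (rule someI_ex) (use ex in blast)
  have "skolem_val M c (Wit \<phi> x ts) = ?b" using ex by (simp add: Let_def)
  then have "?b \<in> range (skolem_val M c)" by (metis rangeI)
  then show thesis using that b by (simp only: sat)
qed

text \<open>Tarski-Vaught criterion for an injection \<open>h\<close> between structures on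
  different types: the embedding clauses give the atomic case and \<open>tv\<close> the
  quantifier.\<close>

lemma sat_pullback:
  fixes N :: "('f, 'p, 'u) struc" and M :: "('f, 'p, 'w) struc"
  assumes N: "is_struc L N"
    and h: "h ` carr N \<subseteq> carr M" "inj_on h (carr N)"
    and f: "\<And>f as. fun_ar L f = Some (length as) \<Longrightarrow> set as \<subseteq> carr N \<Longrightarrow>
              h (fun_int N f as) = fun_int M f (map h as)"
    and r: "\<And>p as. set as \<subseteq> carr N \<Longrightarrow> rel_int N p as = rel_int M p (map h as)"
    and tv: "\<And>e x a \<phi>. assignment N e \<Longrightarrow> a \<in> carr M \<Longrightarrow> sat M ((h \<circ> e)(x := a)) \<phi> \<Longrightarrow>
               \<exists>b \<in> carr N. sat M ((h \<circ> e)(x := h b)) \<phi>"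
  shows "wf_fm L \<phi> \<Longrightarrow> assignment N e \<Longrightarrow> sat N e \<phi> = sat M (h \<circ> e) \<phi>"
proof -
  have tm: "h (eval_tm N e t) = eval_tm M (h \<circ> e) t" if "wf_tm L t" "assignment N e" for t e
    using that
  proof (induction t)
    case (Fn g ts)
    then have ts: "list_all (wf_tm L) ts" by (simp add: list_all_iff)
    then have "set (map (eval_tm N e) ts) \<subseteq> carr N"
      using eval_tm_in_carr[OF N Fn.prems(2)] by (auto simp: list_all_iff)
    moreover have "map h (map (eval_tm N e) ts) = map (eval_tm M (h \<circ> e)) ts"
      unfolding map_map using Fn ts by (intro map_cong refl) (metis o_apply list_all_iff)
    ultimately show ?case using f[of g "map (eval_tm N e) ts"] Fn.prems
      by (metis eval_tm.simps(2) length_map wf_tm.simps(2))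
  qed simp
  show "wf_fm L \<phi> \<Longrightarrow> assignment N e \<Longrightarrow> sat N e \<phi> = sat M (h \<circ> e) \<phi>"
  proof (induction \<phi> arbitrary: e)
    case (Eq s t)
    then have "eval_tm N e s \<in> carr N" "eval_tm N e t \<in> carr N"
      using eval_tm_in_carr[OF N] by auto
    then show ?case using Eq tm[of s e] tm[of t e] h(2)
      by (metis inj_onD sat.simps(2) wf_fm.simps(2))
  next
    case (Rel p ts)
    have "set (map (eval_tm N e) ts) \<subseteq> carr N"
      using Rel eval_tm_in_carr[OF N Rel.prems(2)] by (auto simp: list_all_iff)
    moreover have "map h (map (eval_tm N e) ts) = map (eval_tm M (h \<circ> e)) ts"
      unfolding map_map using Rel tm by (intro map_cong refl) (metis o_apply list_all_iff wf_fm.simps(3))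
    ultimately show ?case using r by (metis sat.simps(3))
  next
    case (Forall x \<phi>)
    have upd: "(h \<circ> e)(x := h a) = h \<circ> e(x := a)" for a by auto
    have IH: "sat N (e(x := a)) \<phi> = sat M ((h \<circ> e)(x := h a)) \<phi>" if "a \<in> carr N" for a
      using Forall.IH[of "e(x := a)"] Forall.prems that by (simp only: upd assignment_upd wf_fm.simps)
    have "(\<forall>a\<in>carr M. sat M ((h \<circ> e)(x := a)) \<phi>) \<longleftrightarrow> (\<forall>b\<in>carr N. sat M ((h \<circ> e)(x := h b)) \<phi>)"
    proof
      assume "\<forall>b\<in>carr N. sat M ((h \<circ> e)(x := h b)) \<phi>"
      \<comment> \<open>A counterexample in \<open>M\<close> would satisfy
        \<open>Neg \<phi>\<close>, so \<open>tv\<close> would give one in the image of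
        \<open>h\<close>.\<close>
      then show "\<forall>a\<in>carr M. sat M ((h \<circ> e)(x := a)) \<phi>"
        using tv[OF Forall.prems(2), of _ x "Neg \<phi>"] by auto
    qed (use h(1) in auto)
    then show ?case unfolding sat.simps using IH by (auto simp only:)
  qed auto
qed

definition elementary ::
  "('f, 'p) lang \<Rightarrow> ('f, 'p, 'u) struc \<Rightarrow> ('f, 'p, 'w) struc \<Rightarrow> ('u \<Rightarrow> 'w) \<Rightarrow> bool" where
  "elementary L N M h \<longleftrightarrow> inj_on h (carr N) \<and> h ` carr N \<subseteq> carr M \<and>
     (\<forall>\<phi> e. wf_fm L \<phi> \<longrightarrow> assignment N e \<longrightarrow> sat N e \<phi> = sat M (h \<circ> e) \<phi>)"

theorem loewenheim_skolem:
  fixes M :: "('f, 'p, 'w) struc" and L :: "('f, 'p) lang"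
  assumes M: "is_struc L M" and large: "large_type TYPE('u) L" and C: "countable C" "C \<subseteq> carr M"
  obtains N :: "('f, 'p, 'u) struc" and h :: "'u \<Rightarrow> 'w"
  where "is_struc L N" "elementary L N M h" "C \<subseteq> h ` carr N"
proof -
  obtain d where d: "d \<in> carr M" using M by (auto simp: is_struc_def)
  \<comment> \<open>The extra point \<open>d\<close> makes the set to be enumerated
    nonempty.\<close>
  obtain c :: "nat \<Rightarrow> 'w" where c: "range c = insert d C"
    using C(1) by (metis countable_insert insert_not_empty uncountable_def)
  let ?D = "range (skolem_val M c)"
  have DM: "?D \<subseteq> carr M" using skolem_val_in_carr[of c M] c d C(2) by auto
  have CD: "C \<subseteq> ?D" 
  proof
    fix a assume "a \<in> C"
    then obtain n where "a = skolem_val M c (Base n)" using c by (metis insertCI rangeE skolem_val.simps(1))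
    then show "a \<in> ?D" by blast
  qed
  obtain j :: "('f, 'p) fm \<Rightarrow> 'u" where j: "inj j" using large by (auto simp: large_type_def)
  \<comment> \<open>\<open>g\<close> sends a member of the hull to the code of one chosen term for
    it; \<open>N\<close> is the hull transported along \<open>g\<close>.\<close>
  define g :: "'w \<Rightarrow> 'u" where "g a = j (code (SOME t. skolem_val M c t = a))" for a
  have g: "inj_on g ?D"
  proof (rule inj_onI)
    fix a b assume ab: "a \<in> ?D" "b \<in> ?D" "g a = g b"
    then have "(SOME t. skolem_val M c t = a) = (SOME t. skolem_val M c t = b)"
      using j code_inject unfolding g_def by (metis injD)
    moreover have "skolem_val M c (SOME t. skolem_val M c t = a) = a" if "a \<in> ?D" for a
      by (rule someI_ex) (use that in auto)
    ultimately show "a = b" using ab by metis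
  qed
  define h where "h = the_inv_into ?D g"
  have hg: "h (g a) = a" if "a \<in> ?D" for a
    using that g by (simp add: h_def the_inv_into_f_f)
  define N :: "('f, 'p, 'u) struc" where
    "N = \<lparr>carr = g ` ?D, fun_int = (\<lambda>f as. g (fun_int M f (map h as))),
          rel_int = (\<lambda>p as. rel_int M p (map h as))\<rparr>"
  have hN: "h ` carr N = ?D" using hg by (auto simp: N_def image_iff)
  have inj: "inj_on h (carr N)" using hg by (auto simp: N_def inj_on_def)
  \<comment> \<open>Closure under functions needs no constructor of its own: the value is the only
    solution of \<open>?\<phi>\<close> in the variable \<open>?n\<close>, and the hull contains a
    solution.\<close>
  have fD: "fun_int M f as \<in> ?D" if f: "fun_ar L f = Some (length as)" "set as \<subseteq> ?D" for f as
  proof -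
    let ?n = "length as"
    let ?e = "list_env (c 0) as"
    let ?\<phi> = "Eq (Var ?n) (Fn f (map Var [0..<?n]))"
    have e: "range ?e \<subseteq> ?D"
    proof -
      have "c 0 \<in> ?D" using skolem_val.simps(1) by (metis rangeI)
      then show ?thesis using f(2) by (auto simp: list_env_def)
    qed
    have as: "map (eval_tm M (?e(?n := a))) (map Var [0..<?n]) = as" for a
      by (rule nth_equalityI) (auto simp: list_env_def)
    have "fun_int M f as \<in> carr M" using M f DM by (auto simp: is_struc_def)
    moreover have sat: "sat M (?e(?n := a)) ?\<phi> \<longleftrightarrow> a = fun_int M f as" for a
      using as[of a] by simp
    ultimately obtain b where "b \<in> ?D" "sat M (?e(?n := b)) ?\<phi>"
      using skolem_witness[OF e] by (metis (no_types, lifting))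
    then show ?thesis using sat by auto
  qed
  have hset: "set (map h as) \<subseteq> ?D" if "set as \<subseteq> carr N" for as
    using that hN by auto
  have N: "is_struc L N"
    unfolding is_struc_def using fD hset by (auto simp: N_def)
  have "elementary L N M h"
    unfolding elementary_def
  proof (intro conjI allI impI inj)
    show "sat N e \<phi> = sat M (h \<circ> e) \<phi>" if "wf_fm L \<phi>" "assignment N e" for \<phi> e
    proof (rule sat_pullback[OF N _ inj _ _ _ that])
      show "h ` carr N \<subseteq> carr M" using hN DM by simp
      show "h (fun_int N f as) = fun_int M f (map h as)"
        if "fun_ar L f = Some (length as)" "set as \<subseteq> carr N" for f as
        using fD[of f "map h as"] that hset[of as] hg by (simp add: N_def)
      show "rel_int N p as = rel_int M p (map h as)" for p as by (simp add: N_def)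
      show "\<exists>b\<in>carr N. sat M ((h \<circ> e)(x := h b)) \<phi>"
        if "assignment N e" "a \<in> carr M" "sat M ((h \<circ> e)(x := a)) \<phi>" for e x a \<phi>
      proof -
        have "range (h \<circ> e) \<subseteq> ?D" using that(1) hN by (auto simp: assignment_def)
        from skolem_witness[OF this that(2,3)] obtain b where "b \<in> ?D" "sat M ((h \<circ> e)(x := b)) \<phi>" .
        then show ?thesis using hN by (metis imageE)
      qed
    qed
  qed (use hN DM in auto)
  then show thesis using that N hN CD by simp
qed

section \<open>Ultrapowers\<close>

definition ultra :: "'i filter \<Rightarrow> bool" where
  "ultra F \<longleftrightarrow> F \<noteq> bot \<and> (\<forall>P. eventually P F \<or> eventually (\<lambda>i. \<not> P i) F)"

lemma ultra_not_eventually: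
  "ultra F \<Longrightarrow> \<not> eventually P F \<longleftrightarrow> eventually (\<lambda>i. \<not> P i) F"
  unfolding ultra_def using eventually_conj_iff[of P "\<lambda>i. \<not> P i" F]
  by (auto simp: trivial_limit_def)

text \<open>Refining a filter makes it smaller in the order on filters, so ultrafilters are the
  minimal proper filters and Zorn's lemma is applied to the reverse order.\<close>

lemma ultra_exists:
  fixes F :: "'i filter"
  assumes "F \<noteq> bot"
  obtains U where "U \<le> F" "ultra U"
proof -
  let ?A = "{G. G \<le> F \<and> G \<noteq> bot}"
  have "\<exists>U \<in> ?A. \<forall>G \<in> ?A. U \<ge> G \<longrightarrow> G = U"
  proof (rule predicate_Zorn)
    show "partial_order_on ?A (relation_of (\<ge>) ?A)"
      by (rule partial_order_on_relation_ofI) auto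
    fix C assume C: "C \<in> Chains (relation_of (\<ge>) ?A)"
    then have CA: "C \<subseteq> ?A" by (auto simp: Chains_def relation_of_def)
    show "\<exists>u \<in> ?A. \<forall>a \<in> C. a \<ge> u"
    proof (cases "C = {}")
      case False
      \<comment> \<open>A chain is directed, so what holds eventually for its infimum already does
        for a member; hence the infimum is proper.\<close>
      have "eventually (\<lambda>_. False) (Inf C) \<longleftrightarrow> (\<exists>G \<in> C. eventually (\<lambda>_. False) G)"
      proof (rule eventually_Inf_base[OF False])
        show "\<exists>x \<in> C. x \<le> inf G G'" if "G \<in> C" "G' \<in> C" for G G'
          using C that by (auto simp: Chains_def relation_of_def)
      qed
      then have "Inf C \<noteq> bot" using CA by (auto simp: trivial_limit_def)
      moreover have "Inf C \<le> F" 
      proof -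
        obtain G where "G \<in> C" using False by blast
        then show ?thesis using CA by (intro Inf_lower2[of G]) auto
      qed
      ultimately show ?thesis by (auto intro: Inf_lower)
    qed (use assms in auto)
  qed
  then obtain U where U: "U \<le> F" "U \<noteq> bot" and max: "\<And>G. G \<le> F \<Longrightarrow> G \<noteq> bot \<Longrightarrow> G \<le> U \<Longrightarrow> G = U"
    by auto
  have "eventually P U" if "\<not> eventually (\<lambda>i. \<not> P i) U" for P
  proof -
    \<comment> \<open>Restricting \<open>U\<close> to \<open>P\<close> keeps it proper, so
      minimality returns \<open>U\<close> itself.\<close>
    have "inf U (principal {i. P i}) \<noteq> bot"
      using that by (simp add: trivial_limit_def eventually_inf_principal)
    then have eq: "inf U (principal {i. P i}) = U" by (rule max[rotated]) (use U(1) in \<open>auto intro: le_infI1\<close>)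
    have "eventually P (inf U (principal {i. P i}))" by (simp add: eventually_inf_principal)
    then show ?thesis by (simp only: eq)
  qed
  with U that show thesis by (auto simp: ultra_def)
qed

text \<open>\<open>sat\<close> interprets equality by equality of HOL, so each class of functions
  must be replaced by a single function. The choice depends on the class alone
  (\<open>ultra_rep_eq\<close>).\<close>

definition ultra_rep :: "'i filter \<Rightarrow> ('f, 'p, 'u) struc \<Rightarrow> ('i \<Rightarrow> 'u) \<Rightarrow> 'i \<Rightarrow> 'u" where
  "ultra_rep F M a = (SOME b. range b \<subseteq> carr M \<and> eventually (\<lambda>i. b i = a i) F)"

text \<open>The carrier consists of one chosen representative of each class of functions.\<close>

definition ultrapower :: "'i filter \<Rightarrow> ('f, 'p, 'u) struc \<Rightarrow> ('f, 'p, 'i \<Rightarrow> 'u) struc" where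
  "ultrapower F M = \<lparr>carr = ultra_rep F M ` {a. range a \<subseteq> carr M},
     fun_int = (\<lambda>f as. ultra_rep F M (\<lambda>i. fun_int M f (map (\<lambda>a. a i) as))),
     rel_int = (\<lambda>p as. eventually (\<lambda>i. rel_int M p (map (\<lambda>a. a i) as)) F)\<rparr>"

lemma ultra_rep:
  assumes "range a \<subseteq> carr M"
  shows "range (ultra_rep F M a) \<subseteq> carr M" "eventually (\<lambda>i. ultra_rep F M a i = a i) F"
proof -
  have "range (ultra_rep F M a) \<subseteq> carr M \<and> eventually (\<lambda>i. ultra_rep F M a i = a i) F"
    unfolding ultra_rep_def by (rule someI[of _ a]) (use assms in auto)
  then show "range (ultra_rep F M a) \<subseteq> carr M" "eventually (\<lambda>i. ultra_rep F M a i = a i) F"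
    by auto
qed

lemma ultra_rep_eq:
  assumes "eventually (\<lambda>i. a i = b i) F"
  shows "ultra_rep F M a = ultra_rep F M b"
proof -
  have "eventually (\<lambda>i. c i = a i) F \<longleftrightarrow> eventually (\<lambda>i. c i = b i) F" for c
    using assms by (auto elim: eventually_elim2)
  then show ?thesis by (simp add: ultra_rep_def)
qed

lemma ultrapower_range: "a \<in> carr (ultrapower F M) \<Longrightarrow> a i \<in> carr M"
  using ultra_rep(1) by (fastforce simp: ultrapower_def)

lemma fun_int_ultrapower:
    "fun_int (ultrapower F M) f as = ultra_rep F M (\<lambda>i. fun_int M f (map (\<lambda>a. a i) as))"
  and rel_int_ultrapower:
    "rel_int (ultrapower F M) p as \<longleftrightarrow> eventually (\<lambda>i. rel_int M p (map (\<lambda>a. a i) as)) F"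
  by (simp_all add: ultrapower_def)

lemma is_struc_ultrapower:
  assumes "is_struc L M"
  shows "is_struc L (ultrapower F M)"
  unfolding is_struc_def
proof (intro conjI allI impI)
  show "carr (ultrapower F M) \<noteq> {}"
  proof -
    obtain d where "d \<in> carr M" using assms by (auto simp: is_struc_def)
    then have "range (\<lambda>_. d) \<subseteq> carr M" by auto
    then show ?thesis unfolding ultrapower_def by (auto intro: exI[of _ "\<lambda>_. d"])
  qed
  fix f as
  assume as: "fun_ar L f = Some (length as)" "set as \<subseteq> carr (ultrapower F M)"
  have "fun_int M f (map (\<lambda>a. a i) as) \<in> carr M" for i
  proof -
    have "set (map (\<lambda>a. a i) as) \<subseteq> carr M" using as(2) ultrapower_range by fastforce
    then show ?thesis using assms as(1) unfolding is_struc_def by (metis length_map)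
  qed
  then show "fun_int (ultrapower F M) f as \<in> carr (ultrapower F M)"
    by (auto simp: ultrapower_def)
qed

lemma los_tm:
  assumes M: "is_struc L M" and e: "assignment (ultrapower F M) e" and "wf_tm L t"
  shows "eventually (\<lambda>i. eval_tm (ultrapower F M) e t i = eval_tm M (\<lambda>n. e n i) t) F"
  using assms(3)
proof (induction t)
  case (Fn f ts)
  let ?P = "ultrapower F M"
  have ts: "wf_tm L t" if "t \<in> set ts" for t using Fn.prems that by (simp add: list_all_iff)
  have in_P: "eval_tm ?P e t \<in> carr ?P" if "t \<in> set ts" for t
    using eval_tm_in_carr[OF is_struc_ultrapower[OF M] e] ts[OF that] .
  let ?a = "\<lambda>i. fun_int M f (map (\<lambda>a. a i) (map (eval_tm ?P e) ts))"
  have "?a i \<in> carr M" for i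
  proof -
    have "set (map (\<lambda>a. a i) (map (eval_tm ?P e) ts)) \<subseteq> carr M"
      using in_P ultrapower_range by fastforce
    moreover have "fun_ar L f = Some (length (map (\<lambda>a. a i) (map (eval_tm ?P e) ts)))"
      using Fn.prems by simp
    ultimately show ?thesis using M unfolding is_struc_def by blast
  qed
  then have "range ?a \<subseteq> carr M" by auto
  note rep = ultra_rep(2)[OF this, of F]
  have "eventually (\<lambda>i. \<forall>t \<in> set ts. eval_tm ?P e t i = eval_tm M (\<lambda>n. e n i) t) F"
    using Fn.IH ts by (intro eventually_ball_finite) auto
  with rep show ?case
  proof eventually_elim
    case (elim i)
    have "map (\<lambda>a. a i) (map (eval_tm ?P e) ts) = map (eval_tm M (\<lambda>n. e n i)) ts"
      using elim(2) by simp
    then show ?case using elim(1) by (simp only: eval_tm.simps fun_int_ultrapower)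
  qed
qed simp

theorem los:
  assumes U: "ultra F" and M: "is_struc L M"
  shows "wf_fm L \<phi> \<Longrightarrow> assignment (ultrapower F M) e \<Longrightarrow>
    sat (ultrapower F M) e \<phi> \<longleftrightarrow> eventually (\<lambda>i. sat M (\<lambda>n. e n i) \<phi>) F"
proof (induction \<phi> arbitrary: e)
  case Bot
  then show ?case using U by (auto simp: ultra_def trivial_limit_def)
next
  case (Eq s t)
  let ?P = "ultrapower F M"
  have "eval_tm ?P e s = eval_tm ?P e t \<longleftrightarrow> eventually (\<lambda>i. eval_tm ?P e s i = eval_tm ?P e t i) F"
  proof
    assume *: "eventually (\<lambda>i. eval_tm ?P e s i = eval_tm ?P e t i) F"
    have "eval_tm ?P e s \<in> carr ?P" "eval_tm ?P e t \<in> carr ?P"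
      using eval_tm_in_carr[OF is_struc_ultrapower[OF M] Eq.prems(2)] Eq.prems(1) by auto
    then obtain a b where ab: "range a \<subseteq> carr M" "eval_tm ?P e s = ultra_rep F M a"
      "range b \<subseteq> carr M" "eval_tm ?P e t = ultra_rep F M b"
      by (auto simp: ultrapower_def)
    have "eventually (\<lambda>i. a i = b i) F"
      using * ultra_rep(2)[OF ab(1), of F] ultra_rep(2)[OF ab(3), of F] unfolding ab(2,4)
      by eventually_elim simp
    then show "eval_tm ?P e s = eval_tm ?P e t" using ab ultra_rep_eq by metis
  qed auto
  also have "\<dots> \<longleftrightarrow> eventually (\<lambda>i. sat M (\<lambda>n. e n i) (Eq s t)) F"
  proof (rule eventually_subst)
    have "wf_tm L s" "wf_tm L t" using Eq.prems(1) by auto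
    from los_tm[OF M Eq.prems(2) this(1)] los_tm[OF M Eq.prems(2) this(2)]
    show "eventually (\<lambda>i. (eval_tm ?P e s i = eval_tm ?P e t i) = sat M (\<lambda>n. e n i) (Eq s t)) F"
      by eventually_elim simp
  qed
  finally show ?case by simp
next
  case (Rel p ts)
  let ?P = "ultrapower F M"
  have "eventually (\<lambda>i. \<forall>t \<in> set ts. eval_tm ?P e t i = eval_tm M (\<lambda>n. e n i) t) F"
    using Rel los_tm[OF M Rel.prems(2)] by (intro eventually_ball_finite) (auto simp: list_all_iff)
  then have "eventually (\<lambda>i. rel_int M p (map (\<lambda>a. a i) (map (eval_tm ?P e) ts))
      = sat M (\<lambda>n. e n i) (Rel p ts)) F"
  proof eventually_elim
    case (elim i)
    have "map (\<lambda>a. a i) (map (eval_tm ?P e) ts) = map (eval_tm M (\<lambda>n. e n i)) ts"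
      using elim by simp
    then show ?case by (simp only: sat.simps)
  qed
  then have "eventually (\<lambda>i. rel_int M p (map (\<lambda>a. a i) (map (eval_tm ?P e) ts))) F
      \<longleftrightarrow> eventually (\<lambda>i. sat M (\<lambda>n. e n i) (Rel p ts)) F"
    by (rule eventually_subst)
  then show ?case by (simp only: sat.simps rel_int_ultrapower)
next
  case (Imp \<phi> \<psi>)
  have "eventually (\<lambda>i. A i \<longrightarrow> B i) F \<longleftrightarrow> (eventually A F \<longrightarrow> eventually B F)" for A B
  proof
    assume "eventually A F \<longrightarrow> eventually B F"
    then have "eventually (\<lambda>i. \<not> A i) F \<or> eventually B F" using U ultra_not_eventually by blast
    then show "eventually (\<lambda>i. A i \<longrightarrow> B i) F" by (auto elim: eventually_mono)
  qed (auto elim: eventually_mp)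
  then show ?case using Imp by simp
next
  case (Forall x \<phi>)
  let ?P = "ultrapower F M"
  have upd: "(\<lambda>n. (e(x := a)) n i) = (\<lambda>n. e n i)(x := a i)" for a i by auto
  have IH: "sat ?P (e(x := a)) \<phi> \<longleftrightarrow> eventually (\<lambda>i. sat M ((\<lambda>n. e n i)(x := a i)) \<phi>) F"
    if "a \<in> carr ?P" for a
    using Forall.IH[of "e(x := a)"] Forall.prems that unfolding upd
    by (simp only: assignment_upd wf_fm.simps)
  have "(\<forall>a \<in> carr ?P. eventually (\<lambda>i. sat M ((\<lambda>n. e n i)(x := a i)) \<phi>) F) \<longleftrightarrow>
      eventually (\<lambda>i. sat M (\<lambda>n. e n i) (Forall x \<phi>)) F" (is "?l \<longleftrightarrow> ?r")
  proof
    assume ?r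
    then show ?l by (auto elim!: eventually_mono simp: ultrapower_range)
  next
    assume l: ?l
    show ?r
    proof (rule ccontr)
      assume "\<not> ?r"
      then have ev: "eventually (\<lambda>i. \<exists>b \<in> carr M. \<not> sat M ((\<lambda>n. e n i)(x := b)) \<phi>) F"
        using ultra_not_eventually[OF U] by simp
      obtain d where d: "d \<in> carr M" using M by (auto simp: is_struc_def)
      \<comment> \<open>Counterexamples are chosen index by index, with \<open>d\<close> where there
        is none, and assembled into one element of the ultrapower.\<close>
      have "\<exists>b. b \<in> carr M \<and> ((\<exists>b \<in> carr M. \<not> sat M ((\<lambda>n. e n i)(x := b)) \<phi>) \<longrightarrow>
          \<not> sat M ((\<lambda>n. e n i)(x := b)) \<phi>)" for i
        using d by blast
      then obtain a where a: "\<And>i. a i \<in> carr M"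
        "\<And>i. \<exists>b \<in> carr M. \<not> sat M ((\<lambda>n. e n i)(x := b)) \<phi> \<Longrightarrow> \<not> sat M ((\<lambda>n. e n i)(x := a i)) \<phi>"
        by metis
      then have ra: "range a \<subseteq> carr M" by auto
      then have "ultra_rep F M a \<in> carr ?P" by (auto simp: ultrapower_def)
      with l have "eventually (\<lambda>i. sat M ((\<lambda>n. e n i)(x := ultra_rep F M a i)) \<phi>) F" by blast
      with ev ultra_rep(2)[OF ra, of F] have "eventually (\<lambda>_. False) F"
        by eventually_elim (use a in auto)
      then show False using U by (auto simp: ultra_def trivial_limit_def)
    qed
  qed
  then show ?case using IH by simp
qed


section \<open>Transfer to models in the other universes\<close>

lemma models_elementary:
  assumes "is_theory L T" "models L M T" "is_struc L N" "elementary L N M h"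
  shows "models L N T"
  unfolding models_def
proof (intro conjI ballI allI impI assms(3))
  fix \<sigma> e assume \<sigma>: "\<sigma> \<in> T" and e: "assignment N e"
  then have "assignment M (h \<circ> e)" using assms(4) by (auto simp: assignment_def elementary_def)
  then have "sat M (h \<circ> e) \<sigma>" using assms(2) \<sigma> by (simp add: models_def)
  moreover have "wf_fm L \<sigma>" using assms(1) \<sigma> by (simp add: is_theory_def sentence_def)
  ultimately show "sat N e \<sigma>" using assms(4) e by (simp add: elementary_def)
qed

lemma models_ultrapower:
  assumes "is_theory L T" "models L M T" "ultra F"
  shows "models L (ultrapower F M) T"
  unfolding models_def
proof (intro conjI ballI allI impI)
  have M: "is_struc L M" using assms(2) by (simp add: models_def)
  then show "is_struc L (ultrapower F M)" by (rule is_struc_ultrapower)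
  fix \<sigma> e assume \<sigma>: "\<sigma> \<in> T" and e: "assignment (ultrapower F M) e"
  have "sat M (\<lambda>n. e n i) \<sigma>" for i
  proof -
    have "assignment M (\<lambda>n. e n i)"
      using ultrapower_range[OF assignment_in[OF e]] by (auto simp: assignment_def)
    then show ?thesis using assms(2) \<sigma> by (simp add: models_def)
  qed
  moreover have "wf_fm L \<sigma>" using assms(1) \<sigma> by (auto simp: is_theory_def sentence_def)
  ultimately show "sat (ultrapower F M) e \<sigma>" using los[OF assms(3) M _ e] by auto
qed

text \<open>\<open>U\<close> is the type over which the hypotheses on \<open>T\<close> quantify.
  This locale extends such hypotheses to models over arbitrary types.\<close>

locale large_theory =
  fixes U :: "'u itself" and L :: "('f, 'p) lang" and T :: "('f, 'p) fm set"
  assumes sentences: "is_theory L T" and large: "large_type U L"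
begin

lemma small_model:
  fixes M :: "('f, 'p, 'w) struc"
  assumes "models L M T" "countable C" "C \<subseteq> carr M"
  obtains N :: "('f, 'p, 'u) struc" and h :: "'u \<Rightarrow> 'w"
  where "models L N T" "elementary L N M h" "C \<subseteq> h ` carr N"
proof -
  have M: "is_struc L M" using assms(1) by (simp add: models_def)
  have "large_type TYPE('u) L" using large by (simp add: large_type_def)
  then obtain N :: "('f, 'p, 'u) struc" and h :: "'u \<Rightarrow> 'w"
    where N: "is_struc L N" "elementary L N M h" "C \<subseteq> h ` carr N"
    by (rule loewenheim_skolem[OF M _ assms(2,3)])
  show thesis by (rule that[OF models_elementary[OF sentences assms(1) N(1,2)] N(2,3)])
qed

lemma small_model_assignment:
  fixes M :: "('f, 'p, 'w) struc"
  assumes "models L M T" "assignment M e" "countable C" "C \<subseteq> carr M"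
  obtains N :: "('f, 'p, 'u) struc" and h :: "'u \<Rightarrow> 'w" and e'
  where "models L N T" "elementary L N M h" "C \<subseteq> h ` carr N" "assignment N e'" "h \<circ> e' = e"
proof -
  have "countable (C \<union> range e)" "C \<union> range e \<subseteq> carr M"
    using assms by (auto simp: assignment_def)
  then obtain N :: "('f, 'p, 'u) struc" and h :: "'u \<Rightarrow> 'w"
    where N: "models L N T" "elementary L N M h" "C \<union> range e \<subseteq> h ` carr N"
    by (rule small_model[OF assms(1)])
  have "\<exists>a. a \<in> carr N \<and> h a = e n" for n
  proof -
    have "e n \<in> h ` carr N" using N(3) by blast
    then show ?thesis by auto
  qed
  then obtain e' where "\<And>n. e' n \<in> carr N \<and> h (e' n) = e n" by metis
  then have "assignment N e'" "h \<circ> e' = e" by (auto simp: assignment_def)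
  then show thesis using that[OF N(1,2)] N(3) by simp
qed

lemma entails_sat:
  fixes M :: "('f, 'p, 'w) struc"
  assumes "models L M T" "entails U L T \<phi>" "wf_fm L \<phi>" "assignment M e"
  shows "sat M e \<phi>"
proof -
  obtain N :: "('f, 'p, 'u) struc" and h e'
    where N: "models L N T" "elementary L N M h" "assignment N e'" "h \<circ> e' = e"
    by (rule small_model_assignment[OF assms(1,4), of "{}"]) auto
  then have "sat N e' \<phi>" using assms(2) by (simp add: entails_def)
  moreover have "sat N e' \<phi> = sat M (h \<circ> e') \<phi>" using N assms(3) by (simp add: elementary_def)
  ultimately show ?thesis by (simp only: N(4))
qed

end

lemma solutions_elementary:
  assumes "elementary L N M h" "wf_fm L \<phi>" "assignment N e"
  shows "h ` solutions N e x \<phi> = solutions M (h \<circ> e) x \<phi> \<inter> h ` carr N"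
proof -
  have "sat N (e(x := a)) \<phi> = sat M ((h \<circ> e)(x := h a)) \<phi>" if "a \<in> carr N" for a
  proof -
    have "h \<circ> e(x := a) = (h \<circ> e)(x := h a)" by auto
    moreover have "sat N (e(x := a)) \<phi> = sat M (h \<circ> e(x := a)) \<phi>"
      using assms assignment_upd[OF assms(3) that] by (simp add: elementary_def)
    ultimately show ?thesis by simp
  qed
  moreover have "h ` carr N \<subseteq> carr M" using assms(1) by (simp add: elementary_def)
  ultimately show ?thesis unfolding solutions_def by blast
qed

lemma (in large_theory) expresses_inf_iff:
  fixes M :: "('f, 'p, 'w) struc"
  assumes "models L M T" "wf_fm L \<phi>" "expresses_inf U L T x \<phi> \<theta>" "assignment M e"
  shows "sat M e \<theta> \<longleftrightarrow> infinite (solutions M e x \<phi>)"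
proof -
  \<comment> \<open>Keeping an infinite set \<open>C\<close> of solutions in the small model lets
    infinitude pass down directly, without formulas that count solutions; it passes up because
    \<open>h\<close> is injective.\<close>
  have "\<exists>C. countable C \<and> C \<subseteq> solutions M e x \<phi> \<and> (infinite (solutions M e x \<phi>) \<longrightarrow> infinite C)"
    using infinite_countable_subset'[of "solutions M e x \<phi>"]
    by (cases "finite (solutions M e x \<phi>)") (auto intro: exI[of _ "{}"])
  then obtain C where C: "countable C" "C \<subseteq> solutions M e x \<phi>"
    "infinite (solutions M e x \<phi>) \<Longrightarrow> infinite C" by blast
  then have "C \<subseteq> carr M" by (auto simp: solutions_def)
  then obtain N :: "('f, 'p, 'u) struc" and h e'
    where N: "models L N T" "elementary L N M h" "C \<subseteq> h ` carr N"
      "assignment N e'" "h \<circ> e' = e"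
    by (rule small_model_assignment[OF assms(1,4) C(1)])
  have sol: "h ` solutions N e' x \<phi> = solutions M e x \<phi> \<inter> h ` carr N"
    using solutions_elementary[OF N(2) assms(2) N(4), of x] unfolding N(5) .
  have "sat N e' \<theta> = sat M (h \<circ> e') \<theta>"
    using N(2,4) assms(3) by (simp add: elementary_def expresses_inf_def)
  then have "sat M e \<theta> \<longleftrightarrow> sat N e' \<theta>" unfolding N(5) by simp
  also have "\<dots> \<longleftrightarrow> infinite (solutions N e' x \<phi>)"
    using assms(3) N(1,4) by (simp add: expresses_inf_def)
  also have "\<dots> \<longleftrightarrow> infinite (h ` solutions N e' x \<phi>)"
  proof -
    have "inj_on h (solutions N e' x \<phi>)"
      using N(2) inj_on_subset[of h "carr N" "solutions N e' x \<phi>"]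
      by (simp add: elementary_def solutions_def)
    then show ?thesis by (simp add: finite_image_iff)
  qed
  also have "\<dots> \<longleftrightarrow> infinite (solutions M e x \<phi>)"
  proof -
    have "C \<subseteq> solutions M e x \<phi> \<inter> h ` carr N" using C(2) N(3) by blast
    then show ?thesis unfolding sol using C(3) finite_subset finite_Int by blast
  qed
  finally show ?thesis .
qed

section \<open>Linear terms\<close>

text \<open>\<open>lin \<tau> c\<close>: the term \<open>\<tau>\<close> is linear, and \<open>c d\<close> is its value at \<open>d\<close> in the vector space \<open>'k\<close>.\<close>

inductive lin :: "('k::field msym + 'f) tm \<Rightarrow> ((nat \<Rightarrow> 'k) \<Rightarrow> 'k) \<Rightarrow> bool" where
  lin_Var: "lin (Var x) (\<lambda>d. d x)"
| lin_zero: "lin zero_tm (\<lambda>d. 0)"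
| lin_plus: "lin s b \<Longrightarrow> lin t c \<Longrightarrow> lin (plus_tm s t) (\<lambda>d. b d + c d)"
| lin_scal: "lin t c \<Longrightarrow> lin (scal_tm a t) (\<lambda>d. a * c d)"

lemma lin_wf: "lin \<tau> c \<Longrightarrow> extends_vs_lang L \<Longrightarrow> wf_tm L \<tau>"
  by (induction rule: lin.induct) (simp_all add: extends_vs_lang_def numeral_2_eq_2)

lemma vspan_lin:
  assumes "b \<in> vspan M (e ` Y)"
  obtains \<tau> c where "lin \<tau> c" "fv_tm \<tau> \<subseteq> Y" "b = eval_tm M e \<tau>"
  using assms
proof (induction arbitrary: thesis)
  case (base a)
  then obtain y where "y \<in> Y" "a = e y" by auto
  then show ?case using base(2)[OF lin_Var[of y]] by simp
next
  case zero
  then show ?case using zero[OF lin_zero] by simp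
next
  case (plus a b)
  obtain s c where s: "lin s c" "fv_tm s \<subseteq> Y" "a = eval_tm M e s" using plus.IH(1) by blast
  obtain t d where t: "lin t d" "fv_tm t \<subseteq> Y" "b = eval_tm M e t" using plus.IH(2) by blast
  show ?case using plus.prems[OF lin_plus[OF s(1) t(1)]] s t by simp
next
  case (scal a k)
  obtain s c where s: "lin s c" "fv_tm s \<subseteq> Y" "a = eval_tm M e s" using scal.IH by blast
  show ?case using scal.prems[OF lin_scal[OF s(1), of k]] s by simp
qed

locale vs_theory = large_theory U L T
  for U :: "'u itself" and L :: "('k::field msym + 'f, 'p) lang" and T :: "('k msym + 'f, 'p) fm set" +
  assumes vs_lang: "extends_vs_lang L"
    and vs: "expands_vs U L T"
    and elim_inf: "eliminates_inf U L T"
    and closures: "closures_are_span U L T"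
begin

text \<open>In a small model the parameters and \<open>a\<close> have preimages, and there
  algebraicity yields a linear term. The equation with that term is a formula of the language and so
  passes to \<open>M\<close>.\<close>

lemma finite_solutions_lin:
  fixes M :: "('k msym + 'f, 'p, 'w) struc"
  assumes M: "models L M T" and \<phi>: "wf_fm L \<phi>" and e: "assignment M e"
    and fin: "finite (solutions M e x \<phi>)" and a: "a \<in> solutions M e x \<phi>"
  obtains \<tau> c where "lin \<tau> c" "fv_tm \<tau> \<subseteq> fv \<phi> - {x}" "a = eval_tm M e \<tau>"
proof -
  \<comment> \<open>Storing \<open>a\<close> in \<open>x\<close> lets it be pulled back together
    with the parameters; the solution set ignores the value at \<open>x\<close>.\<close>
  let ?e = "e(x := a)"
  have e1: "assignment M ?e" using e a by (simp add: assignment_upd solutions_def)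
  have sol: "solutions M ?e x \<phi> = solutions M e x \<phi>" by (simp add: solutions_def)
  obtain N :: "('k msym + 'f, 'p, 'u) struc" and h e'
    where N: "models L N T" "elementary L N M h" "assignment N e'" "h \<circ> e' = ?e"
    by (rule small_model_assignment[OF M e1, of "{}"]) auto
  have "h ` solutions N e' x \<phi> = solutions M e x \<phi> \<inter> h ` carr N"
    using solutions_elementary[OF N(2) \<phi> N(3), of x] unfolding N(4) sol .
  moreover have "inj_on h (solutions N e' x \<phi>)"
    using N(2) inj_on_subset[of h "carr N" "solutions N e' x \<phi>"]
    by (simp add: elementary_def solutions_def)
  ultimately have "finite (solutions N e' x \<phi>)" using fin by (metis finite_Int finite_imageD)
  moreover have "sat N e' \<phi>"
  proof -
    have "sat N e' \<phi> = sat M (h \<circ> e') \<phi>" using N(2,3) \<phi> by (simp add: elementary_def)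
    then show ?thesis unfolding N(4) using a by (simp add: solutions_def)
  qed
  then have "e' x \<in> solutions N e' x \<phi>" using N(3) by (simp add: solutions_def assignment_in)
  ultimately have "e' x \<in> acl L N (e' ` (fv \<phi> - {x}))" using \<phi> unfolding acl_def by blast
  moreover have "e' ` (fv \<phi> - {x}) \<subseteq> carr N" using N(3) by (auto simp: assignment_def)
  ultimately have "e' x \<in> vspan N (e' ` (fv \<phi> - {x}))"
    using closures N(1) by (simp add: closures_are_span_def)
  then obtain \<tau> c where \<tau>: "lin \<tau> c" "fv_tm \<tau> \<subseteq> fv \<phi> - {x}" "e' x = eval_tm N e' \<tau>"
    by (rule vspan_lin)
  have "wf_fm L (Eq (Var x) \<tau>)" using lin_wf[OF \<tau>(1) vs_lang] by simp
  then have "sat N e' (Eq (Var x) \<tau>) = sat M (h \<circ> e') (Eq (Var x) \<tau>)"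
    using N(2,3) by (simp only: elementary_def)
  then have "a = eval_tm M ?e \<tau>" unfolding N(4) using \<tau>(3) by simp
  also have "\<dots> = eval_tm M e \<tau>" using \<tau>(2) by (intro eval_tm_cong) auto
  finally show thesis using that \<tau> by blast
qed

text \<open>Compactness makes the finitely many linear terms independent of the parameters.\<close>

theorem finite_solutions_uniform:
  fixes M :: "('k msym + 'f, 'p, 'w) struc"
  assumes M: "models L M T" and \<phi>: "wf_fm L \<phi>"
  obtains \<T> where "finite \<T>" "\<And>\<tau>. \<tau> \<in> \<T> \<Longrightarrow> (\<exists>c. lin \<tau> c) \<and> fv_tm \<tau> \<subseteq> fv \<phi> - {x}"
    "\<And>e a. assignment M e \<Longrightarrow> finite (solutions M e x \<phi>) \<Longrightarrow> a \<in> solutions M e x \<phi> \<Longrightarrow>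
       \<exists>\<tau> \<in> \<T>. a = eval_tm M e \<tau>"
proof -
  define LT :: "('k msym + 'f) tm set" where "LT = {\<tau>. (\<exists>c. lin \<tau> c) \<and> fv_tm \<tau> \<subseteq> fv \<phi> - {x}}"
  define bad where "bad \<T> e a \<longleftrightarrow> assignment M e \<and> finite (solutions M e x \<phi>) \<and>
    a \<in> solutions M e x \<phi> \<and> (\<forall>\<tau> \<in> \<T>. a \<noteq> eval_tm M e \<tau>)" for \<T> e a
  have "\<exists>\<T>. finite \<T> \<and> \<T> \<subseteq> LT \<and> (\<forall>e a. \<not> bad \<T> e a)"
  proof (rule ccontr)
    assume "\<not> ?thesis"
    then have ex_bad: "\<exists>e a. bad \<T> e a" if "finite \<T>" "\<T> \<subseteq> LT" for \<T> using that by blast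
    \<comment> \<open>Ineligible index sets get the configuration that is bad for the empty set of
      terms, so that \<open>E\<close> and \<open>A\<close> have values in \<open>M\<close> at every
      index.\<close>
    have "\<exists>e a. assignment M e \<and> a \<in> carr M \<and> (finite \<T> \<and> \<T> \<subseteq> LT \<longrightarrow> bad \<T> e a)" for \<T>
    proof (cases "finite \<T> \<and> \<T> \<subseteq> LT")
      case True
      then show ?thesis using ex_bad[of \<T>] unfolding bad_def solutions_def by blast
    next
      case False
      obtain e a where "bad {} e a" using ex_bad[of "{}"] by auto
      then show ?thesis using False unfolding bad_def solutions_def by blast
    qed
    then obtain E A where EA: "\<And>\<T>. assignment M (E \<T>)" "\<And>\<T>. A \<T> \<in> carr M"
      "\<And>\<T>. finite \<T> \<Longrightarrow> \<T> \<subseteq> LT \<Longrightarrow> bad \<T> (E \<T>) (A \<T>)" by metis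
    \<comment> \<open>Every single linear term eventually belongs to the index, so it is refuted
      along \<open>F\<close>.\<close>
    obtain F where F: "F \<le> finite_subsets_at_top LT" "ultra F"
      using ultra_exists[of "finite_subsets_at_top LT"] by auto
    have ev: "eventually P F" if "\<And>\<T>. finite \<T> \<Longrightarrow> X \<subseteq> \<T> \<Longrightarrow> \<T> \<subseteq> LT \<Longrightarrow> P \<T>" "finite X" "X \<subseteq> LT" for P X
    proof -
      have "eventually P (finite_subsets_at_top LT)"
        unfolding eventually_finite_subsets_at_top by (intro exI[of _ X] conjI allI impI that) auto
      then show ?thesis using F(1) by (simp add: le_filter_def)
    qed
    let ?P = "ultrapower F M"
    have M': "is_struc L M" using M by (simp add: models_def)
    have P: "models L ?P T" by (rule models_ultrapower[OF sentences M F(2)])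
    have rE: "range (\<lambda>\<T>. E \<T> n) \<subseteq> carr M" for n using EA(1) by (auto simp: assignment_def)
    have rA: "range A \<subseteq> carr M" using EA(2) by auto
    define e where "e = (\<lambda>n. ultra_rep F M (\<lambda>\<T>. E \<T> n))"
    define a where "a = ultra_rep F M A"
    have e: "assignment ?P e" using rE by (auto simp: assignment_def e_def ultrapower_def)
    have a: "a \<in> carr ?P" using rA by (auto simp: a_def ultrapower_def)
    have eE: "eventually (\<lambda>\<T>. e n \<T> = E \<T> n) F" for n unfolding e_def by (rule ultra_rep(2)[OF rE])
    have aA: "eventually (\<lambda>\<T>. a \<T> = A \<T>) F" unfolding a_def by (rule ultra_rep(2)[OF rA])
    have sat_e: "sat ?P e \<psi> \<longleftrightarrow> eventually (\<lambda>\<T>. sat M (E \<T>) \<psi>) F" if "wf_fm L \<psi>" for \<psi>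
    proof -
      have "eventually (\<lambda>\<T>. \<forall>n \<in> fv \<psi>. e n \<T> = E \<T> n) F"
        using eE by (intro eventually_ball_finite) auto
      then have "eventually (\<lambda>\<T>. sat M (\<lambda>n. e n \<T>) \<psi> = sat M (E \<T>) \<psi>) F"
        by eventually_elim (rule sat_cong, simp)
      then show ?thesis unfolding los[OF F(2) M' that e] by (rule eventually_subst)
    qed
    have sat_ea: "sat ?P (e(x := a)) \<psi> \<longleftrightarrow> eventually (\<lambda>\<T>. sat M ((E \<T>)(x := A \<T>)) \<psi>) F"
      if "wf_fm L \<psi>" for \<psi>
    proof -
      have "eventually (\<lambda>\<T>. \<forall>n \<in> fv \<psi>. e n \<T> = E \<T> n) F"
        using eE by (intro eventually_ball_finite) auto
      with aA have "eventually (\<lambda>\<T>. sat M (\<lambda>n. (e(x := a)) n \<T>) \<psi> = sat M ((E \<T>)(x := A \<T>)) \<psi>) F"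
        by eventually_elim (rule sat_cong, simp)
      then show ?thesis unfolding los[OF F(2) M' that assignment_upd[OF e a]] by (rule eventually_subst)
    qed
    obtain \<theta> where \<theta>: "expresses_inf U L T x \<phi> \<theta>"
      using elim_inf \<phi> by (auto simp: eliminates_inf_def)
    \<comment> \<open>Finiteness of a solution set is not a first-order condition by itself.
      Elimination of \<open>\<exists>\<^sup>\<infinity>\<close> turns it into the formula
      \<open>Neg \<theta>\<close>, which passes to the ultrapower.\<close>
    have "eventually (\<lambda>\<T>. sat M (E \<T>) (Neg \<theta>)) F"
      using EA expresses_inf_iff[OF M \<phi> \<theta>] by (intro ev[of "{}"]) (auto simp: bad_def)
    then have "sat ?P e (Neg \<theta>)" using \<theta> by (subst sat_e) (auto simp: expresses_inf_def)
    then have fin: "finite (solutions ?P e x \<phi>)"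
      using expresses_inf_iff[OF P \<phi> \<theta> e] by simp
    have "eventually (\<lambda>\<T>. sat M ((E \<T>)(x := A \<T>)) \<phi>) F"
      using EA by (intro ev[of "{}"]) (auto simp: solutions_def bad_def)
    then have "a \<in> solutions ?P e x \<phi>" using sat_ea[OF \<phi>] a by (simp add: solutions_def)
    from finite_solutions_lin[OF P \<phi> e fin this]
    obtain \<tau> c where \<tau>: "lin \<tau> c" "fv_tm \<tau> \<subseteq> fv \<phi> - {x}" "a = eval_tm ?P e \<tau>" .
    have wf: "wf_tm L \<tau>" using lin_wf[OF \<tau>(1) vs_lang] .
    have "eval_tm ?P (e(x := a)) \<tau> = eval_tm ?P e \<tau>" using \<tau>(2) by (intro eval_tm_cong) auto
    then have "sat ?P (e(x := a)) (Eq (Var x) \<tau>)" using \<tau>(3) by simp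
    then have "eventually (\<lambda>\<T>. sat M ((E \<T>)(x := A \<T>)) (Eq (Var x) \<tau>)) F"
      using sat_ea[of "Eq (Var x) \<tau>"] wf by (simp del: sat.simps)
    moreover have "eventually (\<lambda>\<T>. \<not> sat M ((E \<T>)(x := A \<T>)) (Eq (Var x) \<tau>)) F"
    proof (rule ev[of "{\<tau>}"])
      fix \<T> assume \<T>: "finite \<T>" "{\<tau>} \<subseteq> \<T>" "\<T> \<subseteq> LT"
      have "eval_tm M ((E \<T>)(x := A \<T>)) \<tau> = eval_tm M (E \<T>) \<tau>" using \<tau>(2) by (intro eval_tm_cong) auto
      then show "\<not> sat M ((E \<T>)(x := A \<T>)) (Eq (Var x) \<tau>)" using EA(3)[OF \<T>(1,3)] \<T>(2) by (auto simp: bad_def)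
    qed (use \<tau> in \<open>auto simp: LT_def\<close>)
    ultimately show False using ultra_not_eventually[OF F(2)] by blast
  qed
  then obtain \<T> where "finite \<T>" "\<T> \<subseteq> LT" "\<forall>e a. \<not> bad \<T> e a" by blast
  then show thesis using that[of \<T>] unfolding LT_def bad_def by blast
qed

end

section \<open>Coverings by cosets\<close>

text \<open>Inclusion-exclusion without signs: splitting off one index \<open>k\<close> leaves
  unions over \<open>I\<close> of the sets and of their traces on the set at \<open>k\<close>;
  intersections of the traces over \<open>J\<close> are intersections over
  \<open>insert k J\<close>.\<close>

lemma card_UN_determined_by_nerve:
  assumes "finite I" "\<And>i. i \<in> I \<Longrightarrow> finite (A i)" "\<And>i. i \<in> I \<Longrightarrow> finite (B i)"
    and "\<And>J. J \<subseteq> I \<Longrightarrow> J \<noteq> {} \<Longrightarrow> card (\<Inter>i\<in>J. A i) = card (\<Inter>i\<in>J. B i)"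
  shows "card (\<Union>i\<in>I. A i) = card (\<Union>i\<in>I. B i)"
  using assms
proof (induction I arbitrary: A B rule: finite_induct)
  case (insert k I)
  have split: "card (\<Union>i\<in>insert k I. C i) + card (\<Union>i\<in>I. C k \<inter> C i) = card (C k) + card (\<Union>i\<in>I. C i)"
    if "\<And>i. i \<in> insert k I \<Longrightarrow> finite (C i)" for C :: "_ \<Rightarrow> 'z set"
  proof -
    have "C k \<inter> (\<Union>i\<in>I. C i) = (\<Union>i\<in>I. C k \<inter> C i)" by auto
    then show ?thesis using card_Un_Int[of "C k" "\<Union>i\<in>I. C i"] that insert.hyps(1) by simp
  qed
  have "card (\<Union>i\<in>I. A i) = card (\<Union>i\<in>I. B i)"
    by (intro insert.IH insert.prems) auto
  moreover have "card (\<Union>i\<in>I. A k \<inter> A i) = card (\<Union>i\<in>I. B k \<inter> B i)"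
  proof (rule insert.IH)
    fix J assume J: "J \<subseteq> I" "J \<noteq> {}"
    have eq: "(\<Inter>i\<in>J. C k \<inter> C i) = (\<Inter>i\<in>insert k J. C i)" for C :: "_ \<Rightarrow> 'z set"
      using J(2) by auto
    have "insert k J \<subseteq> insert k I" using J(1) by blast
    then show "card (\<Inter>i\<in>J. A k \<inter> A i) = card (\<Inter>i\<in>J. B k \<inter> B i)"
      unfolding eq by (rule insert.prems(3)) simp
  qed (use insert.prems in auto)
  moreover have "card (A k) = card (B k)" using insert.prems(3)[of "{k}"] by simp
  ultimately show ?case using split[of A] split[of B] insert.prems(1,2) by simp
qed simp

section \<open>Abelian groups on a carrier set\<close>

locale abelian =
  fixes V :: "'v set" and add :: "'v \<Rightarrow> 'v \<Rightarrow> 'v" (infixl "\<oplus>" 65) and zero :: 'v ("\<zero>")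
    and neg :: "'v \<Rightarrow> 'v"
  assumes add_closed [simp]: "x \<in> V \<Longrightarrow> y \<in> V \<Longrightarrow> x \<oplus> y \<in> V"
    and zero_closed [simp]: "\<zero> \<in> V"
    and neg_closed [simp]: "x \<in> V \<Longrightarrow> neg x \<in> V"
    and assoc: "x \<in> V \<Longrightarrow> y \<in> V \<Longrightarrow> z \<in> V \<Longrightarrow> x \<oplus> y \<oplus> z = x \<oplus> (y \<oplus> z)"
    and commute: "x \<in> V \<Longrightarrow> y \<in> V \<Longrightarrow> x \<oplus> y = y \<oplus> x"
    and add_zero [simp]: "x \<in> V \<Longrightarrow> x \<oplus> \<zero> = x"
    and add_neg [simp]: "x \<in> V \<Longrightarrow> x \<oplus> neg x = \<zero>"
begin

lemma zero_add [simp]: "x \<in> V \<Longrightarrow> \<zero> \<oplus> x = x"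
  using commute[of \<zero> x] by simp

lemma left_commute: "x \<in> V \<Longrightarrow> y \<in> V \<Longrightarrow> z \<in> V \<Longrightarrow> x \<oplus> (y \<oplus> z) = y \<oplus> (x \<oplus> z)"
  by (metis assoc commute)

lemmas ac = assoc commute left_commute

lemma add_neg_cancel [simp]: "x \<in> V \<Longrightarrow> y \<in> V \<Longrightarrow> x \<oplus> (neg x \<oplus> y) = y"
  by (simp flip: assoc)

lemma neg_add_cancel [simp]: "x \<in> V \<Longrightarrow> y \<in> V \<Longrightarrow> neg x \<oplus> (x \<oplus> y) = y"
  by (metis add_neg_cancel left_commute neg_closed add_closed)

lemma neg_unique: "x \<in> V \<Longrightarrow> y \<in> V \<Longrightarrow> x \<oplus> y = \<zero> \<Longrightarrow> y = neg x"
  by (metis add_zero neg_add_cancel neg_closed)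

lemma neg_neg [simp]: "x \<in> V \<Longrightarrow> neg (neg x) = x"
  by (metis add_neg commute neg_closed neg_unique)

lemma neg_add: "x \<in> V \<Longrightarrow> y \<in> V \<Longrightarrow> neg (x \<oplus> y) = neg x \<oplus> neg y"
  by (rule neg_unique[symmetric]) (auto simp: ac)

definition sub :: "'v \<Rightarrow> 'v \<Rightarrow> 'v" (infixl "\<ominus>" 65) where
  "x \<ominus> y = x \<oplus> neg y"

lemma sub_closed [simp]: "x \<in> V \<Longrightarrow> y \<in> V \<Longrightarrow> x \<ominus> y \<in> V"
  by (simp add: sub_def)

lemma sub_self [simp]: "x \<in> V \<Longrightarrow> x \<ominus> x = \<zero>"
  by (simp add: sub_def)

lemma sub_zero [simp]: "x \<in> V \<Longrightarrow> x \<ominus> \<zero> = x"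
  by (metis add_zero neg_unique sub_def zero_closed)

lemma add_sub_cancel_left [simp]: "x \<in> V \<Longrightarrow> y \<in> V \<Longrightarrow> x \<oplus> y \<ominus> x = y"
  by (metis add_neg_cancel assoc commute neg_closed sub_def add_closed)

lemma add_sub_same [simp]: "x \<in> V \<Longrightarrow> y \<in> V \<Longrightarrow> y \<oplus> (x \<ominus> y) = x"
  by (simp add: sub_def left_commute)

lemma add_sub_assoc: "x \<in> V \<Longrightarrow> y \<in> V \<Longrightarrow> z \<in> V \<Longrightarrow> (x \<oplus> y) \<ominus> z = x \<oplus> (y \<ominus> z)"
  by (simp add: sub_def assoc)

lemma sub_sub: "x \<in> V \<Longrightarrow> y \<in> V \<Longrightarrow> z \<in> V \<Longrightarrow> (x \<ominus> y) \<ominus> z = x \<ominus> (y \<oplus> z)"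
  by (simp add: sub_def neg_add assoc)

lemma sub_sub_right: "x \<in> V \<Longrightarrow> y \<in> V \<Longrightarrow> z \<in> V \<Longrightarrow> x \<ominus> (y \<ominus> z) = (x \<oplus> z) \<ominus> y"
  by (simp add: sub_def neg_add ac)

lemma neg_sub: "x \<in> V \<Longrightarrow> y \<in> V \<Longrightarrow> neg (x \<ominus> y) = y \<ominus> x"
  by (simp add: sub_def neg_add ac)

lemma add_sub_add_left [simp]: "x \<in> V \<Longrightarrow> y \<in> V \<Longrightarrow> z \<in> V \<Longrightarrow> (x \<oplus> y) \<ominus> (x \<oplus> z) = y \<ominus> z"
  by (metis add_closed add_sub_assoc add_sub_cancel_left neg_add sub_def sub_sub)

section \<open>Subgroups, cosets and finite index\<close>

definition subgrp :: "'v set \<Rightarrow> bool" where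
  "subgrp H \<longleftrightarrow> H \<subseteq> V \<and> \<zero> \<in> H \<and> (\<forall>x \<in> H. \<forall>y \<in> H. x \<ominus> y \<in> H)"

lemma subgrp_neg: "subgrp H \<Longrightarrow> x \<in> H \<Longrightarrow> neg x \<in> H"
  unfolding subgrp_def by (metis sub_def zero_add neg_closed subsetD)

lemma subgrp_add: "subgrp H \<Longrightarrow> x \<in> H \<Longrightarrow> y \<in> H \<Longrightarrow> x \<oplus> y \<in> H"
  using subgrp_neg[of H y] unfolding subgrp_def by (metis neg_neg sub_def subsetD)

lemma subgrp_sub_commute: "subgrp H \<Longrightarrow> x \<in> V \<Longrightarrow> y \<in> V \<Longrightarrow> x \<ominus> y \<in> H \<Longrightarrow> y \<ominus> x \<in> H"
  using subgrp_neg neg_sub by metis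

lemma subgrp_sub_trans:
  assumes "subgrp H" "x \<in> V" "y \<in> V" "z \<in> V" "x \<ominus> y \<in> H" "y \<ominus> z \<in> H"
  shows "x \<ominus> z \<in> H"
proof -
  have "x \<ominus> z = (x \<ominus> y) \<oplus> (y \<ominus> z)"
    using assms(2-4) by (metis add_sub_assoc add_sub_same commute sub_closed)
  then show ?thesis using subgrp_add assms by simp
qed

text \<open>The empty set counts as a coset.\<close>

definition coset :: "'v set \<Rightarrow> 'v set \<Rightarrow> bool" where
  "coset H C \<longleftrightarrow> C \<subseteq> V \<and> (\<forall>a \<in> C. \<forall>b \<in> V. b \<in> C \<longleftrightarrow> b \<ominus> a \<in> H)"

text \<open>\<open>K\<close> need not lie in \<open>H\<close>: for subgroups this says that
  \<open>H \<inter> K\<close> has finite index in \<open>H\<close>.\<close>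

definition fin_index :: "'v set \<Rightarrow> 'v set \<Rightarrow> bool" where
  "fin_index H K \<longleftrightarrow> (\<exists>A. finite A \<and> A \<subseteq> V \<and> (\<forall>h \<in> H. \<exists>a \<in> A. h \<ominus> a \<in> K))"

lemma fin_indexE:
  assumes "fin_index H K"
  obtains A where "finite A" "A \<subseteq> V" "\<forall>h \<in> H. \<exists>a \<in> A. h \<ominus> a \<in> K"
  using assms unfolding fin_index_def by metis

text \<open>B. H. Neumann's lemma.\<close>

lemma no_cover_by_infinite_index:
  assumes H: "subgrp H" and "finite \<K>" and "\<And>K. K \<in> \<K> \<Longrightarrow> subgrp K \<and> \<not> fin_index H K"
    and "finite A" "A \<subseteq> V"
  shows "\<not> (\<forall>h \<in> H. \<exists>K \<in> \<K>. \<exists>a \<in> A. h \<ominus> a \<in> K)"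
  using assms(2-)
proof (induction \<K> arbitrary: A rule: finite_induct)
  case empty
  then show ?case using H by (auto simp: subgrp_def)
next
  case (insert K \<K>)
  have HV: "H \<subseteq> V" and K: "subgrp K" using H insert.prems(1) by (auto simp: subgrp_def)
  show ?case
  proof
    assume cov: "\<forall>h \<in> H. \<exists>K' \<in> insert K \<K>. \<exists>a \<in> A. h \<ominus> a \<in> K'"
    have "\<not> fin_index H K" using insert.prems(1) by simp
    \<comment> \<open>The coset of \<open>K\<close> through \<open>c\<close> is disjoint from those
      with representative in \<open>A\<close>, so its part in \<open>H\<close> is covered by cosets
      of the other groups.\<close>
    then obtain c where c: "c \<in> H" "\<And>a. a \<in> A \<Longrightarrow> c \<ominus> a \<notin> K"
      using insert.prems(2,3) unfolding fin_index_def by metis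
    have "\<exists>g. g \<in> H \<and> ((\<exists>h \<in> H. h \<ominus> a \<in> K) \<longrightarrow> g \<ominus> a \<in> K)" for a using c(1) by blast
    then obtain g where g: "\<And>a. g a \<in> H" "\<And>a h. h \<in> H \<Longrightarrow> h \<ominus> a \<in> K \<Longrightarrow> g a \<ominus> a \<in> K" by metis
    \<comment> \<open>A coset of \<open>K\<close> through \<open>a\<close> that meets
      \<open>H\<close> is the translate by \<open>g a - c\<close> of the coset through
      \<open>c\<close>. Translating the cover of the latter replaces the cosets of \<open>K\<close>
      by cosets of the other groups.\<close>
    let ?A = "A \<union> (\<lambda>(a, b). (g a \<ominus> c) \<oplus> b) ` (A \<times> A)"
    have gV: "g a \<in> V" and cV: "c \<in> V" for a using g(1) c(1) HV by auto
    have fin: "finite ?A" "?A \<subseteq> V" using insert.prems(2,3) gV cV by auto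
    have "\<exists>K' \<in> \<K>. \<exists>a \<in> ?A. h \<ominus> a \<in> K'" if h: "h \<in> H" for h
    proof -
      obtain K' a where K': "K' \<in> insert K \<K>" "a \<in> A" "h \<ominus> a \<in> K'" using cov h by blast
      show ?thesis
      proof (cases "K' \<in> \<K>")
        case False
        then have ha: "h \<ominus> a \<in> K" using K' by simp
        have V: "h \<in> V" "a \<in> V" "c \<in> V" "g a \<in> V" using h K'(2) c(1) g(1) HV insert.prems(3) by auto
        have hg: "h \<ominus> g a \<in> K"
          using subgrp_sub_trans[OF K V(1,2,4) ha] subgrp_sub_commute[OF K V(4,2)] g(2)[OF h ha] by blast
        let ?h = "c \<oplus> (h \<ominus> g a)"
        have "?h \<in> H" using subgrp_add[OF H c(1)] H h g(1) by (simp add: subgrp_def)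
        then obtain K'' b where K'': "K'' \<in> insert K \<K>" "b \<in> A" "?h \<ominus> b \<in> K''" using cov by blast
        have b: "b \<in> V" using K''(2) insert.prems(3) by auto
        have "K'' \<noteq> K"
        proof
          assume "K'' = K"
          moreover have "c \<ominus> ?h \<in> K"
            using V hg by (subst neg_sub[symmetric]) (simp_all add: subgrp_neg[OF K])
          ultimately have "c \<ominus> b \<in> K" using subgrp_sub_trans[OF K, of c ?h b] V b K''(3) by simp
          then show False using c(2) K''(2) by blast
        qed
        moreover have "?h \<ominus> b = h \<ominus> ((g a \<ominus> c) \<oplus> b)"
          using V b by (simp add: sub_def neg_add ac)
        moreover have "(g a \<ominus> c) \<oplus> b \<in> ?A" using K'(2) K''(2) by force
        ultimately show ?thesis using K''(1,3) by (metis insertE)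
      qed (use K' in blast)
    qed
    then show False using insert.IH[OF _ fin] insert.prems(1) by blast
  qed
qed

lemma subgrp_Inter: "subgrp H \<Longrightarrow> (\<And>i. i \<in> I \<Longrightarrow> subgrp (K i)) \<Longrightarrow> subgrp (H \<inter> (\<Inter>i\<in>I. K i))"
  by (auto simp: subgrp_def)

lemma coset_iff: "coset H C \<Longrightarrow> a \<in> C \<Longrightarrow> b \<in> V \<Longrightarrow> b \<in> C \<longleftrightarrow> b \<ominus> a \<in> H"
  by (simp add: coset_def)

lemma coset_subset: "coset H C \<Longrightarrow> C \<subseteq> V"
  by (simp add: coset_def)

lemma coset_Inter:
  assumes "coset H C" "\<And>i. i \<in> I \<Longrightarrow> coset (K i) (D i)"
  shows "coset (H \<inter> (\<Inter>i\<in>I. K i)) (C \<inter> (\<Inter>i\<in>I. D i))"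
proof -
  have "b \<in> C \<inter> (\<Inter>i\<in>I. D i) \<longleftrightarrow> b \<ominus> a \<in> H \<inter> (\<Inter>i\<in>I. K i)"
    if "a \<in> C \<inter> (\<Inter>i\<in>I. D i)" "b \<in> V" for a b
  proof -
    have "b \<in> D i \<longleftrightarrow> b \<ominus> a \<in> K i" if "i \<in> I" for i
      using coset_iff[OF assms(2)[OF that]] \<open>a \<in> _\<close> \<open>b \<in> V\<close> that by blast
    moreover have "b \<in> C \<longleftrightarrow> b \<ominus> a \<in> H" using coset_iff[OF assms(1)] that by blast
    ultimately show ?thesis by simp
  qed
  then show ?thesis using coset_subset[OF assms(1)] by (auto simp: coset_def)
qed

lemma fin_index_Int:
  assumes "subgrp K" "subgrp K'" "H \<subseteq> V" "fin_index H K" "fin_index H K'"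
  shows "fin_index H (K \<inter> K')"
proof -
  obtain A where A: "finite A" "A \<subseteq> V" "\<forall>h \<in> H. \<exists>a \<in> A. h \<ominus> a \<in> K"
    by (rule fin_indexE[OF assms(4)])
  obtain B where B: "finite B" "B \<subseteq> V" "\<forall>h \<in> H. \<exists>b \<in> B. h \<ominus> b \<in> K'"
    by (rule fin_indexE[OF assms(5)])
  \<comment> \<open>For each pair of cosets that meet inside \<open>H\<close>, \<open>g a b\<close>
    is a common point; it represents a coset of the intersection.\<close>
  have "\<exists>g. g \<in> V \<and> (\<forall>h \<in> H. h \<ominus> a \<in> K \<longrightarrow> h \<ominus> b \<in> K' \<longrightarrow> g \<ominus> a \<in> K \<and> g \<ominus> b \<in> K')" for a b
    using assms(3) zero_closed by blast
  then obtain g where g: "\<And>a b. g a b \<in> V"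
    "\<And>a b. \<forall>h \<in> H. h \<ominus> a \<in> K \<longrightarrow> h \<ominus> b \<in> K' \<longrightarrow> g a b \<ominus> a \<in> K \<and> g a b \<ominus> b \<in> K'"
    by metis
  have "\<exists>x \<in> (\<lambda>(a, b). g a b) ` (A \<times> B). h \<ominus> x \<in> K \<inter> K'" if h: "h \<in> H" for h
  proof -
    obtain a b where ab: "a \<in> A" "h \<ominus> a \<in> K" "b \<in> B" "h \<ominus> b \<in> K'" using A(3) B(3) h by blast
    have V: "h \<in> V" "a \<in> V" "b \<in> V" "g a b \<in> V" using h ab A(2) B(2) assms(3) g(1) by auto
    have gK: "g a b \<ominus> a \<in> K" "g a b \<ominus> b \<in> K'" using g(2)[of a b] h ab(2,4) by auto
    have "h \<ominus> g a b \<in> K"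
      by (rule subgrp_sub_trans[OF assms(1) V(1,2,4) ab(2) subgrp_sub_commute[OF assms(1) V(4,2) gK(1)]])
    moreover have "h \<ominus> g a b \<in> K'"
      by (rule subgrp_sub_trans[OF assms(2) V(1,3,4) ab(4) subgrp_sub_commute[OF assms(2) V(4,3) gK(2)]])
    ultimately show ?thesis using ab(1,3) by (intro bexI[of _ "g a b"]) auto
  qed
  moreover have "finite ((\<lambda>(a, b). g a b) ` (A \<times> B))" "(\<lambda>(a, b). g a b) ` (A \<times> B) \<subseteq> V"
    using A(1) B(1) g(1) by auto
  ultimately show ?thesis unfolding fin_index_def by blast
qed

lemma fin_index_self: "fin_index H H" if "subgrp H"
  unfolding fin_index_def using that by (intro exI[of _ "{\<zero>}"]) (auto simp: subgrp_def)

lemma fin_index_Inter: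
  assumes "finite I" "subgrp H" "\<And>i. i \<in> I \<Longrightarrow> subgrp (K i) \<and> fin_index H (K i)"
  shows "fin_index H (H \<inter> (\<Inter>i\<in>I. K i))"
  using assms(1,3)
proof (induction I rule: finite_induct)
  case empty
  then show ?case using fin_index_self[OF assms(2)] by simp
next
  case (insert k I)
  have "fin_index H (K k \<inter> (H \<inter> (\<Inter>i\<in>I. K i)))"
  proof (rule fin_index_Int)
    show "subgrp (H \<inter> (\<Inter>i\<in>I. K i))" by (rule subgrp_Inter) (use assms(2) insert.prems in auto)
    show "H \<subseteq> V" using assms(2) by (simp add: subgrp_def)
  qed (use insert in auto)
  moreover have "H \<inter> (\<Inter>i\<in>insert k I. K i) = K k \<inter> (H \<inter> (\<Inter>i\<in>I. K i))" by auto
  ultimately show ?case by simp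
qed

text \<open>If a point \<open>x\<close> escaped the pieces of finite index, so would its whole coset
  of \<open>?N\<close>. As \<open>?N\<close> has finite index in \<open>H\<close>, finitely many
  cosets of the remaining subgroups would then cover \<open>H\<close>, against Neumann's
  lemma.\<close>

lemma cover_by_finite_index:
  assumes I: "finite I" and H: "subgrp H" and K: "\<And>i. i \<in> I \<Longrightarrow> subgrp (K i)"
    and C: "coset H C" and D: "\<And>i. i \<in> I \<Longrightarrow> coset (K i) (D i)" and cov: "C \<subseteq> (\<Union>i\<in>I. D i)"
  shows "C \<subseteq> (\<Union>i\<in>{i \<in> I. fin_index H (K i)}. D i)"
proof
  let ?J = "{i \<in> I. fin_index H (K i)}"
  let ?N = "H \<inter> (\<Inter>i\<in>?J. K i)"
  fix x assume x: "x \<in> C"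
  show "x \<in> (\<Union>i\<in>?J. D i)"
  proof (rule ccontr)
    assume nx: "x \<notin> (\<Union>i\<in>?J. D i)"
    have xV: "x \<in> V" using x C by (auto simp: coset_def)
    have N: "subgrp ?N" using H K by (intro subgrp_Inter) auto
    have "fin_index H ?N" using I H K by (intro fin_index_Inter) auto
    then obtain B where B: "finite B" "B \<subseteq> V" "\<forall>h \<in> H. \<exists>b \<in> B. h \<ominus> b \<in> ?N"
      by (rule fin_indexE)
    have "\<exists>d. d \<in> V \<and> (D i \<noteq> {} \<longrightarrow> d \<in> D i)" if "i \<in> I" for i
      using coset_subset[OF D[OF that]] zero_closed by blast
    then obtain d where d: "\<And>i. i \<in> I \<Longrightarrow> d i \<in> V" "\<And>i. i \<in> I \<Longrightarrow> D i \<noteq> {} \<Longrightarrow> d i \<in> D i" by metis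
    \<comment> \<open>If \<open>x + k\<close> lies in the piece through \<open>d i\<close>, then
      \<open>h = b + k\<close> lies in the coset through \<open>b + (d i - x)\<close>.\<close>
    let ?A = "(\<lambda>(b, i). b \<oplus> (d i \<ominus> x)) ` (B \<times> I)"
    have "\<exists>L \<in> K ` (I - ?J). \<exists>a \<in> ?A. h \<ominus> a \<in> L" if h: "h \<in> H" for h
    proof -
      obtain b where b: "b \<in> B" "h \<ominus> b \<in> ?N" using B(3) h by blast
      let ?k = "h \<ominus> b"
      have V: "h \<in> V" "b \<in> V" "?k \<in> V" "x \<oplus> ?k \<in> V"
        using h b B(2) H xV by (auto simp: subgrp_def)
      have "x \<oplus> ?k \<in> C" using coset_iff[OF C x V(4)] V b(2) xV by simp
      then obtain i where i: "i \<in> I" "x \<oplus> ?k \<in> D i" using cov by blast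
      have "i \<notin> ?J"
      proof
        assume iJ: "i \<in> ?J"
        then have "?k \<in> K i" using b(2) by blast
        then have "x \<ominus> (x \<oplus> ?k) \<in> K i"
          using subgrp_sub_commute[OF K[OF i(1)], of "x \<oplus> ?k" x] V xV by simp
        then have "x \<in> D i" using coset_iff[OF D[OF i(1)] i(2) xV] by simp
        then show False using nx iJ by blast
      qed
      moreover have "h \<ominus> (b \<oplus> (d i \<ominus> x)) \<in> K i"
      proof -
        have "d i \<in> D i" using d(2) i by blast
        then have "(x \<oplus> ?k) \<ominus> d i \<in> K i" using coset_iff[OF D[OF i(1)] \<open>d i \<in> D i\<close> V(4)] i(2) by simp
        moreover have "(x \<oplus> ?k) \<ominus> d i = h \<ominus> (b \<oplus> (d i \<ominus> x))"
          using V xV d(1)[OF i(1)] by (simp add: sub_def neg_add ac)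
        ultimately show ?thesis by simp
      qed
      ultimately show ?thesis using i(1) b(1) by blast
    qed
    moreover have "\<not> (\<forall>h \<in> H. \<exists>L \<in> K ` (I - ?J). \<exists>a \<in> ?A. h \<ominus> a \<in> L)"
      by (rule no_cover_by_infinite_index[OF H]) (use I K B d(1) xV in auto)
    ultimately show False by blast
  qed
qed

text \<open>
  The pieces of finite index are unions of cosets of a common subgroup of finite index, and
  inclusion-exclusion computes the number of these cosets that they cover.
\<close>

theorem cover_determined_by_nerve:
  assumes I: "finite I" and H: "subgrp H" and K: "\<And>i. i \<in> I \<Longrightarrow> subgrp (K i)"
    and C: "coset H C" and D: "\<And>i. i \<in> I \<Longrightarrow> coset (K i) (D i)"
    and C': "coset H C'" and D': "\<And>i. i \<in> I \<Longrightarrow> coset (K i) (D' i)"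
    and nerve: "\<And>J. J \<subseteq> I \<Longrightarrow> C \<inter> (\<Inter>i\<in>J. D i) = {} \<longleftrightarrow> C' \<inter> (\<Inter>i\<in>J. D' i) = {}"
    and cov: "C \<subseteq> (\<Union>i\<in>I. D i)"
  shows "C' \<subseteq> (\<Union>i\<in>I. D' i)"
proof -
  let ?I = "{i \<in> I. fin_index H (K i)}"
  let ?N = "H \<inter> (\<Inter>i\<in>?I. K i)"
  have N: "subgrp ?N" using H K by (intro subgrp_Inter) auto
  then have NV: "?N \<subseteq> V" by (simp add: subgrp_def)
  \<comment> \<open>\<open>q x\<close> is the coset of \<open>?N\<close> through \<open>x\<close>;
    images under \<open>q\<close> count the cosets that a set meets.\<close>
  define q where "q x = {y \<in> V. y \<ominus> x \<in> ?N}" for x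
  have q_eq: "y \<ominus> x \<in> ?N" if "q x = q y" "x \<in> V" "y \<in> V" for x y
  proof -
    have "y \<in> q y" using N that(3) by (simp add: q_def subgrp_def)
    then show ?thesis using that(1) by (auto simp: q_def)
  qed
  have finq: "finite (q ` H)"
  proof -
    have "fin_index H ?N" using I H K by (intro fin_index_Inter) auto
    then obtain B where B: "finite B" "B \<subseteq> V" "\<forall>h \<in> H. \<exists>b \<in> B. h \<ominus> b \<in> ?N"
      by (rule fin_indexE)
    have "q h \<in> q ` B" if h: "h \<in> H" for h
    proof -
      obtain b where b: "b \<in> B" "h \<ominus> b \<in> ?N" using B(3) h by blast
      have V: "h \<in> V" "b \<in> V" using h b B(2) H by (auto simp: subgrp_def)
      have "q h = q b"
        unfolding q_def using subgrp_sub_trans[OF N _ V _ b(2)]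
          subgrp_sub_trans[OF N _ V(2,1) _ subgrp_sub_commute[OF N V b(2)]] by blast
      then show ?thesis using b(1) by blast
    qed
    then show ?thesis using B(1) by (meson finite_imageI finite_subset image_subsetI)
  qed
  \<comment> \<open>A nonempty coset \<open>X\<close> of \<open>L\<close> is a translate of
    \<open>L\<close>, and translation permutes the cosets of \<open>?N\<close>; so the count depends
    on \<open>L\<close> only.\<close>
  have card_q: "card (q ` X) = card (q ` L)" "finite (q ` X)"
    if X: "coset L X" "X \<noteq> {}" and L: "L \<subseteq> H" for X L
  proof -
    obtain x where x: "x \<in> X" using X(2) by blast
    have V: "x \<in> V" "X \<subseteq> V" "L \<subseteq> V" using x X(1) L H by (auto simp: coset_def subgrp_def)
    have XL: "X = (\<lambda>l. x \<oplus> l) ` L"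
    proof (intro equalityI subsetI)
      fix y assume y: "y \<in> X"
      then have "y \<ominus> x \<in> L" using coset_iff[OF X(1) x] V by blast
      moreover have "y = x \<oplus> (y \<ominus> x)" using y V by (simp add: subsetD)
      ultimately show "y \<in> (\<lambda>l. x \<oplus> l) ` L" by blast
    next
      fix y assume "y \<in> (\<lambda>l. x \<oplus> l) ` L"
      then obtain l where l: "l \<in> L" "y = x \<oplus> l" by blast
      then have "y \<ominus> x \<in> L" "y \<in> V" using V by (auto simp: subsetD)
      then show "y \<in> X" using coset_iff[OF X(1) x] by blast
    qed
    have T: "q (x \<oplus> l) = (\<lambda>y. x \<oplus> y) ` q l" if "l \<in> V" for l
    proof (intro equalityI subsetI)
      fix y assume y: "y \<in> q (x \<oplus> l)"
      then have yV: "y \<in> V" by (simp add: q_def)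
      have "y \<ominus> (x \<oplus> l) = (y \<ominus> x) \<ominus> l" using yV V that by (simp add: sub_sub)
      then have "y \<ominus> x \<in> q l" using y yV V by (simp add: q_def)
      moreover have "y = x \<oplus> (y \<ominus> x)" using yV V by simp
      ultimately show "y \<in> (\<lambda>y. x \<oplus> y) ` q l" by blast
    qed (use V that in \<open>auto simp: q_def\<close>)
    have "q ` X = (`) (\<lambda>y. x \<oplus> y) ` (q ` L)"
      unfolding XL image_image using T V(3) by (intro image_cong) auto
    moreover have "inj_on ((`) (\<lambda>y. x \<oplus> y)) (q ` L)"
    proof (rule inj_on_image)
      have "inj_on ((\<oplus>) x) V" using V(1) by (metis add_sub_cancel_left inj_onI)
      moreover have "\<Union> (q ` L) \<subseteq> V" by (auto simp: q_def)
      ultimately show "inj_on ((\<oplus>) x) (\<Union> (q ` L))" by (rule inj_on_subset)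
    qed
    moreover have "finite (q ` L)" using finq L by (meson finite_subset image_mono)
    ultimately show "card (q ` X) = card (q ` L)" "finite (q ` X)" by (simp_all add: card_image)
  qed
  have finite_q: "finite (q ` X)" if "coset H E" "X \<subseteq> E" for E X
  proof (rule finite_subset[OF image_mono[OF that(2)]])
    show "finite (q ` E)" using card_q(2)[OF that(1)] by (cases "E = {}") auto
  qed
  \<comment> \<open>As \<open>?N \<subseteq> K i\<close> for \<open>i\<close> in \<open>?I\<close>,
    the set \<open>F i\<close> contains every coset of \<open>?N\<close> that it meets. Therefore
    \<open>q\<close> commutes with these intersections.\<close>
  have q_Inter: "(\<Inter>i\<in>J. q ` (E \<inter> F i)) = q ` (E \<inter> (\<Inter>i\<in>J. F i))"
    if E: "coset H E" and F: "\<And>i. i \<in> I \<Longrightarrow> coset (K i) (F i)" and J: "J \<subseteq> ?I" "J \<noteq> {}" for E F J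
  proof
    show "(\<Inter>i\<in>J. q ` (E \<inter> F i)) \<subseteq> q ` (E \<inter> (\<Inter>i\<in>J. F i))"
    proof
      fix z assume z: "z \<in> (\<Inter>i\<in>J. q ` (E \<inter> F i))"
      obtain j where "j \<in> J" using J(2) by blast
      with z obtain x where x: "x \<in> E" "z = q x" by blast
      have "x \<in> F i" if i: "i \<in> J" for i
      proof -
        obtain y where y: "y \<in> E" "y \<in> F i" "z = q y" using z i by blast
        have "x \<in> V" "y \<in> V" using x y E by (auto simp: coset_def)
        then have "x \<ominus> y \<in> K i" using q_eq[of y x] x(2) y(3) i J(1) by auto
        then show ?thesis using coset_iff[OF F y(2) \<open>x \<in> V\<close>] i J(1) by blast
      qed
      then show "z \<in> q ` (E \<inter> (\<Inter>i\<in>J. F i))" using x by blast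
    qed
  qed blast
  have sub_I: "?I \<subseteq> I" by blast
  \<comment> \<open>The nerve decides which intersections are empty; all others, on both sides, are
    cosets of one and the same group.\<close>
  have card_eq: "card (q ` (C \<inter> (\<Inter>i\<in>J. D i))) = card (q ` (C' \<inter> (\<Inter>i\<in>J. D' i)))" if J: "J \<subseteq> ?I" for J
  proof (cases "C \<inter> (\<Inter>i\<in>J. D i) = {}")
    case True
    then have "C' \<inter> (\<Inter>i\<in>J. D' i) = {}" using nerve[OF subset_trans[OF J sub_I]] by simp
    then show ?thesis using True by simp
  next
    case False
    then have ne: "C' \<inter> (\<Inter>i\<in>J. D' i) \<noteq> {}"
      using nerve[OF subset_trans[OF J sub_I]] by simp
    have *: "coset (H \<inter> (\<Inter>i\<in>J. K i)) (C \<inter> (\<Inter>i\<in>J. D i))"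
      "coset (H \<inter> (\<Inter>i\<in>J. K i)) (C' \<inter> (\<Inter>i\<in>J. D' i))"
      using C D C' D' J by (auto intro!: coset_Inter)
    show ?thesis using card_q(1)[OF *(1) False] card_q(1)[OF *(2) ne] by simp
  qed
  have "card (\<Union>i\<in>?I. q ` (C \<inter> D i)) = card (\<Union>i\<in>?I. q ` (C' \<inter> D' i))"
  proof (rule card_UN_determined_by_nerve)
    show "finite ?I" using I by simp
    show "finite (q ` (C \<inter> D i))" "finite (q ` (C' \<inter> D' i))" for i
      using finite_q[OF C] finite_q[OF C'] by auto
    show "card (\<Inter>i\<in>J. q ` (C \<inter> D i)) = card (\<Inter>i\<in>J. q ` (C' \<inter> D' i))" if "J \<subseteq> ?I" "J \<noteq> {}" for J
      using q_Inter[OF C D that] q_Inter[OF C' D' that] card_eq[OF that(1)] by simp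
  qed
  \<comment> \<open>On the side of \<open>C\<close> the pieces account for all cosets of
    \<open>?N\<close> that \<open>C\<close> meets. Equality of the counts forces the same for
    \<open>C'\<close>.\<close>
  moreover have "(\<Union>i\<in>?I. q ` (C \<inter> D i)) = q ` C"
    using cover_by_finite_index[OF I H K C D cov] by blast
  moreover have "card (q ` C) = card (q ` C')" using card_eq[of "{}"] by simp
  ultimately have "(\<Union>i\<in>?I. q ` (C' \<inter> D' i)) = q ` C'"
    using finite_q[OF C', of C'] by (intro card_subset_eq) auto
  show ?thesis
  proof
    fix x assume x: "x \<in> C'"
    then have "q x \<in> (\<Union>i\<in>?I. q ` (C' \<inter> D' i))" using \<open>_ = q ` C'\<close> by blast
    then obtain i y where y: "i \<in> ?I" "y \<in> C'" "y \<in> D' i" "q x = q y" by blast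
    have "x \<in> V" "y \<in> V" using x y C' by (auto simp: coset_def)
    then have "x \<ominus> y \<in> K i" using q_eq[of y x] y by auto
    then show "x \<in> (\<Union>i\<in>I. D' i)" using coset_iff[OF D' y(3) \<open>x \<in> V\<close>] y(1) by blast
  qed
qed

end

section \<open>Primitive positive conditions on a vector space with a submodule\<close>

lemma wf_univ_closure: "wf_fm L (univ_closure \<phi>) \<longleftrightarrow> wf_fm L \<phi>"
proof -
  have "wf_fm L (foldr Forall xs \<phi>) \<longleftrightarrow> wf_fm L \<phi>" for xs by (induction xs) auto
  then show ?thesis by (simp add: univ_closure_def)
qed

lemma (in large_theory) models_univ_closure:
  assumes "models L M T" "entails U L T (univ_closure \<phi>)" "wf_fm L \<phi>" "assignment M e"
  shows "sat M e \<phi>"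
proof -
  have "\<forall>e. assignment M e \<longrightarrow> sat M e (univ_closure \<phi>)"
    using entails_sat[OF assms(1,2)] assms(3) by (simp add: wf_univ_closure)
  moreover have ne: "carr M \<noteq> {}" using assms(1) by (simp add: models_def is_struc_def)
  ultimately show ?thesis using assms(4) unfolding sat_univ_closure[OF ne] by simp
qed

section \<open>The vector space and the submodule in a model of the pair theory\<close>

locale vs_pair = vs_theory U L T
  for U :: "'u itself" and L :: "('k::field msym + 'f, 'p) lang" and T :: "('k msym + 'f, 'p) fm set" +
  fixes R :: "'k set" and M :: "('k msym + 'f, ('k, 'p) grel, 'w) struc"
  assumes subring: "is_subring R" and frac: "frac_is_everything R"
    and model: "models (G_lang L R) M (G_theory U L R T)"
begin

abbreviation "V \<equiv> carr M"
abbreviation "M0 \<equiv> reduct M"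

definition G where "G = {a \<in> V. rel_int M InG [a]}"

definition vadd where "vadd a b = fun_int M (Inl Add) [a, b]"
definition vzero where "vzero = fun_int M (Inl Zero) []"
definition scal where "scal c a = fun_int M (Inl (Scal c)) [a]"
definition vneg where "vneg a = scal (- 1) a"

lemmas fold_ops [simp] = vadd_def[symmetric] vzero_def[symmetric] scal_def[symmetric]

lemma is_struc_M: "is_struc (G_lang L R) M"
  using model by (simp add: models_def)

lemma carr_nonempty: "V \<noteq> {}"
  using is_struc_M by (simp add: is_struc_def)

lemma M0_model: "models L M0 T"
  unfolding models_def
proof (intro conjI ballI allI impI)
  show "is_struc L M0" using is_struc_M by (simp add: is_struc_def G_lang_def)
  fix \<sigma> e assume "\<sigma> \<in> T" "assignment M0 e"
  then have "sat M e (old \<sigma>)" using model by (auto simp: models_def G_theory_def)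
  then show "sat M0 e \<sigma>" by (simp add: sat_old)
qed

lemma axiom_sat:
  assumes "\<phi> \<in> submodule_axioms R \<union> predicate_axioms R \<union> density_axioms U L R T" "assignment M e"
  shows "sat M e \<phi>"
proof -
  have "univ_closure \<phi> \<in> G_theory U L R T" using assms(1) unfolding G_theory_def by blast
  then have "\<forall>e. assignment M e \<longrightarrow> sat M e (univ_closure \<phi>)" using model by (simp add: models_def)
  then show ?thesis using assms(2) unfolding sat_univ_closure[OF carr_nonempty] by simp
qed

lemma vs_axiom_sat:
  fixes \<phi> :: "('k msym + 'f, 'p) fm"
  assumes "univ_closure \<phi> \<in> vs_axioms" "wf_fm L \<phi>" "assignment M e"
  shows "sat M0 e \<phi>"
  using models_univ_closure[OF M0_model _ assms(2)] assms(1,3) vs by (simp add: expands_vs_def)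

lemma closed: "a \<in> V \<Longrightarrow> b \<in> V \<Longrightarrow> vadd a b \<in> V" "vzero \<in> V" "a \<in> V \<Longrightarrow> scal c a \<in> V"
proof -
  have ar: "fun_ar (G_lang L R) (Inl s) = module_ar UNIV s" for s
    using vs_lang by (simp add: extends_vs_lang_def G_lang_def)
  have cl: "fun_int M (Inl s) as \<in> V" if "module_ar UNIV s = Some (length as)" "set as \<subseteq> V" for s as
    using is_struc_M that ar[of s] unfolding is_struc_def by metis
  show "a \<in> V \<Longrightarrow> b \<in> V \<Longrightarrow> vadd a b \<in> V" using cl[of Add "[a, b]"] by (simp add: numeral_2_eq_2)
  show "vzero \<in> V" using cl[of Zero "[]"] by simp
  show "a \<in> V \<Longrightarrow> scal c a \<in> V" using cl[of "Scal c" "[a]"] by simp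
qed

abbreviation env3 where "env3 x y z \<equiv> (\<lambda>_::nat. x)(1 := y, 2 := z)"

lemma vs_laws:
  assumes V: "x \<in> V" "y \<in> V" "z \<in> V"
  shows "vadd (vadd x y) z = vadd x (vadd y z)" "vadd x y = vadd y x" "vadd x vzero = x"
    "\<exists>w \<in> V. vadd x w = vzero" "scal 1 x = x" "scal c (vadd x y) = vadd (scal c x) (scal c y)"
    "scal (c + d) x = vadd (scal c x) (scal d x)" "scal (c * d) x = scal c (scal d x)"
proof -
  have e: "assignment M (env3 x y z)" using V by (auto simp: assignment_def)
  have wf: "fun_ar L (Inl Add) = Some (Suc (Suc 0))" "fun_ar L (Inl Zero) = Some 0"
    "fun_ar L (Inl (Scal c)) = Some (Suc 0)" for c
    using vs_lang by (simp_all add: extends_vs_lang_def numeral_2_eq_2)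
  note ax = vs_axiom_sat[OF _ _ e]
  note ax' = ax[unfolded vs_axioms_def Let_def, OF imageI]
  let ?x = "Var 0 :: ('k msym + 'f) tm" and ?y = "Var 1 :: ('k msym + 'f) tm"
    and ?z = "Var 2 :: ('k msym + 'f) tm"
  show "vadd (vadd x y) z = vadd x (vadd y z)"
    using ax'[of "Eq (plus_tm (plus_tm ?x ?y) ?z) (plus_tm ?x (plus_tm ?y ?z))"] wf
    by simp
  show "vadd x y = vadd y x"
    using ax'[of "Eq (plus_tm ?x ?y) (plus_tm ?y ?x)"] wf by simp
  show "vadd x vzero = x"
    using ax'[of "Eq (plus_tm ?x zero_tm) ?x"] wf by simp
  show "\<exists>w \<in> V. vadd x w = vzero"
    using ax'[of "Exists 1 (Eq (plus_tm ?x ?y) zero_tm)"] wf by simp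
  show "scal 1 x = x"
    using ax'[of "Eq (scal_tm 1 ?x) ?x"] wf by simp
  show "scal c (vadd x y) = vadd (scal c x) (scal c y)"
  proof -
    have "univ_closure (Eq (scal_tm c (plus_tm ?x ?y)) (plus_tm (scal_tm c ?x) (scal_tm c ?y)))
        \<in> (vs_axioms :: ('k msym + 'f, 'p) fm set)"
      unfolding vs_axioms_def Let_def by (rule imageI) blast
    from ax[OF this] wf show ?thesis by simp
  qed
  show "scal (c + d) x = vadd (scal c x) (scal d x)"
  proof -
    have "univ_closure (Eq (scal_tm (c + d) ?x) (plus_tm (scal_tm c ?x) (scal_tm d ?x)))
        \<in> (vs_axioms :: ('k msym + 'f, 'p) fm set)"
      unfolding vs_axioms_def Let_def by (rule imageI) blast
    from ax[OF this] wf show ?thesis by simp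
  qed
  show "scal (c * d) x = scal c (scal d x)"
  proof -
    have "univ_closure (Eq (scal_tm (c * d) ?x) (scal_tm c (scal_tm d ?x)))
        \<in> (vs_axioms :: ('k msym + 'f, 'p) fm set)"
      unfolding vs_axioms_def Let_def by (rule imageI) blast
    from ax[OF this] wf show ?thesis by simp
  qed
qed

lemma scal_0: "x \<in> V \<Longrightarrow> scal 0 x = vzero"
proof -
  assume x: "x \<in> V"
  let ?o = "scal 0 x"
  have o: "?o \<in> V" using closed(3)[OF x] .
  obtain w where w: "w \<in> V" "vadd ?o w = vzero" using vs_laws(4)[OF o o o] by blast
  have "vadd ?o ?o = ?o" using vs_laws(7)[OF x x x, of 0 0] by simp
  then have "vadd ?o (vadd ?o w) = vadd ?o w" using vs_laws(1)[OF o o w(1)] by simp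
  then show "scal 0 x = vzero" using w(2) vs_laws(3)[OF o o o] by simp
qed

sublocale abelian V vadd vzero vneg
proof
  fix x assume x: "x \<in> V"
  have "vadd (scal 1 x) (scal (- 1) x) = scal (1 + - 1) x" using vs_laws(7)[OF x x x] by metis
  then show "vadd x (vneg x) = vzero" using scal_0[OF x] vs_laws(5)[OF x x x] by (simp add: vneg_def)
  show "vneg x \<in> V" using x by (simp add: vneg_def closed)
  show "vadd x vzero = x" using vs_laws(3)[OF x x x] .
  show "vadd x y = vadd y x" "vadd x y \<in> V" if "y \<in> V" for y
    using vs_laws(2)[OF x that x] closed(1)[OF x that] by auto
  show "vadd (vadd x y) z = vadd x (vadd y z)" if "y \<in> V" "z \<in> V" for y z
    using vs_laws(1)[OF x that] .
qed (rule closed(2))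

lemma scal_closed [simp]: "a \<in> V \<Longrightarrow> scal c a \<in> V"
  by (rule closed)

lemma scal_1 [simp]: "x \<in> V \<Longrightarrow> scal 1 x = x"
  by (simp add: vs_laws)

lemma scal_add: "x \<in> V \<Longrightarrow> y \<in> V \<Longrightarrow> scal c (vadd x y) = vadd (scal c x) (scal c y)"
  by (simp add: vs_laws)

lemma add_scal: "x \<in> V \<Longrightarrow> scal (c + d) x = vadd (scal c x) (scal d x)"
  by (simp add: vs_laws)

lemma scal_scal [simp]: "x \<in> V \<Longrightarrow> scal c (scal d x) = scal (c * d) x"
  by (simp add: vs_laws)

lemma scal_zero [simp]: "scal c vzero = vzero"
  using scal_0[of vzero] scal_scal[of vzero c 0] by simp

lemma scal_sub: "x \<in> V \<Longrightarrow> y \<in> V \<Longrightarrow> scal c (sub x y) = sub (scal c x) (scal c y)"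
  by (simp add: sub_def vneg_def scal_add)

lemma sub_eq_zero_iff: "x \<in> V \<Longrightarrow> y \<in> V \<Longrightarrow> sub x y = vzero \<longleftrightarrow> x = y"
  by (metis add_sub_same add_zero sub_self)

lemma ring_closed: "0 \<in> R" "1 \<in> R" "a \<in> R \<Longrightarrow> b \<in> R \<Longrightarrow> a + b \<in> R" "a \<in> R \<Longrightarrow> b \<in> R \<Longrightarrow> a * b \<in> R"
  "a \<in> R \<Longrightarrow> - a \<in> R"
  using subring by (auto simp: is_subring_def)

lemma G_in_V: "g \<in> G \<Longrightarrow> g \<in> V"
  by (simp add: G_def)

lemma G_closed: "vzero \<in> G" "g \<in> G \<Longrightarrow> h \<in> G \<Longrightarrow> vadd g h \<in> G" "r \<in> R \<Longrightarrow> g \<in> G \<Longrightarrow> scal r g \<in> G"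
proof -
  obtain d where d: "d \<in> V" using carr_nonempty by blast
  have "assignment M (\<lambda>_. d)" using d by (auto simp: assignment_def)
  from axiom_sat[OF _ this, of "in_G zero_tm"] show "vzero \<in> G"
    by (simp add: submodule_axioms_def Let_def G_def)
  show "vadd g h \<in> G" if "g \<in> G" "h \<in> G"
  proof -
    have "assignment M (env3 g h g)" using that by (auto simp: assignment_def G_def)
    from axiom_sat[OF _ this, of "Imp (And (in_G (Var 0)) (in_G (Var 1))) (in_G (plus_tm (Var 0) (Var 1)))"]
    show ?thesis using that by (simp add: submodule_axioms_def Let_def G_def)
  qed
  show "scal r g \<in> G" if "r \<in> R" "g \<in> G"
  proof -
    have "assignment M (env3 g g g)" using that by (auto simp: assignment_def G_def)
    from axiom_sat[OF _ this, of "Imp (in_G (Var 0)) (in_G (scal_tm r (Var 0)))"]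
    show ?thesis using that by (simp add: submodule_axioms_def Let_def G_def)
  qed
qed

lemma G_sub: "g \<in> G \<Longrightarrow> h \<in> G \<Longrightarrow> sub g h \<in> G"
  using G_closed ring_closed by (simp add: sub_def vneg_def)

section \<open>Linear terms as homomorphisms\<close>

lemma lin_closed: "lin \<tau> c \<Longrightarrow> assignment M e \<Longrightarrow> eval_tm M e \<tau> \<in> V"
  by (induction rule: lin.induct) (auto simp: assignment_in)

lemma lin_sub:
  "lin \<tau> c \<Longrightarrow> assignment M e \<Longrightarrow> assignment M e' \<Longrightarrow>
     eval_tm M (\<lambda>n. sub (e n) (e' n)) \<tau> = sub (eval_tm M e \<tau>) (eval_tm M e' \<tau>)"
proof (induction rule: lin.induct)
  case (lin_plus s b t c)
  then have V: "eval_tm M e s \<in> V" "eval_tm M e t \<in> V" "eval_tm M e' s \<in> V" "eval_tm M e' t \<in> V"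
    using lin_closed by auto
  then show ?case using lin_plus by (simp add: sub_def neg_add ac)
qed (auto simp: scal_sub lin_closed)

lemma lin_direction:
  "lin \<tau> c \<Longrightarrow> g \<in> V \<Longrightarrow> eval_tm M (\<lambda>n. scal (d n) g) \<tau> = scal (c d) g"
  by (induction rule: lin.induct) (auto simp: add_scal scal_0)

lemma lin_coefficient: "lin \<tau> c \<Longrightarrow> c (\<lambda>n. d n + t * d' n) = c d + t * c d'"
  by (induction rule: lin.induct) (auto simp: algebra_simps)

text \<open>A coefficient function applied to \<open>unit_at x\<close> gives the coefficient of
  \<open>x\<close>.\<close>

definition unit_at :: "nat \<Rightarrow> nat \<Rightarrow> 'k" where
  "unit_at x n = (if n = x then 1 else 0)"

lemma lin_upd:
  "lin \<tau> c \<Longrightarrow> assignment M e \<Longrightarrow> a \<in> V \<Longrightarrow>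
     eval_tm M (e(x := a)) \<tau> = vadd (eval_tm M e \<tau>) (scal (c (unit_at x)) (sub a (e x)))"
proof (induction rule: lin.induct)
  case (lin_Var y)
  then show ?case by (simp add: unit_at_def assignment_in scal_0)
next
  case (lin_plus s b t c)
  then have "eval_tm M e s \<in> V" "eval_tm M e t \<in> V" "e x \<in> V" using lin_closed by (auto simp: assignment_in)
  then show ?case using lin_plus by (simp add: add_scal ac)
next
  case (lin_scal t c k)
  then have "eval_tm M e t \<in> V" "e x \<in> V" using lin_closed by (auto simp: assignment_in)
  then show ?case using lin_scal by (simp add: scal_add)
qed (auto simp: scal_0 assignment_in)

text \<open>Formulas are represented by the conditions that they define on assignments. Quantifiers
  range over \<open>V\<close>, so membership of variables in \<open>G\<close> suffices: for a linear
  term \<open>t\<close>, \<open>G(t)\<close> says that some \<open>a\<close> in \<open>G\<close>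
  solves \<open>a - t = 0\<close>.\<close>

inductive pp :: "((nat \<Rightarrow> 'w) \<Rightarrow> bool) \<Rightarrow> bool" where
  pp_lin: "lin \<tau> c \<Longrightarrow> pp (\<lambda>e. eval_tm M e \<tau> = vzero)"
| pp_G: "pp (\<lambda>e. e i \<in> G)"
| pp_conj: "pp P \<Longrightarrow> pp Q \<Longrightarrow> pp (\<lambda>e. P e \<and> Q e)"
| pp_ex: "pp P \<Longrightarrow> pp (\<lambda>e. \<exists>a \<in> V. P (e(x := a)))"

lemma assignment_sub: "assignment M e \<Longrightarrow> assignment M e' \<Longrightarrow> assignment M (\<lambda>n. sub (e n) (e' n))"
  using sub_closed[OF assignment_in assignment_in, of e e'] by (auto simp: assignment_def)

lemma assignment_const: "a \<in> V \<Longrightarrow> assignment M (\<lambda>_. a)"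
  by (auto simp: assignment_def)

lemma pp_zero: "pp P \<Longrightarrow> P (\<lambda>_. vzero)"
proof (induction rule: pp.induct)
  case (pp_lin \<tau> c)
  have "(\<lambda>_. vzero) = (\<lambda>n. sub ((\<lambda>_. vzero) n) ((\<lambda>_. vzero) n))" by simp
  then show ?case using lin_sub[OF pp_lin, of "\<lambda>_. vzero" "\<lambda>_. vzero"] lin_closed[OF pp_lin]
    by (simp add: assignment_const)
next
  case (pp_ex P x)
  have "(\<lambda>_. vzero)(x := vzero) = (\<lambda>_. vzero)" by auto
  then show ?case using pp_ex.IH by (intro bexI[of _ vzero]) auto
qed (auto simp: G_closed)

lemma pp_sub:
  "pp P \<Longrightarrow> assignment M e \<Longrightarrow> assignment M e' \<Longrightarrow> P e \<Longrightarrow> P e' \<Longrightarrow> P (\<lambda>n. sub (e n) (e' n))"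
proof (induction arbitrary: e e' rule: pp.induct)
  case (pp_lin \<tau> c)
  then show ?case by (simp add: lin_sub)
next
  case (pp_ex P x)
  then obtain a b where ab: "a \<in> V" "P (e(x := a))" "b \<in> V" "P (e'(x := b))" by blast
  have "P (\<lambda>n. sub ((e(x := a)) n) ((e'(x := b)) n))"
    by (rule pp_ex.IH[OF assignment_upd[OF pp_ex.prems(1) ab(1)] assignment_upd[OF pp_ex.prems(2) ab(3)]
          ab(2,4)])
  moreover have "(\<lambda>n. sub ((e(x := a)) n) ((e'(x := b)) n)) = (\<lambda>n. sub (e n) (e' n))(x := sub a b)" by auto
  ultimately show ?case using ab by (intro bexI[of _ "sub a b"]) auto
qed (auto simp: G_sub)

lemma pp_add:
  assumes "pp P" "assignment M e" "assignment M e'" "P e" "P e'"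
  shows "P (\<lambda>n. vadd (e n) (e' n))"
proof -
  have z: "assignment M (\<lambda>_. vzero)" by (simp add: assignment_const)
  have "P (\<lambda>n. sub (e n) (sub vzero (e' n)))"
    using pp_sub[OF assms(1,2) assignment_sub[OF z assms(3)] assms(4)
        pp_sub[OF assms(1) z assms(3) pp_zero[OF assms(1)] assms(5)]] .
  moreover have "sub (e n) (sub vzero (e' n)) = vadd (e n) (e' n)" for n
    using assignment_in[OF assms(2)] assignment_in[OF assms(3)] by (simp add: sub_sub_right)
  ultimately show ?thesis by simp
qed

text \<open>
  For a direction \<open>d\<close>, a primitive positive condition either implies a linear equation that is not
  satisfied along \<open>d\<close>, or it contains \<open>r G d\<close> for some nonzero \<open>r\<close>. A projection along \<open>x\<close>
  inherits this from the directions \<open>d + t u\<close>, where \<open>u\<close> is the unit vector at \<open>x\<close>: if all of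
  them are obstructed, then two of the obstructing equations combine to one without \<open>x\<close>.
\<close>

lemma pp_direction:
  "pp P \<Longrightarrow> (\<exists>\<tau> c. lin \<tau> c \<and> c d \<noteq> 0 \<and> (\<forall>e. assignment M e \<longrightarrow> P e \<longrightarrow> eval_tm M e \<tau> = vzero)) \<or>
     (\<exists>r \<in> R - {0}. \<forall>g \<in> G. P (\<lambda>n. scal (r * d n) g))"
proof (induction arbitrary: d rule: pp.induct)
  case (pp_lin \<tau> c)
  show ?case
  proof (cases "c d = 0")
    case True
    then have "\<forall>g \<in> G. eval_tm M (\<lambda>n. scal (1 * d n) g) \<tau> = vzero"
      using lin_direction[OF pp_lin] G_in_V by (simp add: scal_0)
    then show ?thesis using ring_closed(2) by (intro disjI2 bexI[of _ 1]) auto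
  qed (use pp_lin in blast)
next
  case (pp_G i)
  \<comment> \<open>Multiplication by the denominator of \<open>d i\<close> brings the coefficient
    into \<open>R\<close>; here the fraction field enters.\<close>
  obtain a b where ab: "a \<in> R" "b \<in> R" "b \<noteq> 0" "d i = a / b"
    using frac unfolding frac_is_everything_def by blast
  then have "\<forall>g \<in> G. scal (b * d i) g \<in> G" using G_closed(3) by simp
  then show ?case using ab by blast
next
  case (pp_conj P Q)
  show ?case
  proof (cases "(\<exists>r \<in> R - {0}. \<forall>g \<in> G. P (\<lambda>n. scal (r * d n) g)) \<and> (\<exists>r \<in> R - {0}. \<forall>g \<in> G. Q (\<lambda>n. scal (r * d n) g))")
    case True
    then obtain r r' where r: "r \<in> R - {0}" "\<And>g. g \<in> G \<Longrightarrow> P (\<lambda>n. scal (r * d n) g)"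
      and r': "r' \<in> R - {0}" "\<And>g. g \<in> G \<Longrightarrow> Q (\<lambda>n. scal (r' * d n) g)" by blast
    \<comment> \<open>The product serves both conditions, because \<open>r' g\<close> and
      \<open>r g\<close> are again in \<open>G\<close>.\<close>
    have "P (\<lambda>n. scal (r * r' * d n) g) \<and> Q (\<lambda>n. scal (r * r' * d n) g)" if g: "g \<in> G" for g
      using r(2)[OF G_closed(3)[of r' g]] r'(2)[OF G_closed(3)[of r g]] g r(1) r'(1) G_in_V[OF g]
      by (simp add: ac_simps)
    moreover have "r * r' \<in> R - {0}" using r(1) r'(1) ring_closed(4) by simp
    ultimately show ?thesis by blast
  qed (use pp_conj.IH[of d] in blast)
next
  case (pp_ex P x)
  let ?d = "\<lambda>t n. d n + t * unit_at x n"
  show ?case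
  proof (cases "\<exists>t. \<exists>r \<in> R - {0}. \<forall>g \<in> G. P (\<lambda>n. scal (r * ?d t n) g)")
    case True
    then obtain t r where r: "r \<in> R - {0}" "\<And>g. g \<in> G \<Longrightarrow> P (\<lambda>n. scal (r * ?d t n) g)" by blast
    have "\<exists>a \<in> V. P ((\<lambda>n. scal (r * d n) g)(x := a))" if g: "g \<in> G" for g
    proof
      have "(\<lambda>n. scal (r * d n) g)(x := scal (r * ?d t x) g) = (\<lambda>n. scal (r * ?d t n) g)"
        by (auto simp: unit_at_def)
      then show "P ((\<lambda>n. scal (r * d n) g)(x := scal (r * ?d t x) g))" using r(2)[OF g] by simp
      show "scal (r * ?d t x) g \<in> V" using G_in_V[OF g] by simp
    qed
    then show ?thesis using r(1) by blast
  next
    case False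
    then have obs: "\<exists>\<tau> c. lin \<tau> c \<and> c (?d t) \<noteq> 0 \<and> (\<forall>e. assignment M e \<longrightarrow> P e \<longrightarrow> eval_tm M e \<tau> = vzero)" for t
      using pp_ex.IH[of "?d t"] by blast
    have "\<exists>\<tau> c. lin \<tau> c \<and> c d \<noteq> 0 \<and> c (unit_at x) = 0 \<and>
      (\<forall>e. assignment M e \<longrightarrow> P e \<longrightarrow> eval_tm M e \<tau> = vzero)"
    proof -
      obtain \<tau> c where \<tau>: "lin \<tau> c" "c d \<noteq> 0" "\<And>e. assignment M e \<Longrightarrow> P e \<Longrightarrow> eval_tm M e \<tau> = vzero"
        using obs[of 0] by auto
      let ?k = "c (unit_at x)"
      show ?thesis
      proof (cases "?k = 0")
        case False
        \<comment> \<open>This \<open>?t\<close> moves \<open>d\<close> into the kernel of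
          \<open>c\<close>, so the equation that obstructs there, \<open>\<sigma>\<close>, is
          independent of \<open>\<tau>\<close>.\<close>
        let ?t = "- (c d / ?k)"
        obtain \<sigma> b where \<sigma>: "lin \<sigma> b" "b (?d ?t) \<noteq> 0" "\<And>e. assignment M e \<Longrightarrow> P e \<Longrightarrow> eval_tm M e \<sigma> = vzero"
          using obs[of ?t] by blast
        \<comment> \<open>\<open>?m\<close> cancels the coefficient of \<open>x\<close>. At the
          moved direction the combination has the value of \<open>\<sigma>\<close>, which is
          nonzero; without \<open>x\<close> it has the same value at \<open>d\<close>.\<close>
        let ?m = "- (b (unit_at x) / ?k)"
        let ?\<rho> = "plus_tm \<sigma> (scal_tm ?m \<tau>)" and ?c = "\<lambda>d. b d + ?m * c d"
        have \<rho>: "lin ?\<rho> ?c" using lin_plus[OF \<sigma>(1) lin_scal[OF \<tau>(1)]] .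
        have "c (?d ?t) = 0" using lin_coefficient[OF \<tau>(1), of d ?t "unit_at x"] False by simp
        then have "?c (?d ?t) \<noteq> 0" using \<sigma>(2) by simp
        moreover have "?c (unit_at x) = 0" using False by simp
        moreover have "?c (?d ?t) = ?c d + ?t * ?c (unit_at x)"
          using lin_coefficient[OF \<rho>, of d ?t "unit_at x"] .
        ultimately have "?c d \<noteq> 0" "?c (unit_at x) = 0" by auto
        moreover have "\<forall>e. assignment M e \<longrightarrow> P e \<longrightarrow> eval_tm M e ?\<rho> = vzero"
          using \<tau>(3) \<sigma>(3) by simp
        ultimately show ?thesis using \<rho> by blast
      qed (use \<tau> in blast)
    qed
    then obtain \<tau> c where \<tau>: "lin \<tau> c" "c d \<noteq> 0" "c (unit_at x) = 0"
      "\<And>e. assignment M e \<Longrightarrow> P e \<Longrightarrow> eval_tm M e \<tau> = vzero" by blast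
    have "eval_tm M e \<tau> = vzero" if e: "assignment M e" and ex: "\<exists>a \<in> V. P (e(x := a))" for e
    proof -
      obtain a where a: "a \<in> V" "P (e(x := a))" using ex by blast
      have "eval_tm M (e(x := a)) \<tau> = eval_tm M e \<tau>"
        using lin_upd[OF \<tau>(1) e a(1), of x] \<tau>(3) lin_closed[OF \<tau>(1) e] a(1)
          assignment_in[OF e] by (simp add: scal_0)
      then show ?thesis using \<tau>(4)[OF assignment_upd[OF e a(1)] a(2)] by simp
    qed
    then show ?thesis using \<tau> by blast
  qed
qed

text \<open>Independence of \<open>x\<close> is semantic because the terms built in
  \<open>pp_dichotomy\<close> contain \<open>x\<close> syntactically, with total coefficient
  zero.\<close>

definition free_of :: "nat \<Rightarrow> ('k msym + 'f) tm \<Rightarrow> bool" where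
  "free_of x \<tau> \<longleftrightarrow> (\<exists>c. lin \<tau> c) \<and>
     (\<forall>e a. assignment M e \<longrightarrow> a \<in> V \<longrightarrow> eval_tm M (e(x := a)) \<tau> = eval_tm M e \<tau>)"

lemma pp_dichotomy:
  assumes "pp P"
  obtains (graph) \<tau> where "free_of x \<tau>" "\<And>e. assignment M e \<Longrightarrow> P e \<Longrightarrow> e x = eval_tm M e \<tau>"
  | (thick) r where "r \<in> R - {0}" "\<And>h. h \<in> G \<Longrightarrow> P ((\<lambda>_. vzero)(x := scal r h))"
proof -
  from pp_direction[OF assms, of "unit_at x"] show thesis
  proof
    assume "\<exists>\<tau> c. lin \<tau> c \<and> c (unit_at x) \<noteq> 0 \<and> (\<forall>e. assignment M e \<longrightarrow> P e \<longrightarrow> eval_tm M e \<tau> = vzero)"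
    then obtain \<tau> c where \<tau>: "lin \<tau> c" "c (unit_at x) \<noteq> 0"
      "\<And>e. assignment M e \<Longrightarrow> P e \<Longrightarrow> eval_tm M e \<tau> = vzero" by blast
    \<comment> \<open>The equation is solved for \<open>x\<close>: this scalar removes
      \<open>x\<close> from \<open>?\<rho>\<close>, while \<open>?\<rho>\<close> still equals
      \<open>x\<close> wherever \<open>\<tau>\<close> vanishes.\<close>
    let ?m = "- (1 / c (unit_at x))"
    let ?\<rho> = "plus_tm (Var x) (scal_tm ?m \<tau>)" and ?c = "\<lambda>d. d x + ?m * c d"
    have \<rho>: "lin ?\<rho> ?c" by (rule lin_plus[OF lin_Var lin_scal[OF \<tau>(1)]])
    have c0: "?c (unit_at x) = 0" using \<tau>(2) by (simp add: unit_at_def)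
    have "free_of x ?\<rho>"
      unfolding free_of_def
    proof (intro conjI exI[of _ ?c] allI impI \<rho>)
      fix e a assume e: "assignment M e" and a: "a \<in> V"
      show "eval_tm M (e(x := a)) ?\<rho> = eval_tm M e ?\<rho>"
        using lin_upd[OF \<rho> e a, of x] lin_closed[OF \<rho> e] a assignment_in[OF e]
        unfolding c0 by (simp only: scal_0 sub_closed add_zero)
    qed
    moreover have "e x = eval_tm M e ?\<rho>" if "assignment M e" "P e" for e
      using \<tau>(3)[OF that] assignment_in[OF that(1)] by simp
    ultimately show thesis by (rule graph)
  next
    assume "\<exists>r \<in> R - {0}. \<forall>g \<in> G. P (\<lambda>n. scal (r * unit_at x n) g)"
    then obtain r where r: "r \<in> R - {0}" "\<And>g. g \<in> G \<Longrightarrow> P (\<lambda>n. scal (r * unit_at x n) g)" by blast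
    have "(\<lambda>n. scal (r * unit_at x n) h) = (\<lambda>_. vzero)(x := scal r h)" if "h \<in> G" for h
      using G_in_V[OF that] by (auto simp: unit_at_def scal_0)
    then show thesis using thick r by simp
  qed
qed

section \<open>Fibres along one variable\<close>

definition fibre where "fibre P e x = {a \<in> V. P (e(x := a))}"
abbreviation "fibre0 P x \<equiv> fibre P (\<lambda>_. vzero) x"

text \<open>The difference of two points over \<open>e\<close> satisfies \<open>P\<close> over the
  zero assignment, so the subgroup does not depend on \<open>e\<close>. This makes fibres over
  different parameters comparable.\<close>

lemma fibre_coset:
  assumes P: "pp P" and e: "assignment M e"
  shows "coset (fibre0 P x) (fibre P e x)"
  unfolding coset_def
proof (intro conjI ballI)
  fix a b assume a: "a \<in> fibre P e x" and b: "b \<in> V"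
  have aV: "a \<in> V" and Pa: "P (e(x := a))" using a by (auto simp: fibre_def)
  let ?z = "(\<lambda>_. vzero)(x := sub b a)"
  have ea: "assignment M (e(x := a))" "assignment M (e(x := b))" "assignment M ?z"
    using e aV b by (auto intro!: assignment_upd simp: assignment_const)
  have 1: "(\<lambda>n. sub ((e(x := b)) n) ((e(x := a)) n)) = ?z" using assignment_in[OF e] by auto
  have 2: "(\<lambda>n. vadd ((e(x := a)) n) (?z n)) = e(x := b)" using assignment_in[OF e] aV b by auto
  have "P (e(x := b)) \<longleftrightarrow> P ?z"
    using pp_sub[OF P ea(2,1) _ Pa] pp_add[OF P ea(1,3) Pa] unfolding 1 2 by blast
  then show "b \<in> fibre P e x \<longleftrightarrow> sub b a \<in> fibre0 P x" using aV b by (simp add: fibre_def)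
qed (auto simp: fibre_def)

lemma fibre_subgrp:
  assumes P: "pp P"
  shows "subgrp (fibre0 P x)"
proof -
  have z: "assignment M (\<lambda>_. vzero)" by (simp add: assignment_const)
  have "(\<lambda>_. vzero)(x := vzero) = (\<lambda>_. vzero)" by auto
  then have z0: "vzero \<in> fibre0 P x" using pp_zero[OF P] by (simp add: fibre_def)
  have "sub a b \<in> fibre0 P x" if ab: "a \<in> fibre0 P x" "b \<in> fibre0 P x" for a b
    using coset_iff[OF fibre_coset[OF P z] ab(2)] ab coset_subset[OF fibre_coset[OF P z, of x]] by blast
  then show ?thesis using z0 by (auto simp: subgrp_def fibre_def)
qed

text \<open>The back-and-forth step of Baur and Monk.\<close>

lemma pp_extend:
  assumes fin: "finite \<P>" and pp: "\<And>P. P \<in> \<P> \<Longrightarrow> pp P" and e: "assignment M e" "assignment M e'"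
    and agree: "\<And>J. J \<subseteq> \<P> \<Longrightarrow>
      (\<exists>a \<in> V. \<forall>P \<in> J. P (e(x := a))) \<longleftrightarrow> (\<exists>a \<in> V. \<forall>P \<in> J. P (e'(x := a)))"
    and a: "a \<in> V"
  obtains a' where "a' \<in> V" "\<And>P. P \<in> \<P> \<Longrightarrow> P (e(x := a)) \<longleftrightarrow> P (e'(x := a'))"
proof -
  \<comment> \<open>\<open>Y\<close> collects the conditions that must hold at the new point; those
    in \<open>\<P> - Y\<close> must fail there.\<close>
  define Y where "Y = {P \<in> \<P>. P (e(x := a))}"
  have YP: "Y \<subseteq> \<P>" by (auto simp: Y_def)
  \<comment> \<open>Intersecting with \<open>V\<close> covers the case of empty
    \<open>Y\<close>.\<close>
  let ?C = "\<lambda>e. V \<inter> (\<Inter>P\<in>Y. fibre P e x)" and ?H = "V \<inter> (\<Inter>P\<in>Y. fibre0 P x)"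
  have V: "subgrp V" "coset V V" by (auto simp: subgrp_def coset_def)
  \<comment> \<open>If the fibres of the conditions in \<open>\<P> - Y\<close> covered
    \<open>?C e'\<close>, then by equality of the nerves they would also cover \<open>?C e\<close>;
    but \<open>a\<close> is not covered there.\<close>
  have "\<not> ?C e' \<subseteq> (\<Union>P\<in>\<P> - Y. fibre P e' x)"
  proof
    assume cov: "?C e' \<subseteq> (\<Union>P\<in>\<P> - Y. fibre P e' x)"
    have "?C e \<subseteq> (\<Union>P\<in>\<P> - Y. fibre P e x)"
    proof (rule cover_determined_by_nerve[OF _ _ _ _ _ _ _ _ cov])
      show "finite (\<P> - Y)" using fin by simp
      show "subgrp ?H" by (rule subgrp_Inter[OF V(1)]) (use fibre_subgrp pp YP in blast)
      show "coset ?H (?C e')" "coset ?H (?C e)"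
        by (rule coset_Inter[OF V(2)]; use fibre_coset pp YP e in blast)+
      show "subgrp (fibre0 P x)" "coset (fibre0 P x) (fibre P e' x)" "coset (fibre0 P x) (fibre P e x)"
        if "P \<in> \<P> - Y" for P using that fibre_subgrp fibre_coset pp e by auto
      fix J assume J: "J \<subseteq> \<P> - Y"
      have *: "?C e \<inter> (\<Inter>P\<in>J. fibre P e x) = {} \<longleftrightarrow> \<not> (\<exists>a \<in> V. \<forall>P \<in> Y \<union> J. P (e(x := a)))" for e
        by (auto simp: fibre_def)
      have "Y \<union> J \<subseteq> \<P>" using J YP by blast
      then show "?C e' \<inter> (\<Inter>P\<in>J. fibre P e' x) = {} \<longleftrightarrow> ?C e \<inter> (\<Inter>P\<in>J. fibre P e x) = {}"
        unfolding * using agree[of "Y \<union> J"] by simp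
    qed
    moreover have "a \<in> ?C e" using a by (auto simp: Y_def fibre_def)
    ultimately show False by (auto simp: Y_def fibre_def)
  qed
  then obtain a' where "a' \<in> V" "\<forall>P \<in> Y. P (e'(x := a'))" "\<forall>P \<in> \<P> - Y. \<not> P (e'(x := a'))"
    by (auto simp: fibre_def)
  then show thesis using that[of a'] by (auto simp: Y_def)
qed

end

section \<open>Elimination of quantifiers\<close>

context vs_pair
begin

definition defin :: "((nat \<Rightarrow> 'w) \<Rightarrow> bool) \<Rightarrow> bool" where
  "defin P \<longleftrightarrow> (\<exists>\<phi>. wf_fm L \<phi> \<and> (\<forall>e. assignment M e \<longrightarrow> P e = sat M0 e \<phi>))"

definition basic :: "((nat \<Rightarrow> 'w) \<Rightarrow> bool) \<Rightarrow> bool" where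
  "basic P \<longleftrightarrow> defin P \<or> pp P"

text \<open>This amounts to being a Boolean combination of basic conditions.\<close>

definition nice :: "((nat \<Rightarrow> 'w) \<Rightarrow> bool) \<Rightarrow> bool" where
  "nice P \<longleftrightarrow> (\<exists>\<F>. finite \<F> \<and> (\<forall>B \<in> \<F>. basic B) \<and>
     (\<forall>e e'. assignment M e \<longrightarrow> assignment M e' \<longrightarrow> (\<forall>B \<in> \<F>. B e = B e') \<longrightarrow> P e = P e'))"

text \<open>The axiom provides a point of \<open>r G\<close>, while one of \<open>c + r G\<close> is
  wanted. It is therefore applied to a translate of \<open>\<phi>\<close>, with \<open>c\<close> as
  a new parameter.\<close>

lemma density:
  assumes \<phi>: "wf_fm L \<phi>" and e: "assignment M e" and inf: "infinite (solutions M0 e x \<phi>)"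
    and c: "c \<in> V" and r: "r \<in> R - {0}"
  obtains h where "h \<in> G" "sat M0 (e(x := vadd c (scal r h))) \<phi>"
proof -
  define w where "w = Suc (Max (insert x (fv \<phi>)))"
  define u where "u = Suc w"
  have lt: "n < w" if "n \<in> insert x (fv \<phi>)" for n
    using that unfolding w_def by (intro le_imp_less_Suc Max_ge) auto
  have fresh: "w \<notin> fv \<phi>" "u \<notin> fv \<phi>" "w \<noteq> x" "u \<noteq> x" "u \<noteq> w"
    using lt[of w] lt[of u] lt[of x] by (auto simp: u_def)
  \<comment> \<open>\<open>\<psi>\<close> says \<open>\<phi>(w + x)\<close> without substitution:
    \<open>u\<close> keeps the value of \<open>w + x\<close> while \<open>x\<close> is bound
    again.\<close>
  define \<psi> :: "('k msym + 'f, 'p) fm" where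
    "\<psi> = Exists u (And (Eq (Var u) (plus_tm (Var w) (Var x))) (Exists x (And (Eq (Var x) (Var u)) \<phi>)))"
  have \<psi>: "wf_fm L \<psi>" using \<phi> vs_lang by (simp add: \<psi>_def extends_vs_lang_def numeral_2_eq_2)
  have sat_\<psi>: "sat M0 d \<psi> \<longleftrightarrow> sat M0 (d(x := vadd (d w) (d x))) \<phi>" if d: "assignment M d" for d
  proof -
    have V: "vadd (d w) (d x) \<in> V" using assignment_in[OF d] by simp
    have "sat M0 d \<psi> \<longleftrightarrow> sat M0 ((d(u := vadd (d w) (d x)))(x := vadd (d w) (d x))) \<phi>"
      unfolding \<psi>_def using V fresh by auto
    also have "\<dots> \<longleftrightarrow> sat M0 (d(x := vadd (d w) (d x))) \<phi>"
      by (rule sat_cong) (use fresh in auto)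
    finally show ?thesis .
  qed
  let ?e = "e(w := c)"
  have e': "assignment M ?e" using e c by (rule assignment_upd)
  have sat_\<psi>': "sat M0 (?e(x := a)) \<psi> \<longleftrightarrow> sat M0 (e(x := vadd c a)) \<phi>" if "a \<in> V" for a
  proof -
    have "sat M0 (?e(x := a)) \<psi> \<longleftrightarrow> sat M0 ((?e(x := a))(x := vadd c a)) \<phi>"
      using sat_\<psi>[OF assignment_upd[OF e' that, of x]] fresh by simp
    also have "\<dots> \<longleftrightarrow> sat M0 (e(x := vadd c a)) \<phi>" by (rule sat_cong) (use fresh in auto)
    finally show ?thesis .
  qed
  have "solutions M0 e x \<phi> \<subseteq> vadd c ` solutions M0 ?e x \<psi>"
  proof
    fix b assume b: "b \<in> solutions M0 e x \<phi>"
    then have "b \<in> V" "vadd c (sub b c) = b" using c by (auto simp: solutions_def)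
    then have "sub b c \<in> solutions M0 ?e x \<psi>" using b c sat_\<psi>'[of "sub b c"] by (simp add: solutions_def)
    then show "b \<in> vadd c ` solutions M0 ?e x \<psi>" using \<open>vadd c (sub b c) = b\<close> by force
  qed
  then have inf': "infinite (solutions M0 ?e x \<psi>)" using inf finite_surj by blast
  obtain \<theta> where \<theta>: "expresses_inf U L T x \<psi> \<theta>"
    using elim_inf \<psi> by (auto simp: eliminates_inf_def)
  have "Imp (old \<theta>) (Exists x (And (old \<psi>) (in_rG r x))) \<in> density_axioms U L R T"
    unfolding density_axioms_def using r \<psi> \<theta> by blast
  then have "sat M ?e (Imp (old \<theta>) (Exists x (And (old \<psi>) (in_rG r x))))"
    by (intro axiom_sat[OF _ e']) blast
  moreover have "sat M0 ?e \<theta>"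
    using expresses_inf_iff[OF M0_model \<psi> \<theta>] e' inf' by simp
  ultimately obtain a where a: "a \<in> V" "sat M0 (?e(x := a)) \<psi>" "sat M (?e(x := a)) (in_rG r x)"
    by (auto simp: sat_old)
  from a(3) obtain h where "h \<in> G" "a = scal r h" by (auto simp: in_rG_def G_def)
  then show thesis using that a sat_\<psi>' by blast
qed

lemma free_of_lin: "free_of x \<tau> \<Longrightarrow> wf_tm L \<tau>"
  using lin_wf vs_lang by (auto simp: free_of_def)

lemma free_of_upd: "free_of x \<tau> \<Longrightarrow> assignment M e \<Longrightarrow> a \<in> V \<Longrightarrow> eval_tm M (e(x := a)) \<tau> = eval_tm M e \<tau>"
  by (simp add: free_of_def)

lemma free_of_closed: "free_of x \<tau> \<Longrightarrow> assignment M e \<Longrightarrow> eval_tm M e \<tau> \<in> V"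
  using lin_closed by (auto simp: free_of_def)

text \<open>Substitution is expressed by a quantifier: some \<open>a\<close> equals the value of
  \<open>\<tau>\<close> and satisfies \<open>B\<close>. Both kinds of basic conditions are closed
  under this.\<close>

lemma basic_substitute:
  assumes "basic B" and \<tau>: "free_of x \<tau>"
  obtains B' where "basic B'" "\<And>e. assignment M e \<Longrightarrow> B' e = B (e(x := eval_tm M e \<tau>))"
proof -
  have eq: "(\<exists>a \<in> V. a = eval_tm M (e(x := a)) \<tau> \<and> P (e(x := a))) = P (e(x := eval_tm M e \<tau>))"
    if e: "assignment M e" for e P
    using free_of_upd[OF \<tau> e] free_of_closed[OF \<tau> e] by auto
  from assms(1) consider "defin B" | "pp B" by (auto simp: basic_def)
  then show thesis
  proof cases
    case 1
    then obtain \<phi> where \<phi>: "wf_fm L \<phi>" "\<And>e. assignment M e \<Longrightarrow> B e = sat M0 e \<phi>" by (auto simp: defin_def)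
    let ?\<psi> = "Exists x (And (Eq (Var x) \<tau>) \<phi>)"
    have "wf_fm L ?\<psi>" using \<phi>(1) free_of_lin[OF \<tau>] by simp
    then have "defin (\<lambda>e. sat M0 e ?\<psi>)" unfolding defin_def by blast
    then have "basic (\<lambda>e. sat M0 e ?\<psi>)" by (simp add: basic_def)
    moreover have "sat M0 e ?\<psi> = B (e(x := eval_tm M e \<tau>))" if e: "assignment M e" for e
      using eq[OF e, of "\<lambda>e. sat M0 e \<phi>"] \<phi>(2)[OF assignment_upd[OF e free_of_closed[OF \<tau> e]]] by simp
    ultimately show thesis by (rule that)
  next
    case 2
    obtain c where "lin \<tau> c" using \<tau> by (auto simp: free_of_def)
    from pp_lin[OF lin_plus[OF lin_Var[of x] lin_scal[OF this, of "- 1"]]]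
    have "pp (\<lambda>e. \<exists>a \<in> V. eval_tm M (e(x := a)) (plus_tm (Var x) (scal_tm (- 1) \<tau>)) = vzero \<and> B (e(x := a)))"
      using 2 by (intro pp_ex pp_conj)
    then have "basic (\<lambda>e. \<exists>a \<in> V. eval_tm M (e(x := a)) (plus_tm (Var x) (scal_tm (- 1) \<tau>)) = vzero \<and> B (e(x := a)))"
      (is "basic ?B") by (simp add: basic_def)
    moreover have "?B e = B (e(x := eval_tm M e \<tau>))" if e: "assignment M e" for e
    proof -
      have "eval_tm M (e(x := a)) (plus_tm (Var x) (scal_tm (- 1) \<tau>)) = vzero \<longleftrightarrow> a = eval_tm M (e(x := a)) \<tau>"
        if "a \<in> V" for a
        using sub_eq_zero_iff[OF that free_of_closed[OF \<tau> assignment_upd[OF e that, of x]]]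
        by (simp add: sub_def vneg_def)
      then show ?thesis using eq[OF e, of B] by (simp cong: bex_cong)
    qed
    ultimately show thesis by (rule that)
  qed
qed

text \<open>Density acts on a single formula, so the wanted truth values of finitely many definable
  conditions and the exclusion of finitely many terms are packed into one.\<close>

lemma defin_trace:
  assumes "finite \<Phi>" "\<And>B. B \<in> \<Phi> \<Longrightarrow> defin B" "finite \<T>" "\<And>\<tau>. \<tau> \<in> \<T> \<Longrightarrow> free_of x \<tau>"
  obtains \<phi> where "wf_fm L \<phi>" "\<And>e. assignment M e \<Longrightarrow> sat M0 e \<phi> \<longleftrightarrow>
    (\<forall>B \<in> \<Phi>. B e \<longleftrightarrow> B \<in> \<Psi>) \<and> (\<forall>\<tau> \<in> \<T>. e x \<noteq> eval_tm M e \<tau>)"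
proof -
  obtain f where f: "\<And>B. B \<in> \<Phi> \<Longrightarrow> wf_fm L (f B) \<and> (\<forall>e. assignment M e \<longrightarrow> B e = sat M0 e (f B))"
    using assms(2) unfolding defin_def by metis
  let ?I = "(\<lambda>B. if B \<in> \<Psi> then f B else Neg (f B)) ` \<Phi> \<union> (\<lambda>\<tau>. Neg (Eq (Var x) \<tau>)) ` \<T>"
  obtain xs where xs: "set xs = ?I" using finite_list[of ?I] assms(1,3) by auto
  have wf: "wf_fm L \<psi>" if "\<psi> \<in> set xs" for \<psi>
    using that f free_of_lin[OF assms(4)] unfolding xs by auto
  have "wf_fm L (Conjs ys)" if "\<And>\<psi>. \<psi> \<in> set ys \<Longrightarrow> wf_fm L \<psi>" for ys
    using that unfolding Conjs_def by (induction ys) auto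
  then have "wf_fm L (Conjs xs)" using wf by blast
  moreover have "sat M0 e (Conjs xs) \<longleftrightarrow>
      (\<forall>B \<in> \<Phi>. B e \<longleftrightarrow> B \<in> \<Psi>) \<and> (\<forall>\<tau> \<in> \<T>. e x \<noteq> eval_tm M e \<tau>)" if e: "assignment M e" for e
  proof -
    have "sat M0 e (if B \<in> \<Psi> then f B else Neg (f B)) \<longleftrightarrow> (B e \<longleftrightarrow> B \<in> \<Psi>)" if "B \<in> \<Phi>" for B
      using f[OF that] e by simp
    then show ?thesis unfolding sat_Conjs xs ball_Un ball_simps by (simp cong: ball_cong)
  qed
  ultimately show thesis by (rule that)
qed

lemma finite_solutions_free:
  assumes "wf_fm L \<phi>"
  obtains \<T> where "finite \<T>" "\<And>\<tau>. \<tau> \<in> \<T> \<Longrightarrow> free_of x \<tau>"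
    "\<And>e a. assignment M e \<Longrightarrow> finite (solutions M0 e x \<phi>) \<Longrightarrow> a \<in> solutions M0 e x \<phi> \<Longrightarrow>
       \<exists>\<tau> \<in> \<T>. a = eval_tm M e \<tau>"
proof -
  obtain \<T> where \<T>: "finite \<T>" "\<And>\<tau>. \<tau> \<in> \<T> \<Longrightarrow> (\<exists>c. lin \<tau> c) \<and> fv_tm \<tau> \<subseteq> fv \<phi> - {x}"
    "\<And>e a. assignment M0 e \<Longrightarrow> finite (solutions M0 e x \<phi>) \<Longrightarrow> a \<in> solutions M0 e x \<phi> \<Longrightarrow>
       \<exists>\<tau> \<in> \<T>. a = eval_tm M0 e \<tau>"
    using finite_solutions_uniform[OF M0_model assms, of x] by metis
  have "free_of x \<tau>" if "\<tau> \<in> \<T>" for \<tau>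
  proof -
    have "eval_tm M (e(x := a)) \<tau> = eval_tm M e \<tau>" for e a
      by (rule eval_tm_cong) (use \<T>(2)[OF that] in auto)
    then show ?thesis using \<T>(2)[OF that] by (auto simp: free_of_def)
  qed
  then show thesis using that[of \<T>] \<T>(1,3) by simp
qed

lemma pp_common_multiple:
  assumes "finite \<P>" "\<And>P. P \<in> \<P> \<Longrightarrow> \<exists>r \<in> R - {0}. \<forall>h \<in> G. P ((\<lambda>_. vzero)(x := scal r h))"
  obtains r where "r \<in> R - {0}" "\<And>P h. P \<in> \<P> \<Longrightarrow> h \<in> G \<Longrightarrow> P ((\<lambda>_. vzero)(x := scal r h))"
proof -
  have "\<exists>r \<in> R - {0}. \<forall>P \<in> \<P>. \<forall>h \<in> G. P ((\<lambda>_. vzero)(x := scal r h))"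
    using assms
  proof (induction \<P> rule: finite_induct)
    case empty
    then show ?case using ring_closed(2) by (intro bexI[of _ 1]) auto
  next
    case (insert P \<P>)
    obtain r where r: "r \<in> R - {0}" "\<forall>Q \<in> \<P>. \<forall>h \<in> G. Q ((\<lambda>_. vzero)(x := scal r h))"
      using insert.IH insert.prems by (metis (no_types, lifting) insertCI)
    obtain s where s: "s \<in> R - {0}" "\<forall>h \<in> G. P ((\<lambda>_. vzero)(x := scal s h))"
      using insert.prems by blast
    have "Q ((\<lambda>_. vzero)(x := scal (r * s) h))" if Q: "Q \<in> insert P \<P>" and h: "h \<in> G" for Q h
    proof (cases "Q = P")
      case True
      then show ?thesis using s(2) G_closed(3)[of r h] r(1) h G_in_V[OF h] by (force simp: mult.commute)
    next
      case False
      then show ?thesis using r(2) Q G_closed(3)[of s h] s(1) h G_in_V[OF h] by force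
    qed
    moreover have "r * s \<in> R - {0}" using r(1) s(1) ring_closed(4) by simp
    ultimately show ?case by blast
  qed
  then show thesis using that by blast
qed

lemma pp_finite_conj:
  assumes "finite J" "\<And>P. P \<in> J \<Longrightarrow> pp P"
  shows "pp (\<lambda>e. \<forall>P \<in> J. P e)"
  using assms
proof (induction J rule: finite_induct)
  case empty
  have "(\<lambda>e. \<forall>P \<in> {}. P e) = (\<lambda>e :: nat \<Rightarrow> 'w. eval_tm M e zero_tm = vzero)" by simp
  then show ?case using pp_lin[OF lin_zero] by metis
next
  case (insert P J)
  have "(\<lambda>e. \<forall>Q \<in> insert P J. Q e) = (\<lambda>e. P e \<and> (\<forall>Q \<in> J. Q e))" by auto
  then show ?case using pp_conj[of P "\<lambda>e. \<forall>Q \<in> J. Q e"] insert by simp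
qed

text \<open>\<open>b\<close> lies in the subgroup of which every fibre of \<open>P\<close> along
  \<open>x\<close> is a coset.\<close>

lemma pp_translate:
  assumes "pp P" "assignment M e" "a \<in> V" "b \<in> V" "P ((\<lambda>_. vzero)(x := b))"
  shows "P (e(x := vadd a b)) = P (e(x := a))"
proof -
  have z: "assignment M (\<lambda>_. vzero)" by (simp add: assignment_const)
  have b: "b \<in> fibre0 P x" using assms(4,5) by (simp add: fibre_def)
  have iff: "vadd a b \<in> fibre P e x \<longleftrightarrow> a \<in> fibre P e x"
  proof
    assume "a \<in> fibre P e x"
    then show "vadd a b \<in> fibre P e x"
      using coset_iff[OF fibre_coset[OF assms(1,2)]] assms(3,4) b by simp
  next
    assume *: "vadd a b \<in> fibre P e x"
    have "sub a (vadd a b) = vneg b" using assms(3,4) by (simp add: sub_def neg_add)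
    then show "a \<in> fibre P e x"
      using coset_iff[OF fibre_coset[OF assms(1,2)] *] assms(3) subgrp_neg[OF fibre_subgrp[OF assms(1)] b] by simp
  qed
  then show ?thesis using assms(3,4) by (simp add: fibre_def)
qed

text \<open>
  Back and forth: a witness for \<open>x\<close> is either the value of one of finitely many linear terms, or
  it lies in an infinite definable set. In the latter case Baur and Monk provide a point with
  the right primitive positive conditions, and density moves it into the definable set by an
  element of \<open>r G\<close>, which does not change these conditions.
\<close>

theorem nice_ex:
  assumes "nice P"
  shows "nice (\<lambda>e. \<exists>a \<in> V. P (e(x := a)))"
proof -
  obtain \<F> where \<F>: "finite \<F>" "\<And>B. B \<in> \<F> \<Longrightarrow> basic B"
    and det: "\<And>e e'. assignment M e \<Longrightarrow> assignment M e' \<Longrightarrow> \<forall>B \<in> \<F>. B e = B e' \<Longrightarrow> P e = P e'"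
    using assms unfolding nice_def by metis
  define \<Phi> where "\<Phi> = {B \<in> \<F>. defin B}"
  define \<P> where "\<P> = {B \<in> \<F>. pp B}"
  \<comment> \<open>\<open>\<P>1\<close> holds the conditions that determine \<open>x\<close> as a
    linear term; by \<open>pp_dichotomy\<close> the fibres of the others absorb some
    \<open>r G\<close>.\<close>
  define \<P>1 where "\<P>1 = {B \<in> \<P>. \<exists>\<tau>. free_of x \<tau> \<and> (\<forall>e. assignment M e \<longrightarrow> B e \<longrightarrow> e x = eval_tm M e \<tau>)}"
  have fin: "finite \<Phi>" "finite \<P>" "finite \<P>1" using \<F>(1) by (auto simp: \<Phi>_def \<P>_def \<P>1_def)
  have \<F>_cases: "B \<in> \<Phi> \<or> B \<in> \<P>" if "B \<in> \<F>" for B using \<F>(2)[OF that] that by (auto simp: basic_def \<Phi>_def \<P>_def)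
  have pp_P: "pp B" if "B \<in> \<P>" for B using that by (simp add: \<P>_def)
  have "\<forall>B \<in> \<P>1. \<exists>\<tau>. free_of x \<tau> \<and> (\<forall>e. assignment M e \<longrightarrow> B e \<longrightarrow> e x = eval_tm M e \<tau>)"
    by (auto simp: \<P>1_def)
  then obtain tm where tm: "\<And>B. B \<in> \<P>1 \<Longrightarrow> free_of x (tm B)"
    "\<And>B e. B \<in> \<P>1 \<Longrightarrow> assignment M e \<Longrightarrow> B e \<Longrightarrow> e x = eval_tm M e (tm B)" by metis
  have "\<exists>r \<in> R - {0}. \<forall>h \<in> G. B ((\<lambda>_. vzero)(x := scal r h))" if B: "B \<in> \<P> - \<P>1" for B
  proof -
    have "pp B" using B pp_P by blast
    then show ?thesis
    proof (cases rule: pp_dichotomy[of B x])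
      case (graph \<tau>)
      then show ?thesis using B by (auto simp: \<P>1_def)
    next
      case (thick r)
      then show ?thesis by blast
    qed
  qed
  then obtain r where r: "r \<in> R - {0}"
    "\<And>B h. B \<in> \<P> - \<P>1 \<Longrightarrow> h \<in> G \<Longrightarrow> B ((\<lambda>_. vzero)(x := scal r h))"
    using pp_common_multiple[of "\<P> - \<P>1" x] fin(2) by (metis finite_Diff)
  \<comment> \<open>Excluding the terms \<open>tm B\<close> makes all conditions in
    \<open>\<P>1\<close> fail at every point that satisfies a trace.\<close>
  define trace where "trace \<Psi> e \<longleftrightarrow> (\<forall>B \<in> \<Phi>. B e \<longleftrightarrow> B \<in> \<Psi>) \<and> (\<forall>\<tau> \<in> tm ` \<P>1. e x \<noteq> eval_tm M e \<tau>)"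
    for \<Psi> and e :: "nat \<Rightarrow> 'w"
  have "\<exists>\<phi>. wf_fm L \<phi> \<and> (\<forall>e. assignment M e \<longrightarrow> sat M0 e \<phi> = trace \<Psi> e)" for \<Psi>
    unfolding trace_def by (rule defin_trace[of \<Phi> "tm ` \<P>1" x \<Psi>]) (use fin tm(1) in \<open>auto simp: \<Phi>_def\<close>)
  then obtain \<phi> where wf: "\<And>\<Psi>. wf_fm L (\<phi> \<Psi>)"
    and sat_trace: "\<And>\<Psi> e. assignment M e \<Longrightarrow> sat M0 e (\<phi> \<Psi>) = trace \<Psi> e" by metis
  note sat_\<phi> = sat_trace[unfolded trace_def]
  have "\<exists>\<theta>. expresses_inf U L T x (\<phi> \<Psi>) \<theta>" for \<Psi>
    using elim_inf wf by (auto simp: eliminates_inf_def)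
  then obtain \<theta> where \<theta>: "\<And>\<Psi>. expresses_inf U L T x (\<phi> \<Psi>) (\<theta> \<Psi>)" by metis
  have "\<exists>\<T>. finite \<T> \<and> (\<forall>\<tau> \<in> \<T>. free_of x \<tau>) \<and> (\<forall>e a. assignment M e \<longrightarrow>
      finite (solutions M0 e x (\<phi> \<Psi>)) \<longrightarrow> a \<in> solutions M0 e x (\<phi> \<Psi>) \<longrightarrow> (\<exists>\<tau> \<in> \<T>. a = eval_tm M e \<tau>))" for \<Psi>
    by (rule finite_solutions_free[OF wf, of x \<Psi>]) blast
  then obtain \<T>0 where \<T>0: "\<And>\<Psi>. finite (\<T>0 \<Psi>)" "\<And>\<Psi> \<tau>. \<tau> \<in> \<T>0 \<Psi> \<Longrightarrow> free_of x \<tau>"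
    "\<And>\<Psi> e a. assignment M e \<Longrightarrow> finite (solutions M0 e x (\<phi> \<Psi>)) \<Longrightarrow> a \<in> solutions M0 e x (\<phi> \<Psi>) \<Longrightarrow>
       \<exists>\<tau> \<in> \<T>0 \<Psi>. a = eval_tm M e \<tau>" by metis
  \<comment> \<open>The terms for exceptional witnesses: the graphs of \<open>\<P>1\<close> and, for
    each trace, the terms that exhaust its finite solution sets.\<close>
  define \<T> where "\<T> = tm ` \<P>1 \<union> (\<Union>\<Psi> \<in> Pow \<Phi>. \<T>0 \<Psi>)"
  have fin_T: "finite \<T>" using fin \<T>0(1) by (simp add: \<T>_def)
  have free_T: "free_of x \<tau>" if "\<tau> \<in> \<T>" for \<tau> using that tm(1) \<T>0(2) by (auto simp: \<T>_def)
  have "\<exists>B'. basic B' \<and> (\<forall>e. assignment M e \<longrightarrow> B' e = B (e(x := eval_tm M e \<tau>)))"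
    if "B \<in> \<F>" "\<tau> \<in> \<T>" for B \<tau>
    by (rule basic_substitute[OF \<F>(2)[OF that(1)] free_T[OF that(2)]]) blast
  then obtain s where s: "\<And>B \<tau>. B \<in> \<F> \<Longrightarrow> \<tau> \<in> \<T> \<Longrightarrow> basic (s B \<tau>)"
    "\<And>B \<tau> e. B \<in> \<F> \<Longrightarrow> \<tau> \<in> \<T> \<Longrightarrow> assignment M e \<Longrightarrow> s B \<tau> e = B (e(x := eval_tm M e \<tau>))" by metis
  define ex where "ex J e = (\<exists>a \<in> V. \<forall>B \<in> J. B (e(x := a)))" for J :: "((nat \<Rightarrow> 'w) \<Rightarrow> bool) set" and e
  have pp_ex_J: "pp (ex J)" if "J \<subseteq> \<P>" for J
  proof -
    have "pp (\<lambda>e. \<forall>B \<in> J. B e)" using that pp_P finite_subset[OF that fin(2)] by (intro pp_finite_conj) auto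
    from pp_ex[OF this, of x] show ?thesis unfolding ex_def .
  qed
  \<comment> \<open>Three families have to agree: whether a trace has infinitely many solutions,
    what holds at each exceptional term, and which sets of primitive positive conditions have a
    common solution, that is, the nerve.\<close>
  define \<G> where "\<G> = (\<lambda>\<Psi> e. sat M0 e (\<theta> \<Psi>)) ` Pow \<Phi> \<union> (\<lambda>(B, \<tau>). s B \<tau>) ` (\<F> \<times> \<T>) \<union> ex ` Pow \<P>"
  have fin_G: "finite \<G>" using fin \<F>(1) fin_T by (simp add: \<G>_def)
  have "defin (\<lambda>e. sat M0 e (\<theta> \<Psi>))" for \<Psi>
    using \<theta>[of \<Psi>] unfolding defin_def expresses_inf_def by blast
  then have basic_G: "basic B" if "B \<in> \<G>" for B
    using that s(1) pp_ex_J by (auto simp: \<G>_def basic_def)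
  have forth: "\<exists>a' \<in> V. \<forall>B \<in> \<F>. B (e(x := a)) = B (e'(x := a'))"
    if e: "assignment M e" "assignment M e'" and agree: "\<forall>B \<in> \<G>. B e = B e'" and a: "a \<in> V" for e e' a
  proof (cases "\<exists>\<tau> \<in> \<T>. a = eval_tm M e \<tau>")
    case True
    then obtain \<tau> where \<tau>: "\<tau> \<in> \<T>" "a = eval_tm M e \<tau>" by blast
    have "B (e(x := a)) = B (e'(x := eval_tm M e' \<tau>))" if B: "B \<in> \<F>" for B
    proof -
      have "s B \<tau> \<in> \<G>" using B \<tau>(1) by (force simp: \<G>_def)
      from bspec[OF agree this] have "s B \<tau> e = s B \<tau> e'" .
      then show ?thesis using s(2)[OF B \<tau>(1)] e \<tau>(2) by simp
    qed
    then show ?thesis using free_of_closed[OF free_T[OF \<tau>(1)] e(2)] by blast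
  next
    case False
    define \<Psi> where "\<Psi> = {B \<in> \<Phi>. B (e(x := a))}"
    have \<Psi>: "\<Psi> \<in> Pow \<Phi>" by (auto simp: \<Psi>_def)
    have ea: "assignment M (e(x := a))" using e(1) a by (rule assignment_upd)
    have no_tm: "a \<noteq> eval_tm M e \<tau>" if "\<tau> \<in> \<T>" for \<tau> using False that by blast
    have "sat M0 (e(x := a)) (\<phi> \<Psi>)"
      unfolding sat_\<phi>[OF ea]
    proof (intro conjI ballI)
      fix \<tau> assume "\<tau> \<in> tm ` \<P>1"
      then have "\<tau> \<in> \<T>" by (simp add: \<T>_def)
      then show "(e(x := a)) x \<noteq> eval_tm M (e(x := a)) \<tau>"
        using no_tm free_of_upd[OF free_T e(1) a] by simp
    qed (auto simp: \<Psi>_def)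
    then have sol: "a \<in> solutions M0 e x (\<phi> \<Psi>)" using a by (simp add: solutions_def)
    have "infinite (solutions M0 e x (\<phi> \<Psi>))"
    proof
      assume "finite (solutions M0 e x (\<phi> \<Psi>))"
      from \<T>0(3)[OF e(1) this sol] obtain \<tau> where "\<tau> \<in> \<T>0 \<Psi>" "a = eval_tm M e \<tau>" by blast
      then show False using no_tm \<Psi> by (auto simp: \<T>_def)
    qed
    then have "sat M0 e (\<theta> \<Psi>)" using expresses_inf_iff[OF M0_model wf \<theta>] e(1) by simp
    moreover have "(\<lambda>e. sat M0 e (\<theta> \<Psi>)) \<in> \<G>" unfolding \<G>_def using \<Psi> by (intro UnI1 imageI)
    from bspec[OF agree this] have "sat M0 e (\<theta> \<Psi>) = sat M0 e' (\<theta> \<Psi>)" .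
    ultimately have "sat M0 e' (\<theta> \<Psi>)" by simp
    then have inf: "infinite (solutions M0 e' x (\<phi> \<Psi>))"
      using expresses_inf_iff[OF M0_model wf \<theta>] e(2) by simp
    have agree_ex: "ex J e = ex J e'" if "J \<subseteq> \<P>" for J
    proof -
      have "ex J \<in> \<G>" unfolding \<G>_def using that by (intro UnI2 imageI) simp
      from bspec[OF agree this] show ?thesis .
    qed
    \<comment> \<open>\<open>b\<close> has the right primitive positive conditions but an arbitrary
      trace; the shift by \<open>scal r h\<close> corrects the trace.\<close>
    have "\<exists>b \<in> V. \<forall>B \<in> \<P>. B (e(x := a)) = B (e'(x := b))"
      by (rule pp_extend[OF fin(2) pp_P e agree_ex[unfolded ex_def] a]) blast+
    then obtain b where b: "b \<in> V" "\<And>B. B \<in> \<P> \<Longrightarrow> B (e(x := a)) = B (e'(x := b))" by blast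
    obtain h where h: "h \<in> G" "sat M0 (e'(x := vadd b (scal r h))) (\<phi> \<Psi>)"
      by (rule density[OF wf e(2) inf b(1) r(1)])
    let ?a = "vadd b (scal r h)"
    have hV: "scal r h \<in> V" using G_in_V[OF h(1)] by simp
    then have aV: "?a \<in> V" using b(1) by simp
    have ea': "assignment M (e'(x := ?a))" using e(2) aV by (rule assignment_upd)
    note sat = h(2)[unfolded sat_\<phi>[OF ea']]
    have "B (e(x := a)) = B (e'(x := ?a))" if B: "B \<in> \<F>" for B
    proof (cases "B \<in> \<Phi>")
      case True
      then show ?thesis using sat by (auto simp: \<Psi>_def)
    next
      case False
      then have BP: "B \<in> \<P>" using \<F>_cases[OF B] by blast
      show ?thesis
      proof (cases "B \<in> \<P>1")
        case True
        \<comment> \<open>Conditions in \<open>\<P>1\<close> are false on both sides: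
          \<open>a\<close> is not an exceptional value, and the new point satisfies the trace
          formula.\<close>
        have "\<not> B (e(x := a))"
          using tm(2)[OF True ea] no_tm[of "tm B"] free_of_upd[OF tm(1)[OF True] e(1) a] True
          by (auto simp: \<T>_def)
        moreover have "\<not> B (e'(x := ?a))" using tm(2)[OF True ea'] sat True by blast
        ultimately show ?thesis by simp
      next
        case False
        then show ?thesis
          using b(2)[OF BP] pp_translate[OF pp_P[OF BP] e(2) b(1) hV r(2)[of B h]] BP h(1) by blast
      qed
    qed
    then show ?thesis using aV by blast
  qed
  have half: "\<exists>a \<in> V. P (e'(x := a))"
    if e: "assignment M e" "assignment M e'" and agree: "\<forall>B \<in> \<G>. B e = B e'"
      and ex: "\<exists>a \<in> V. P (e(x := a))" for e e'
  proof -
    obtain a where a: "a \<in> V" "P (e(x := a))" using ex by blast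
    obtain a' where a': "a' \<in> V" "\<forall>B \<in> \<F>. B (e(x := a)) = B (e'(x := a'))"
      using forth[OF e agree a(1)] by blast
    have "P (e(x := a)) = P (e'(x := a'))"
      by (rule det[OF assignment_upd[OF e(1) a(1)] assignment_upd[OF e(2) a'(1)] a'(2)])
    then show ?thesis using a(2) a'(1) by blast
  qed
  show ?thesis
    unfolding nice_def
  proof (intro exI[of _ \<G>] conjI ballI allI impI)
    show "finite \<G>" by (rule fin_G)
    show "basic B" if "B \<in> \<G>" for B using that by (rule basic_G)
    fix e e' assume e: "assignment M e" "assignment M e'" and agree: "\<forall>B \<in> \<G>. B e = B e'"
    from agree have "\<forall>B \<in> \<G>. B e' = B e" by (metis (no_types))
    from half[OF e agree] half[OF e(2,1) this]
    show "(\<exists>a \<in> V. P (e(x := a))) = (\<exists>a \<in> V. P (e'(x := a)))" by (rule iffI)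
  qed
qed

section \<open>Closure properties of \<open>nice\<close>\<close>

lemma niceI:
  assumes "finite \<F>" "\<And>B. B \<in> \<F> \<Longrightarrow> basic B"
    "\<And>e e'. assignment M e \<Longrightarrow> assignment M e' \<Longrightarrow> (\<And>B. B \<in> \<F> \<Longrightarrow> B e = B e') \<Longrightarrow> P e = P e'"
  shows "nice P"
  unfolding nice_def
proof (intro exI[of _ \<F>] conjI ballI allI impI)
  fix e e' assume "assignment M e" "assignment M e'" "\<forall>B \<in> \<F>. B e = B e'"
  then show "P e = P e'" using assms(3) by (metis (no_types))
qed (use assms(1,2) in auto)

lemma niceE:
  assumes "nice P"
  obtains \<F> where "finite \<F>" "\<And>B. B \<in> \<F> \<Longrightarrow> basic B"
    "\<And>e e'. assignment M e \<Longrightarrow> assignment M e' \<Longrightarrow> (\<And>B. B \<in> \<F> \<Longrightarrow> B e = B e') \<Longrightarrow> P e = P e'"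
  using assms unfolding nice_def by metis

lemma basic_nice: "basic P \<Longrightarrow> nice P"
  by (rule niceI[of "{P}"]) auto

lemma nice_cong:
  assumes "nice P" "\<And>e. assignment M e \<Longrightarrow> P e = Q e"
  shows "nice Q"
proof -
  obtain \<F> where \<F>: "finite \<F>" "\<And>B. B \<in> \<F> \<Longrightarrow> basic B"
    "\<And>e e'. assignment M e \<Longrightarrow> assignment M e' \<Longrightarrow> (\<And>B. B \<in> \<F> \<Longrightarrow> B e = B e') \<Longrightarrow> P e = P e'"
    by (rule niceE[OF assms(1)]) blast
  show ?thesis
  proof (rule niceI[OF \<F>(1,2)])
    fix e e' assume e: "assignment M e" "assignment M e'" and agree: "\<And>B. B \<in> \<F> \<Longrightarrow> B e = B e'"
    show "Q e = Q e'" using \<F>(3)[OF e agree] assms(2)[OF e(1)] assms(2)[OF e(2)] by simp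
  qed
qed

lemma nice_False: "nice (\<lambda>_. False)"
  by (rule niceI[of "{}"]) auto

lemma nice_imp:
  assumes "nice P" "nice Q"
  shows "nice (\<lambda>e. P e \<longrightarrow> Q e)"
proof -
  obtain A where A: "finite A" "\<And>B. B \<in> A \<Longrightarrow> basic B"
    "\<And>e e'. assignment M e \<Longrightarrow> assignment M e' \<Longrightarrow> (\<And>B. B \<in> A \<Longrightarrow> B e = B e') \<Longrightarrow> P e = P e'"
    by (rule niceE[OF assms(1)]) blast
  obtain C where C: "finite C" "\<And>B. B \<in> C \<Longrightarrow> basic B"
    "\<And>e e'. assignment M e \<Longrightarrow> assignment M e' \<Longrightarrow> (\<And>B. B \<in> C \<Longrightarrow> B e = B e') \<Longrightarrow> Q e = Q e'"
    by (rule niceE[OF assms(2)]) blast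
  show ?thesis
  proof (rule niceI[of "A \<union> C"])
    fix e e' assume e: "assignment M e" "assignment M e'" and agree: "\<And>B. B \<in> A \<union> C \<Longrightarrow> B e = B e'"
    have "P e = P e'" by (rule A(3)[OF e agree]) simp
    moreover have "Q e = Q e'" by (rule C(3)[OF e agree]) simp
    ultimately show "(P e \<longrightarrow> Q e) = (P e' \<longrightarrow> Q e')" by simp
  qed (use A C in auto)
qed

lemma nice_not: "nice P \<Longrightarrow> nice (\<lambda>e. \<not> P e)"
  using nice_imp[OF _ nice_False] by simp

lemma nice_conj: "nice P \<Longrightarrow> nice Q \<Longrightarrow> nice (\<lambda>e. P e \<and> Q e)"
  using nice_not[OF nice_imp[OF _ nice_not, of P Q]] by simp

lemma nice_all: "nice P \<Longrightarrow> nice (\<lambda>e. \<forall>a \<in> V. P (e(x := a)))"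
  using nice_not[OF nice_ex[OF nice_not, of P x]] by simp

lemma nice_finite_conj: "finite I \<Longrightarrow> (\<And>i. i \<in> I \<Longrightarrow> nice (P i)) \<Longrightarrow> nice (\<lambda>e. \<forall>i \<in> I. P i e)"
proof (induction I rule: finite_induct)
  case empty
  then show ?case using nice_not[OF nice_False] by simp
next
  case (insert i I)
  then show ?case using nice_conj[of "P i" "\<lambda>e. \<forall>i \<in> I. P i e"] by simp
qed

lemma nice_defin: "wf_fm L \<phi> \<Longrightarrow> nice (\<lambda>e. sat M0 e \<phi>)"
  by (rule basic_nice) (auto simp: basic_def defin_def simp del: sat.simps)

lemma nice_G: "nice (\<lambda>e. e x \<in> G)"
  by (rule basic_nice) (simp add: basic_def pp_G)

lemma eval_in_V: "wf_tm L t \<Longrightarrow> assignment M e \<Longrightarrow> eval_tm M e t \<in> V"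
  using eval_tm_in_carr[of L M0 e t] M0_model by (simp add: models_def)

lemma nice_substitute:
  assumes "nice P" "wf_tm L t" "x \<notin> fv_tm t"
  shows "nice (\<lambda>e. P (e(x := eval_tm M e t)))"
proof (rule nice_cong)
  have "nice (\<lambda>e. sat M0 e (Eq (Var x) t) \<and> P e)"
    by (intro nice_conj nice_defin assms(1)) (use assms(2) in simp)
  then show "nice (\<lambda>e. \<exists>a \<in> V. sat M0 (e(x := a)) (Eq (Var x) t) \<and> P (e(x := a)))" by (rule nice_ex)
  fix e assume e: "assignment M e"
  have "eval_tm M (e(x := a)) t = eval_tm M e t" for a
    by (rule eval_tm_cong) (use assms(3) in auto)
  then show "(\<exists>a \<in> V. sat M0 (e(x := a)) (Eq (Var x) t) \<and> P (e(x := a))) = P (e(x := eval_tm M e t))"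
    using eval_in_V[OF assms(2) e] by simp
qed

text \<open>The substitutions are carried out one after another. If the variables replaced do not
  occur in the terms, this is simultaneous substitution (\<open>seq_subst_zip\<close>).\<close>

fun seq_subst :: "(nat \<times> ('k msym + 'f) tm) list \<Rightarrow> (nat \<Rightarrow> 'w) \<Rightarrow> nat \<Rightarrow> 'w" where
  "seq_subst [] e = e"
| "seq_subst ((x, t) # ps) e = seq_subst ps (e(x := eval_tm M e t))"

lemma nice_seq_subst:
  assumes "nice P" "\<And>x t. (x, t) \<in> set ps \<Longrightarrow> wf_tm L t \<and> x \<notin> fv_tm t"
  shows "nice (\<lambda>e. P (seq_subst ps e))"
  using assms(2)
proof (induction ps)
  case Nil
  then show ?case using assms(1) by simp
next
  case (Cons p ps)
  obtain x t where p: "p = (x, t)" by (cases p)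
  have "nice (\<lambda>e. P (seq_subst ps e))" by (rule Cons.IH) (rule Cons.prems, simp)
  then show ?case using nice_substitute[of "\<lambda>e. P (seq_subst ps e)" t x] Cons.prems[of x t] unfolding p by simp
qed

lemma assignment_seq_subst:
  "(\<And>x t. (x, t) \<in> set ps \<Longrightarrow> wf_tm L t) \<Longrightarrow> assignment M e \<Longrightarrow> assignment M (seq_subst ps e)"
proof (induction ps arbitrary: e)
  case (Cons p ps)
  obtain x t where p: "p = (x, t)" by (cases p)
  have "assignment M (e(x := eval_tm M e t))"
    by (rule assignment_upd[OF Cons.prems(2) eval_in_V[OF Cons.prems(1)[of x] Cons.prems(2)]]) (simp add: p)
  moreover have "wf_tm L s" if "(y, s) \<in> set ps" for y s by (rule Cons.prems(1)[of y]) (use that in simp)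
  ultimately show ?case using Cons.IH[of "e(x := eval_tm M e t)"] by (simp only: p seq_subst.simps)
qed simp

lemma seq_subst_zip:
  assumes "length xs = length ts" "distinct xs" "\<And>t. t \<in> set ts \<Longrightarrow> set xs \<inter> fv_tm t = {}"
  shows "map (seq_subst (zip xs ts) e) xs = map (eval_tm M e) ts"
    "y \<notin> set xs \<Longrightarrow> seq_subst (zip xs ts) e y = e y"
proof -
  have "map (seq_subst (zip xs ts) e) xs = map (eval_tm M e) ts \<and>
      (\<forall>y. y \<notin> set xs \<longrightarrow> seq_subst (zip xs ts) e y = e y)"
    using assms
  proof (induction xs ts arbitrary: e rule: list_induct2)
    case (Cons x xs t ts)
    define e' where "e' = e(x := eval_tm M e t)"
    have IH: "map (seq_subst (zip xs ts) e') xs = map (eval_tm M e') ts \<and>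
      (\<forall>y. y \<notin> set xs \<longrightarrow> seq_subst (zip xs ts) e' y = e' y)"
      by (rule Cons.IH) (use Cons.prems in auto)
    have "eval_tm M e' s = eval_tm M e s" if "s \<in> set ts" for s
      unfolding e'_def by (rule eval_tm_cong) (use Cons.prems(2)[of s] that in auto)
    then have "map (eval_tm M e') ts = map (eval_tm M e) ts" by simp
    moreover have "seq_subst (zip (x # xs) (t # ts)) e = seq_subst (zip xs ts) e'" by (simp add: e'_def)
    moreover have "e' x = eval_tm M e t" "\<And>y. y \<noteq> x \<Longrightarrow> e' y = e y" by (simp_all add: e'_def)
    ultimately show ?case using IH Cons.prems(1) by (simp del: seq_subst.simps zip_Cons_Cons)
  qed simp
  then show "map (seq_subst (zip xs ts) e) xs = map (eval_tm M e) ts"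
    "y \<notin> set xs \<Longrightarrow> seq_subst (zip xs ts) e y = e y" by auto
qed

text \<open>A quantifier over \<open>G\<close> is a quantifier over \<open>V\<close> with a nice
  guard, so \<open>nice_all\<close> handles module formulas of any quantifier depth.\<close>

lemma nice_relativize: "wf_fm (module_lang R) \<phi> \<Longrightarrow> nice (\<lambda>e. sat M e (relativize \<phi>))"
proof (induction \<phi>)
  case Bot
  then show ?case using nice_False by simp
next
  case (Eq s t)
  have ar: "fun_ar L (Inl f) = Some n" if "fun_ar (module_lang R) f = Some n" for f n
  proof (cases f)
    case (Scal c)
    then show ?thesis using that vs_lang
      by (auto simp: extends_vs_lang_def module_lang_def split: if_splits)
  qed (use that vs_lang in \<open>auto simp: extends_vs_lang_def module_lang_def\<close>)
  have "wf_tm L (map_tm Inl t)" if "wf_tm (module_lang R) t" for t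
    using that by (induction t) (auto simp: list_all_iff dest: ar)
  then have "wf_fm L (Eq (map_tm Inl s) (map_tm Inl t))" using Eq by simp
  from nice_defin[OF this] show ?case by simp
next
  case (Rel p ts)
  then show ?case by (simp add: module_lang_def)
next
  case (Imp \<phi> \<psi>)
  then show ?case using nice_imp by simp
next
  case (Forall x \<phi>)
  have "nice (\<lambda>e. e x \<in> G \<longrightarrow> sat M e (relativize \<phi>))" by (rule nice_imp[OF nice_G]) (use Forall in simp)
  from nice_all[OF this, of x] show ?case by (rule nice_cong) (auto simp: G_def)
qed

lemma predicate_iff:
  assumes "formula_in R xs \<phi>" "assignment M e"
  shows "rel_int M (Pred xs \<phi>) (map e xs) \<longleftrightarrow> (\<forall>x \<in> set xs. e x \<in> G) \<and> sat M e (relativize \<phi>)"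
proof -
  let ?P = "Rel (Pred xs \<phi>) (map Var xs) :: ('k msym + 'f, ('k, 'p) grel) fm"
  have "Imp ?P (all_in_G xs) \<in> predicate_axioms R"
    unfolding predicate_axioms_def by (intro UnI1 CollectI exI[of _ xs] exI[of _ \<phi>] conjI refl assms(1))
  then have "sat M e (Imp ?P (all_in_G xs))" by (intro axiom_sat[OF _ assms(2)] UnI1 UnI2)
  moreover have "Imp (all_in_G xs) (Iff ?P (relativize \<phi>)) \<in> predicate_axioms R"
    unfolding predicate_axioms_def by (intro UnI2 CollectI exI[of _ xs] exI[of _ \<phi>] conjI refl assms(1))
  then have "sat M e (Imp (all_in_G xs) (Iff ?P (relativize \<phi>)))"
    by (intro axiom_sat[OF _ assms(2)] UnI1 UnI2)
  moreover have "sat M e (all_in_G xs) \<longleftrightarrow> (\<forall>x \<in> set xs. e x \<in> G)"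
    using assignment_in[OF assms(2)] by (auto simp: all_in_G_def sat_Conjs G_def)
  moreover have "sat M e ?P \<longleftrightarrow> rel_int M (Pred xs \<phi>) (map e xs)" by (simp add: comp_def)
  ultimately show ?thesis by auto
qed

theorem nice_formula: "wf_fm (G_lang L R) \<phi> \<Longrightarrow> nice (\<lambda>e. sat M e \<phi>)"
proof (induction \<phi>)
  case Bot
  then show ?case using nice_False by simp
next
  case (Eq s t)
  have "wf_tm L t" if "wf_tm (G_lang L R) t" for t
    using that by (induction t) (auto simp: list_all_iff G_lang_def)
  then have "wf_fm L (Eq s t)" using Eq by simp
  from nice_defin[OF this] show ?case by simp
next
  case (Rel p ts)
  have "wf_tm L t" if "wf_tm (G_lang L R) t" for t
    using that by (induction t) (auto simp: list_all_iff G_lang_def)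
  then have ts: "wf_tm L t" if "t \<in> set ts" for t using Rel that by (simp add: list_all_iff)
  have ar: "G_rel_ar L R p = Some (length ts)" using Rel by (simp add: G_lang_def)
  show ?case
  proof (cases p)
    case (Old q)
    then have "wf_fm L (Rel q ts)" using ts ar by (simp add: list_all_iff)
    moreover have "sat M0 e (Rel q ts) = sat M e (Rel p ts)" for e
      using sat_old[of M e "Rel q ts"] Old by (simp add: tm.map_id0)
    ultimately show ?thesis using nice_cong[OF nice_defin[of "Rel q ts"]] by (simp only:)
  next
    case InG
    then obtain t where t: "ts = [t]" using ar by (cases ts) auto
    define w where "w = Suc (Max (insert 0 (fv_tm t)))"
    have "n < w" if "n \<in> fv_tm t" for n
      using that unfolding w_def by (intro le_imp_less_Suc Max_ge) auto
    then have "w \<notin> fv_tm t" by blast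
    from nice_substitute[OF nice_G ts this, of w] t have "nice (\<lambda>e. eval_tm M e t \<in> G)" by simp
    then show ?thesis by (rule nice_cong) (use t InG eval_in_V[OF ts] in \<open>simp add: G_def\<close>)
  next
    case (Pred xs \<psi>)
    have xs: "formula_in R xs \<psi>" "length xs = length ts" using ar Pred by (auto split: if_splits)
    \<comment> \<open>The terms \<open>ts\<close> may mention variables of \<open>xs\<close>, so
      their values are first stored in fresh variables \<open>ws\<close> and then copied to
      \<open>xs\<close>.\<close>
    define k where "k = Suc (Max (insert 0 (set xs \<union> (\<Union>t \<in> set ts. fv_tm t))))"
    define ws where "ws = [k..<k + length xs]"
    have lt: "n < k" if "n \<in> set xs \<union> (\<Union>t \<in> set ts. fv_tm t)" for n
      using that unfolding k_def by (intro le_imp_less_Suc Max_ge) auto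
    have ws: "length ws = length xs" "distinct ws" "w \<in> set ws \<Longrightarrow> k \<le> w" for w by (auto simp: ws_def)
    have fresh: "w \<notin> set xs" "t \<in> set ts \<Longrightarrow> w \<notin> fv_tm t" if "w \<in> set ws" for w t
      using lt[of w] ws(3)[OF that] by auto
    let ?s = "\<lambda>e. seq_subst (zip xs (map Var ws)) (seq_subst (zip ws ts) e)"
    have 1: "wf_tm L t \<and> x \<notin> fv_tm t" if "(x, t) \<in> set (zip ws ts)" for x t
      using that ts fresh set_zip_leftD set_zip_rightD by metis
    have 2: "wf_tm L t \<and> x \<notin> fv_tm t" if "(x, t) \<in> set (zip xs (map Var ws))" for x t
      using that fresh(1) set_zip_leftD[OF that] set_zip_rightD[OF that] by auto
    have "nice (\<lambda>e. (\<forall>x \<in> set xs. e x \<in> G) \<and> sat M e (relativize \<psi>))"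
      by (intro nice_conj nice_finite_conj nice_G nice_relativize) (use xs(1) in \<open>auto simp: formula_in_def\<close>)
    from nice_seq_subst[OF nice_seq_subst[OF this 2] 1]
    have "nice (\<lambda>e. (\<forall>x \<in> set xs. ?s e x \<in> G) \<and> sat M (?s e) (relativize \<psi>))" .
    then show ?thesis
    proof (rule nice_cong)
      fix e assume e: "assignment M e"
      have "assignment M (?s e)" using 1 2 e by (intro assignment_seq_subst) blast+
      from predicate_iff[OF xs(1) this]
      have "(\<forall>x \<in> set xs. ?s e x \<in> G) \<and> sat M (?s e) (relativize \<psi>) \<longleftrightarrow>
          rel_int M (Pred xs \<psi>) (map (?s e) xs)" by simp
      also have "map (?s e) xs = map (eval_tm M (seq_subst (zip ws ts) e)) (map Var ws)"
        by (rule seq_subst_zip(1)) (use xs(1) ws(1) fresh(1) in \<open>auto simp: formula_in_def\<close>)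
      also have "\<dots> = map (seq_subst (zip ws ts) e) ws" by simp
      also have "\<dots> = map (eval_tm M e) ts"
        by (rule seq_subst_zip(1)) (use xs(2) ws(1,2) fresh(2) in auto)
      finally show "(\<forall>x \<in> set xs. ?s e x \<in> G) \<and> sat M (?s e) (relativize \<psi>) \<longleftrightarrow> sat M e (Rel p ts)"
        using Pred by simp
    qed
  qed
next
  case (Imp \<phi> \<psi>)
  then show ?case using nice_imp by simp
next
  case (Forall x \<phi>)
  then show ?case using nice_all by simp
qed

end

section \<open>Order and independence patterns\<close>

definition order_len :: "'a set \<Rightarrow> ('a \<Rightarrow> 'a \<Rightarrow> bool) \<Rightarrow> nat \<Rightarrow> bool" where
  "order_len A Q n \<longleftrightarrow> (\<exists>a b :: nat \<Rightarrow> 'a. (\<forall>i < n. a i \<in> A \<and> b i \<in> A) \<and>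
     (\<forall>i < n. \<forall>j < n. Q (a i) (b j) \<longleftrightarrow> i < j))"

definition shatter_len :: "'a set \<Rightarrow> ('a \<Rightarrow> 'a \<Rightarrow> bool) \<Rightarrow> nat \<Rightarrow> bool" where
  "shatter_len A Q n \<longleftrightarrow> (\<exists>(a :: nat \<Rightarrow> 'a) b. (\<forall>i < n. a i \<in> A) \<and> (\<forall>S \<subseteq> {..<n}. b S \<in> A) \<and>
     (\<forall>i < n. \<forall>S \<subseteq> {..<n}. Q (a i) (b S) \<longleftrightarrow> i \<in> S))"

lemma order_lenE:
  assumes "order_len A Q n"
  obtains a b where "\<And>i. i < n \<Longrightarrow> a i \<in> A" "\<And>i. i < n \<Longrightarrow> b i \<in> A"
    "\<And>i j. i < n \<Longrightarrow> j < n \<Longrightarrow> Q (a i) (b j) \<longleftrightarrow> i < j"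
  using assms unfolding order_len_def by (elim exE conjE) metis

lemma shatter_lenE:
  assumes "shatter_len A Q n"
  obtains a b where "\<And>i. i < n \<Longrightarrow> a i \<in> A" "\<And>S. S \<subseteq> {..<n} \<Longrightarrow> b S \<in> A"
    "\<And>i S. i < n \<Longrightarrow> S \<subseteq> {..<n} \<Longrightarrow> Q (a i) (b S) \<longleftrightarrow> i \<in> S"
  using assms unfolding shatter_len_def by (elim exE conjE) metis

lemma order_len_mono:
  assumes "order_len A Q n" "m \<le> n"
  shows "order_len A Q m"
proof -
  obtain a b where "\<And>i. i < n \<Longrightarrow> a i \<in> A" "\<And>i. i < n \<Longrightarrow> b i \<in> A"
    "\<And>i j. i < n \<Longrightarrow> j < n \<Longrightarrow> Q (a i) (b j) \<longleftrightarrow> i < j"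
    by (rule order_lenE[OF assms(1)]) blast
  then show ?thesis unfolding order_len_def using assms(2) by (intro exI[of _ a] exI[of _ b]) simp
qed

lemma shatter_len_mono:
  assumes "shatter_len A Q n" "m \<le> n"
  shows "shatter_len A Q m"
proof -
  obtain a b where ab: "\<And>i. i < n \<Longrightarrow> a i \<in> A" "\<And>S. S \<subseteq> {..<n} \<Longrightarrow> b S \<in> A"
    "\<And>i S. i < n \<Longrightarrow> S \<subseteq> {..<n} \<Longrightarrow> Q (a i) (b S) \<longleftrightarrow> i \<in> S"
    by (rule shatter_lenE[OF assms(1)]) blast
  have "S \<subseteq> {..<n}" if "S \<subseteq> {..<m}" for S using that assms(2) by force
  then show ?thesis
    unfolding shatter_len_def using ab assms(2) by (intro exI[of _ a] exI[of _ b]) simp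
qed

text \<open>Reading both sequences backwards turns \<open>\<not> i < j\<close> into a weak
  inequality in the right direction. A shift of one sequence by one makes it strict and costs one
  entry.\<close>

lemma order_len_reverse:
  assumes A: "\<forall>i \<le> n. a i \<in> A \<and> b i \<in> A"
    and Q: "\<forall>i \<le> n. \<forall>j \<le> n. Q (a i) (b j) \<longleftrightarrow> \<not> i < j"
  shows "order_len A Q n"
  unfolding order_len_def
proof (intro exI conjI allI impI)
  fix i j assume i: "i < n" and j: "j < n"
  have "Q (a (n - Suc i)) (b (n - j)) \<longleftrightarrow> \<not> n - Suc i < n - j" using Q by simp
  also have "\<dots> \<longleftrightarrow> i < j" using i j by linarith
  finally show "Q (a (n - Suc i)) (b (n - j)) \<longleftrightarrow> i < j" .
qed (use A in auto)

text \<open>Pairs of positions are coloured by the truth values of all \<open>Q\<close> in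
  \<open>\<F>\<close>, in both orders. On a homogeneous set some \<open>Q\<close> distinguishes the
  two orders, as otherwise \<open>P\<close> could not, and this \<open>Q\<close> has a long pattern
  there.\<close>

theorem order_len_determined:
  assumes \<F>: "finite \<F>" "\<And>Q. Q \<in> \<F> \<Longrightarrow> \<exists>n. \<not> order_len A Q n"
    and det: "\<And>a b a' b'. a \<in> A \<Longrightarrow> b \<in> A \<Longrightarrow> a' \<in> A \<Longrightarrow> b' \<in> A \<Longrightarrow>
      (\<And>Q. Q \<in> \<F> \<Longrightarrow> Q a b = Q a' b') \<Longrightarrow> P a b = P a' b'"
  shows "\<exists>n. \<not> order_len A P n"
proof (rule ccontr)
  assume "\<nexists>n. \<not> order_len A P n"
  then have P: "order_len A P n" for n by blast
  obtain len where len: "\<And>Q. Q \<in> \<F> \<Longrightarrow> \<not> order_len A Q (len Q)" using \<F>(2) by metis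
  define m where "m = Max (insert 0 (len ` \<F>))"
  have m: "\<not> order_len A Q m" if "Q \<in> \<F>" for Q
  proof -
    have "len Q \<le> m" unfolding m_def using \<F>(1) that by (intro Max_ge) auto
    then show ?thesis using len[OF that] order_len_mono by blast
  qed
  have finC: "finite (Pow \<F> \<times> Pow \<F>)" using \<F>(1) by simp
  define c where "c = card (Pow \<F> \<times> Pow \<F>)"
  obtain enc where enc: "bij_betw enc (Pow \<F> \<times> Pow \<F>) {..<c}"
    using ex_bij_betw_finite_nat[OF finC] by (auto simp: c_def atLeast0LessThan)
  \<comment> \<open>Odd positions serve \<open>a\<close> and even ones serve \<open>b\<close>:
    \<open>m + 1\<close> of each, one to spare for \<open>order_len_reverse\<close>.\<close>
  let ?k = "2 * m + 2"
  obtain N :: nat where N: "partn_lst {..<N} (replicate c ?k) 2" using ramsey_full by blast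
  obtain a b where ab: "\<And>i. i < N \<Longrightarrow> a i \<in> A" "\<And>i. i < N \<Longrightarrow> b i \<in> A"
    "\<And>i j. i < N \<Longrightarrow> j < N \<Longrightarrow> P (a i) (b j) \<longleftrightarrow> i < j"
    by (rule order_lenE[OF P[of N]]) blast
  define tr where "tr i j = {Q \<in> \<F>. Q (a i) (b j)}" for i j
  define f where "f e = enc (tr (Min e) (Max e), tr (Max e) (Min e))" for e
  have tr_in: "tr i j \<in> Pow \<F>" for i j by (auto simp: tr_def)
  have "f e < c" for e
    using bij_betwE[OF enc] tr_in unfolding f_def by auto
  then have "f \<in> nsets {..<N} 2 \<rightarrow> {..<c}" by simp
  then obtain i H where i: "i < c" and H: "H \<in> nsets {..<N} (replicate c ?k ! i)" "f ` nsets H 2 \<subseteq> {i}"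
    by (rule partn_lstE[OF N]) auto
  have HN: "H \<subseteq> {..<N}" "finite H" "card H = ?k" using H(1) i by (auto simp: nsets_def)
  define h where "h = (!) (sorted_list_of_set H)"
  have h_in: "h x \<in> H" if "x < ?k" for x
    using that HN by (metis h_def length_sorted_list_of_set nth_mem set_sorted_list_of_set)
  have h_mono: "h x < h y" if "x < y" "y < ?k" for x y
    using that HN strict_sorted_list_of_set[of H] unfolding h_def by (simp add: sorted_wrt_nth_less)
  have hN: "h x < N" if "x < ?k" for x using h_in[OF that] HN(1) by auto
  have fh: "enc (tr (h x) (h y), tr (h y) (h x)) = i" if "x < y" "y < ?k" for x y
  proof -
    have "{h x, h y} \<in> nsets H 2" using h_in h_mono[OF that] that by simp
    then have "f {h x, h y} = i" using H(2) by blast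
    then show ?thesis using h_mono[OF that] by (simp add: f_def)
  qed
  define \<alpha> where "\<alpha> = tr (h 0) (h 1)"
  define \<beta> where "\<beta> = tr (h 1) (h 0)"
  have const: "tr (h x) (h y) = \<alpha>" "tr (h y) (h x) = \<beta>" if "x < y" "y < ?k" for x y
  proof -
    have "enc (tr (h x) (h y), tr (h y) (h x)) = enc (\<alpha>, \<beta>)"
      using fh[OF that] fh[of 0 1] by (simp add: \<alpha>_def \<beta>_def)
    moreover have "inj_on enc (Pow \<F> \<times> Pow \<F>)" using enc by (simp add: bij_betw_def)
    ultimately have "(tr (h x) (h y), tr (h y) (h x)) = (\<alpha>, \<beta>)"
      using tr_in unfolding \<alpha>_def \<beta>_def by (intro inj_onD[of enc "Pow \<F> \<times> Pow \<F>"] SigmaI)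
    then show "tr (h x) (h y) = \<alpha>" "tr (h y) (h x) = \<beta>" by auto
  qed
  have "\<alpha> \<noteq> \<beta>"
  proof
    assume "\<alpha> = \<beta>"
    have h01: "h 0 < N" "h 1 < N" "h 0 < h 1" using hN h_mono[of 0 1] by auto
    have "Q (a (h 0)) (b (h 1)) = Q (a (h 1)) (b (h 0))" if "Q \<in> \<F>" for Q
      using \<open>\<alpha> = \<beta>\<close> that unfolding \<alpha>_def \<beta>_def tr_def by blast
    then have "P (a (h 0)) (b (h 1)) = P (a (h 1)) (b (h 0))" using h01 ab(1,2) by (intro det) auto
    then show False using ab(3) h01 by auto
  qed
  then obtain Q where Q: "Q \<in> \<F>" "Q \<in> \<alpha> \<longleftrightarrow> Q \<notin> \<beta>" by (auto simp: \<alpha>_def \<beta>_def tr_def)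
  \<comment> \<open>The colouring says nothing about a position paired with itself. Odd and even
    positions never coincide, and \<open>2 * i + 1 < 2 * j\<close> holds exactly when
    \<open>i < j\<close>.\<close>
  let ?a = "\<lambda>i. a (h (2 * i + 1))" and ?b = "\<lambda>j. b (h (2 * j))"
  have in_A: "?a i \<in> A" "?b i \<in> A" if "i \<le> m" for i using that ab(1,2) hN by auto
  have Qab: "Q (?a i) (?b j) \<longleftrightarrow> (if i < j then Q \<in> \<alpha> else Q \<in> \<beta>)" if "i \<le> m" "j \<le> m" for i j
  proof -
    have "Q (?a i) (?b j) \<longleftrightarrow> Q \<in> tr (h (2 * i + 1)) (h (2 * j))" using Q(1) by (simp add: tr_def)
    moreover have "tr (h (2 * i + 1)) (h (2 * j)) = (if i < j then \<alpha> else \<beta>)"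
      using const[of "2 * i + 1" "2 * j"] const[of "2 * j" "2 * i + 1"] that by auto
    ultimately show ?thesis by simp
  qed
  have "order_len A Q m"
  proof (cases "Q \<in> \<alpha>")
    case True
    then show ?thesis
      unfolding order_len_def using in_A Qab Q(2) by (intro exI[of _ ?a] exI[of _ ?b]) simp
  next
    case False
    then show ?thesis using in_A Qab Q(2) by (intro order_len_reverse[of m ?a A ?b]) simp_all
  qed
  then show False using m Q(1) by blast
qed

section \<open>The Sauer-Shelah lemma and Boolean combinations\<close>

definition shatters :: "'a set set \<Rightarrow> 'a set \<Rightarrow> bool" where
  "shatters \<A> D \<longleftrightarrow> (\<forall>T \<subseteq> D. \<exists>A \<in> \<A>. A \<inter> D = T)"

text \<open>Pajor's form of the Sauer-Shelah lemma.\<close>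

lemma card_le_card_shattered:
  assumes "finite E" "\<A> \<subseteq> Pow E"
  shows "card \<A> \<le> card {D. D \<subseteq> E \<and> shatters \<A> D}"
  using assms
proof (induction E arbitrary: \<A> rule: finite_induct)
  case empty
  then have "\<A> = {} \<or> \<A> = {{}}" by auto
  then show ?case
  proof
    assume "\<A> = {{}}"
    then have "{D. D \<subseteq> {} \<and> shatters \<A> D} = {{}}" by (auto simp: shatters_def)
    then show ?thesis using \<open>\<A> = {{}}\<close> by simp
  qed simp
next
  case (insert x E)
  \<comment> \<open>The family is split at \<open>x\<close>. A set shattered by one half is
    shattered by \<open>\<A>\<close>; one shattered by both remains so with \<open>x\<close> added,
    which accounts for the overlap in the count.\<close>
  define \<A>0 where "\<A>0 = {A \<in> \<A>. x \<notin> A}"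
  define \<A>1 where "\<A>1 = (\<lambda>A. A - {x}) ` {A \<in> \<A>. x \<in> A}"
  define Sh where "Sh \<B> = {D. D \<subseteq> E \<and> shatters \<B> D}" for \<B>
  have sub: "\<A>0 \<subseteq> Pow E" "\<A>1 \<subseteq> Pow E" using insert.prems by (auto simp: \<A>0_def \<A>1_def)
  have fin: "finite \<A>" "finite (Sh \<B>)" for \<B>
    using insert.hyps(1) insert.prems by (auto simp: Sh_def intro: finite_subset)
  have "inj_on (\<lambda>A. A - {x}) {A \<in> \<A>. x \<in> A}" by (auto simp: inj_on_def)
  then have "card \<A>1 = card {A \<in> \<A>. x \<in> A}" unfolding \<A>1_def by (rule card_image)
  moreover have "card \<A> = card \<A>0 + card {A \<in> \<A>. x \<in> A}"
  proof -
    have "\<A> = \<A>0 \<union> {A \<in> \<A>. x \<in> A}" "\<A>0 \<inter> {A \<in> \<A>. x \<in> A} = {}" by (auto simp: \<A>0_def)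
    then show ?thesis using card_Un_disjoint[of \<A>0 "{A \<in> \<A>. x \<in> A}"] fin(1) by (simp add: \<A>0_def)
  qed
  ultimately have "card \<A> \<le> card (Sh \<A>0) + card (Sh \<A>1)"
    using insert.IH[OF sub(1)] insert.IH[OF sub(2)] by (simp add: Sh_def)
  also have "\<dots> = card (Sh \<A>0 \<union> Sh \<A>1) + card (Sh \<A>0 \<inter> Sh \<A>1)" by (rule card_Un_Int[OF fin(2) fin(2)])
  also have "card (Sh \<A>0 \<inter> Sh \<A>1) = card (insert x ` (Sh \<A>0 \<inter> Sh \<A>1))"
  proof (rule card_image[symmetric])
    show "inj_on (insert x) (Sh \<A>0 \<inter> Sh \<A>1)"
      using insert.hyps(2) unfolding Sh_def inj_on_def by (auto dest: insert_ident[THEN iffD1, rotated 2])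
  qed
  also have "card (Sh \<A>0 \<union> Sh \<A>1) + card (insert x ` (Sh \<A>0 \<inter> Sh \<A>1)) =
      card ((Sh \<A>0 \<union> Sh \<A>1) \<union> insert x ` (Sh \<A>0 \<inter> Sh \<A>1))"
  proof (rule card_Un_disjoint[symmetric])
    show "(Sh \<A>0 \<union> Sh \<A>1) \<inter> insert x ` (Sh \<A>0 \<inter> Sh \<A>1) = {}"
      using insert.hyps(2) by (auto simp: Sh_def)
  qed (use fin in auto)
  also have "\<dots> \<le> card {D. D \<subseteq> insert x E \<and> shatters \<A> D}"
  proof (rule card_mono)
    show "finite {D. D \<subseteq> insert x E \<and> shatters \<A> D}" using insert.hyps(1) by simp
    have 0: "shatters \<A> D" if "D \<in> Sh \<A>0" for D
      using that unfolding Sh_def shatters_def \<A>0_def by blast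
    have 1: "shatters \<A> D" if D1: "D \<in> Sh \<A>1" for D
      unfolding shatters_def
    proof (intro allI impI)
      fix T assume "T \<subseteq> D"
      then obtain A where A: "A \<in> \<A>" "x \<in> A" "(A - {x}) \<inter> D = T"
        using D1 unfolding Sh_def shatters_def \<A>1_def by blast
      have "x \<notin> D" using D1 insert.hyps(2) by (auto simp: Sh_def)
      then have "A \<inter> D = T" using A(3) by blast
      then show "\<exists>A \<in> \<A>. A \<inter> D = T" using A(1) by blast
    qed
    have 2: "shatters \<A> (insert x D)" if D0: "D \<in> Sh \<A>0" and D1: "D \<in> Sh \<A>1" for D
      unfolding shatters_def
    proof (intro allI impI)
      fix T assume T: "T \<subseteq> insert x D"
      have xD: "x \<notin> D" using D1 insert.hyps(2) by (auto simp: Sh_def)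
      have TD: "T - {x} \<subseteq> D" using T by blast
      show "\<exists>A \<in> \<A>. A \<inter> insert x D = T"
      proof (cases "x \<in> T")
        case True
        obtain A where A: "A \<in> \<A>" "x \<in> A" "(A - {x}) \<inter> D = T - {x}"
          using D1 TD unfolding Sh_def shatters_def \<A>1_def by blast
        then have "A \<inter> insert x D = T" using True xD by blast
        then show ?thesis using A(1) by blast
      next
        case False
        obtain A where A: "A \<in> \<A>" "x \<notin> A" "A \<inter> D = T - {x}"
          using D0 TD unfolding Sh_def shatters_def \<A>0_def by blast
        then have "A \<inter> insert x D = T" using False by blast
        then show ?thesis using A(1) by blast
      qed
    qed
    show "(Sh \<A>0 \<union> Sh \<A>1) \<union> insert x ` (Sh \<A>0 \<inter> Sh \<A>1) \<subseteq> {D. D \<subseteq> insert x E \<and> shatters \<A> D}"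
      using 0 1 2 by (auto simp: Sh_def)
  qed
  finally show ?case .
qed

lemma shatters_subset: "shatters \<A> D \<Longrightarrow> D' \<subseteq> D \<Longrightarrow> shatters \<A> D'"
  unfolding shatters_def
proof (intro allI impI)
  fix T assume *: "\<forall>T \<subseteq> D. \<exists>A \<in> \<A>. A \<inter> D = T" "D' \<subseteq> D" "T \<subseteq> D'"
  then obtain A where "A \<in> \<A>" "A \<inter> D = T" by (meson subset_trans)
  then have "A \<in> \<A>" "A \<inter> D' = T" using *(2,3) by auto
  then show "\<exists>A \<in> \<A>. A \<inter> D' = T" by blast
qed

text \<open>Shattered sets have fewer than \<open>d\<close> elements. They are counted by lists of
  length \<open>d\<close> in which the entry \<open>N\<close>, outside \<open>{..<N}\<close>, serves
  as padding; only polynomial growth in \<open>N\<close> matters.\<close>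

lemma card_not_shattering:
  assumes "\<A> \<subseteq> Pow {..<N :: nat}" "\<And>D. D \<subseteq> {..<N} \<Longrightarrow> card D = d \<Longrightarrow> \<not> shatters \<A> D"
  shows "card \<A> \<le> (N + 1) ^ d"
proof -
  let ?L = "{xs. set xs \<subseteq> {..N} \<and> length xs = d}"
  have "{D. D \<subseteq> {..<N} \<and> shatters \<A> D} \<subseteq> (\<lambda>xs. set xs \<inter> {..<N}) ` ?L"
  proof
    fix D assume D: "D \<in> {D. D \<subseteq> {..<N} \<and> shatters \<A> D}"
    then have fin: "finite D" and DN: "D \<subseteq> {..<N}" using finite_subset[of D "{..<N}"] by auto
    have "card D < d"
    proof (rule ccontr)
      assume "\<not> card D < d"
      then obtain D' where "D' \<subseteq> D" "card D' = d"
        using obtain_subset_with_card_n[of d D] by (auto simp: not_less)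
      then show False using assms(2)[of D'] D shatters_subset by blast
    qed
    define xs where "xs = sorted_list_of_set D @ replicate (d - card D) N"
    have "set xs \<subseteq> {..N}" "length xs = d" "set xs \<inter> {..<N} = D"
      using fin DN \<open>card D < d\<close> by (auto simp: xs_def)
    then show "D \<in> (\<lambda>xs. set xs \<inter> {..<N}) ` ?L" by blast
  qed
  moreover have "finite ?L" by (rule finite_lists_length_eq) simp
  ultimately have "card {D. D \<subseteq> {..<N} \<and> shatters \<A> D} \<le> card ?L"
    using surj_card_le by blast
  also have "\<dots> = (N + 1) ^ d" using card_lists_length_eq[of "{..N}" d] by simp
  finally show ?thesis using card_le_card_shattered[OF _ assms(1)] by simp
qed

text \<open>With \<open>N = 2 ^ m - 1\<close> only the exponents \<open>m * q\<close> and
  \<open>2 ^ m - 1\<close> have to be compared. The \<open>5\<close> is where squares fall below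
  powers of two for good.\<close>

lemma power_less_exponential: "\<exists>N :: nat. (N + 1) ^ q < 2 ^ N"
proof -
  have sq: "m * m < 2 ^ m" if "5 \<le> m" for m :: nat
    using that
  proof (induction m rule: nat_induct_at_least)
    case (Suc m)
    have "Suc m * Suc m = m * m + 2 * m + 1" by simp
    also have "\<dots> \<le> m * m + m * m" using Suc.hyps mult_le_mono1[of 3 m m] by linarith
    finally show ?case using Suc.IH by simp
  qed simp
  define m where "m = q + 5"
  have "m * q + 1 < m * m" by (simp add: m_def algebra_simps)
  also have "m * m < 2 ^ m" using sq by (simp add: m_def)
  finally have lt: "m * q < 2 ^ m - 1" by linarith
  have "(2 ^ m - 1 + 1 :: nat) ^ q = 2 ^ (m * q)" by (simp add: power_mult)
  also have "\<dots> < 2 ^ (2 ^ m - 1)" using lt by (intro power_strict_increasing) auto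
  finally show ?thesis by blast
qed

text \<open>A pattern of length \<open>N\<close> for \<open>P\<close> gives \<open>2 ^ N\<close>
  parameters, told apart by their traces under the finitely many \<open>Q\<close>. Each
  \<open>Q\<close> has only polynomially many traces by Sauer-Shelah.\<close>

theorem shatter_len_determined:
  assumes \<F>: "finite \<F>" "\<And>Q. Q \<in> \<F> \<Longrightarrow> \<exists>n. \<not> shatter_len A Q n"
    and det: "\<And>a b a' b'. a \<in> A \<Longrightarrow> b \<in> A \<Longrightarrow> a' \<in> A \<Longrightarrow> b' \<in> A \<Longrightarrow>
      (\<And>Q. Q \<in> \<F> \<Longrightarrow> Q a b = Q a' b') \<Longrightarrow> P a b = P a' b'"
  shows "\<exists>n. \<not> shatter_len A P n"
proof (rule ccontr)
  assume "\<nexists>n. \<not> shatter_len A P n"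
  then have P: "shatter_len A P n" for n by blast
  obtain len where len: "\<And>Q. Q \<in> \<F> \<Longrightarrow> \<not> shatter_len A Q (len Q)" using \<F>(2) by metis
  define d where "d = Max (insert 0 (len ` \<F>))"
  have d: "\<not> shatter_len A Q d" if "Q \<in> \<F>" for Q
  proof -
    have "len Q \<le> d" unfolding d_def using \<F>(1) that by (intro Max_ge) auto
    then show ?thesis using len[OF that] shatter_len_mono by blast
  qed
  obtain N :: nat where N: "(N + 1) ^ (d * card \<F>) < 2 ^ N" using power_less_exponential by blast
  obtain a b where ab: "\<And>i. i < N \<Longrightarrow> a i \<in> A" "\<And>S. S \<subseteq> {..<N} \<Longrightarrow> b S \<in> A"
    "\<And>i S. i < N \<Longrightarrow> S \<subseteq> {..<N} \<Longrightarrow> P (a i) (b S) \<longleftrightarrow> i \<in> S"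
    by (rule shatter_lenE[OF P[of N]]) blast
  define tr where "tr S Q = {i. i < N \<and> Q (a i) (b S)}" for S Q
  define \<A> where "\<A> Q = (\<lambda>S. tr S Q) ` Pow {..<N}" for Q
  have card_A: "card (\<A> Q) \<le> (N + 1) ^ d" if Q: "Q \<in> \<F>" for Q
  proof (rule card_not_shattering)
    show "\<A> Q \<subseteq> Pow {..<N}" by (auto simp: \<A>_def tr_def)
    fix D assume D: "D \<subseteq> {..<N}" "card D = d"
    have finD: "finite D" using D(1) finite_subset by blast
    show "\<not> shatters (\<A> Q) D"
    proof
      assume sh: "shatters (\<A> Q) D"
      \<comment> \<open>A shattered set of size \<open>d\<close> gives a pattern for
        \<open>Q\<close>: its points enumerated by \<open>h\<close>, and for each \<open>T\<close> a
        parameter \<open>s T\<close> whose trace on \<open>D\<close> is the image of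
        \<open>T\<close>.\<close>
      obtain h where h: "bij_betw h {..<d} D"
        using ex_bij_betw_nat_finite[OF finD] D(2) by (auto simp: atLeast0LessThan)
      have hD: "h i \<in> D" if "i < d" for i using h that by (auto simp: bij_betw_def)
      have h_inj: "h i \<in> h ` T \<longleftrightarrow> i \<in> T" if "i < d" "T \<subseteq> {..<d}" for i T
        using h that unfolding bij_betw_def by (metis inj_on_image_mem_iff lessThan_iff)
      have "\<exists>S. S \<subseteq> {..<N} \<and> (T \<subseteq> {..<d} \<longrightarrow> tr S Q \<inter> D = h ` T)" for T
      proof (cases "T \<subseteq> {..<d}")
        case True
        then have "h ` T \<subseteq> D" using hD by auto
        then obtain A' where "A' \<in> \<A> Q" "A' \<inter> D = h ` T" using sh unfolding shatters_def by blast
        then show ?thesis by (auto simp: \<A>_def)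
      qed auto
      then obtain s where s: "\<And>T. s T \<subseteq> {..<N}" "\<And>T. T \<subseteq> {..<d} \<Longrightarrow> tr (s T) Q \<inter> D = h ` T" by metis
      have "Q (a (h i)) (b (s T)) \<longleftrightarrow> i \<in> T" if i: "i < d" and T: "T \<subseteq> {..<d}" for i T
      proof -
        have "h i < N" using hD[OF i] D(1) by auto
        then have "Q (a (h i)) (b (s T)) \<longleftrightarrow> h i \<in> tr (s T) Q \<inter> D" using hD[OF i] by (simp add: tr_def)
        then show ?thesis using s(2)[OF T] h_inj[OF i T] by simp
      qed
      moreover have "a (h i) \<in> A" if "i < d" for i using ab(1) hD[OF that] D(1) by auto
      moreover have "b (s T) \<in> A" for T using ab(2) s(1) by blast
      ultimately have "shatter_len A Q d"
        unfolding shatter_len_def by (intro exI[of _ "\<lambda>i. a (h i)"] exI[of _ "\<lambda>T. b (s T)"]) blast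
      then show False using d[OF Q] by blast
    qed
  qed
  \<comment> \<open>\<open>S\<close> can be recovered from its traces: by \<open>det\<close> they
    decide \<open>P (a i) (b S)\<close>, which means \<open>i \<in> S\<close>.\<close>
  have "inj_on (\<lambda>S. restrict (tr S) \<F>) (Pow {..<N})"
  proof (rule inj_onI)
    fix S S' assume S: "S \<in> Pow {..<N}" "S' \<in> Pow {..<N}" and eq: "restrict (tr S) \<F> = restrict (tr S') \<F>"
    have "i \<in> S \<longleftrightarrow> i \<in> S'" if i: "i < N" for i
    proof -
      have "Q (a i) (b S) = Q (a i) (b S')" if "Q \<in> \<F>" for Q
      proof -
        have "tr S Q = tr S' Q" using fun_cong[OF eq, of Q] that by simp
        then show ?thesis using i unfolding tr_def by blast
      qed
      then have "P (a i) (b S) = P (a i) (b S')" using ab(1,2) i S by (intro det) auto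
      then show ?thesis using ab(3) i S by auto
    qed
    then show "S = S'" using S by auto
  qed
  moreover have "(\<lambda>S. restrict (tr S) \<F>) ` Pow {..<N} \<subseteq> Pi\<^sub>E \<F> \<A>"
    by (intro image_subsetI restrict_PiE_iff[THEN iffD2] ballI) (simp add: \<A>_def)
  moreover have "finite (Pi\<^sub>E \<F> \<A>)" by (intro finite_PiE \<F>(1)) (simp add: \<A>_def)
  ultimately have "card (Pow {..<N}) \<le> card (Pi\<^sub>E \<F> \<A>)" by (rule card_inj_on_le)
  also have "\<dots> = (\<Prod>Q\<in>\<F>. card (\<A> Q))" by (rule card_PiE[OF \<F>(1)])
  also have "\<dots> \<le> (\<Prod>Q\<in>\<F>. (N + 1) ^ d)" by (intro prod_mono conjI card_A) auto
  also have "\<dots> = (N + 1) ^ (d * card \<F>)" by (simp add: power_mult)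
  finally show False using N by (simp add: card_Pow)
qed

section \<open>Stability and NIP of the pair\<close>

lemma order_property_iff:
  "order_property M \<phi> X \<longleftrightarrow>
     (\<forall>n. order_len {e. assignment M e} (\<lambda>a b. sat M (override_on b a X) \<phi>) n)"
  by (simp add: order_property_def order_len_def)

lemma independence_property_iff:
  "independence_property M \<phi> X \<longleftrightarrow>
     (\<forall>n. shatter_len {e. assignment M e} (\<lambda>a b. sat M (override_on b a X) \<phi>) n)"
  by (simp add: independence_property_def shatter_len_def)

lemma elementary_override:
  assumes h: "elementary L N M h" and \<phi>: "wf_fm L \<phi>"
    and k: "\<And>v. v \<in> range a \<union> range b \<Longrightarrow> k v \<in> carr N \<and> h (k v) = v"
  shows "sat N (override_on (k \<circ> b) (k \<circ> a) X) \<phi> = sat M (override_on b a X) \<phi>"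
proof -
  have "assignment N (override_on (k \<circ> b) (k \<circ> a) X)"
    using k by (auto simp: assignment_def override_on_def)
  moreover have "h \<circ> override_on (k \<circ> b) (k \<circ> a) X = override_on b a X"
    using k by (auto simp: override_on_def fun_eq_iff)
  ultimately show ?thesis using h \<phi> by (metis elementary_def)
qed

section \<open>Stability and NIP in models over other types\<close>

context large_theory
begin

lemma pull_back:
  fixes M :: "('f, 'p, 'w) struc"
  assumes "models L M T" "countable C" "C \<subseteq> carr M"
  obtains N :: "('f, 'p, 'u) struc" and h :: "'u \<Rightarrow> 'w" and k
  where "models L N T" "elementary L N M h" "\<And>v. v \<in> C \<Longrightarrow> k v \<in> carr N \<and> h (k v) = v"
proof -
  obtain N :: "('f, 'p, 'u) struc" and h :: "'u \<Rightarrow> 'w"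
    where N: "models L N T" "elementary L N M h" "C \<subseteq> h ` carr N"
    by (rule small_model[OF assms])
  have "inv_into (carr N) h v \<in> carr N \<and> h (inv_into (carr N) h v) = v" if "v \<in> C" for v
    using that N(3) by (meson f_inv_into_f inv_into_into subsetD)
  then show thesis by (rule that[OF N(1,2)])
qed

text \<open>Patterns of all lengths together use countably many elements. They are pulled back at
  once, because \<open>order_property\<close> asks for one model that has patterns of every
  length.\<close>

lemma stable_any_universe:
  fixes M :: "('f, 'p, 'w) struc"
  assumes "stable_theory U L T" "models L M T" "wf_fm L \<phi>"
  shows "\<not> order_property M \<phi> X"
proof
  assume "order_property M \<phi> X"
  then have op: "order_len {e. assignment M e} (\<lambda>a b. sat M (override_on b a X) \<phi>) n" for n
    by (simp add: order_property_iff)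
  define conf where "conf n a b \<longleftrightarrow> (\<forall>i < n. assignment M (a i) \<and> assignment M (b i) \<and>
      (\<forall>j < n. sat M (override_on (b j) (a i) X) \<phi> \<longleftrightarrow> i < j))" for n :: nat and a b
  have "\<exists>a b. conf n a b" for n
    unfolding conf_def by (rule order_lenE[OF op[of n]]) blast
  then obtain a b where "\<And>n. conf n (a n) (b n)" by metis
  then have ab: "assignment M (a n i) \<and> assignment M (b n i) \<and>
      (\<forall>j < n. sat M (override_on (b n j) (a n i) X) \<phi> \<longleftrightarrow> i < j)" if "i < n" for n i
    using that unfolding conf_def by blast
  define C where "C = (\<Union>n. \<Union>i<n. range (a n i) \<union> range (b n i))"
  have "countable C" by (simp add: C_def)
  moreover have "C \<subseteq> carr M"
  proof -
    have "range (a n i) \<union> range (b n i) \<subseteq> carr M" if "i < n" for n i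
      using ab[OF that] by (simp add: assignment_def)
    then show ?thesis unfolding C_def by blast
  qed
  ultimately obtain N :: "('f, 'p, 'u) struc" and h :: "'u \<Rightarrow> 'w" and k
    where N: "models L N T" "elementary L N M h" and k: "\<And>v. v \<in> C \<Longrightarrow> k v \<in> carr N \<and> h (k v) = v"
    by (rule pull_back[OF assms(2)]) blast
  have in_C: "range (a n i) \<union> range (b n i) \<subseteq> C" if "i < n" for n i using that by (auto simp: C_def)
  have "order_property N \<phi> X"
    unfolding order_property_def
  proof (intro allI exI conjI impI)
    fix n i assume i: "i < (n :: nat)"
    show "assignment N (k \<circ> a n i)" "assignment N (k \<circ> b n i)"
      using k in_C[OF i] by (auto simp: assignment_def)
    fix j assume j: "j < n"
    have "k v \<in> carr N \<and> h (k v) = v" if "v \<in> range (a n i) \<union> range (b n j)" for v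
      using k that in_C[OF i] in_C[OF j] by blast
    from elementary_override[OF N(2) assms(3) this]
    show "sat N (override_on (k \<circ> b n j) (k \<circ> a n i) X) \<phi> \<longleftrightarrow> i < j" using ab[OF i] j by simp
  qed
  then show False using assms(1,3) N(1) by (simp add: stable_theory_def)
qed

lemma NIP_any_universe:
  fixes M :: "('f, 'p, 'w) struc"
  assumes "NIP_theory U L T" "models L M T" "wf_fm L \<phi>"
  shows "\<not> independence_property M \<phi> X"
proof
  assume "independence_property M \<phi> X"
  then have ip: "shatter_len {e. assignment M e} (\<lambda>a b. sat M (override_on b a X) \<phi>) n" for n
    by (simp add: independence_property_iff)
  define conf where "conf n a b \<longleftrightarrow> (\<forall>i < n. assignment M (a i)) \<and> (\<forall>S \<subseteq> {..<n}. assignment M (b S) \<and>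
      (\<forall>i < n. sat M (override_on (b S) (a i) X) \<phi> \<longleftrightarrow> i \<in> S))" for n :: nat and a b
  have "\<exists>a b. conf n a b" for n
    unfolding conf_def by (rule shatter_lenE[OF ip[of n]]) blast
  then obtain a b where conf: "\<And>n. conf n (a n) (b n)" by metis
  then have a: "assignment M (a n i)" if "i < n" for n i using that unfolding conf_def by blast
  have b: "assignment M (b n S) \<and> (\<forall>i < n. sat M (override_on (b n S) (a n i) X) \<phi> \<longleftrightarrow> i \<in> S)"
    if "S \<subseteq> {..<n}" for n S
    using that conf[of n] unfolding conf_def by blast
  define C where "C = (\<Union>n. (\<Union>i<n. range (a n i)) \<union> (\<Union>S\<in>Pow {..<n}. range (b n S)))"
  \<comment> \<open>A pattern of length \<open>n\<close> has a parameter for each of the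
    \<open>2 ^ n\<close> subsets, still finitely many.\<close>
  have "countable (Pow {..<n})" for n :: nat by (rule countable_finite) simp
  then have "countable C" by (simp add: C_def)
  moreover have "C \<subseteq> carr M"
  proof -
    have "range (a n i) \<subseteq> carr M" if "i < n" for n i using a[OF that] by (simp add: assignment_def)
    moreover have "range (b n S) \<subseteq> carr M" if "S \<subseteq> {..<n}" for n S
      using b[OF that] by (simp add: assignment_def)
    ultimately show ?thesis unfolding C_def by blast
  qed
  ultimately obtain N :: "('f, 'p, 'u) struc" and h :: "'u \<Rightarrow> 'w" and k
    where N: "models L N T" "elementary L N M h" and k: "\<And>v. v \<in> C \<Longrightarrow> k v \<in> carr N \<and> h (k v) = v"
    by (rule pull_back[OF assms(2)]) blast
  have a_C: "range (a n i) \<subseteq> C" if "i < n" for n i using that unfolding C_def by blast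
  have b_C: "range (b n S) \<subseteq> C" if "S \<subseteq> {..<n}" for n S using that unfolding C_def by blast
  have "independence_property N \<phi> X"
    unfolding independence_property_def
  proof (intro allI exI conjI impI)
    fix n i assume i: "i < (n :: nat)"
    show "assignment N (k \<circ> a n i)" using k a_C[OF i] by (auto simp: assignment_def)
    fix S assume S: "S \<subseteq> {..<n}"
    have "k v \<in> carr N \<and> h (k v) = v" if "v \<in> range (a n i) \<union> range (b n S)" for v
      using k that a_C[OF i] b_C[OF S] by blast
    from elementary_override[OF N(2) assms(3) this]
    show "sat N (override_on (k \<circ> b n S) (k \<circ> a n i) X) \<phi> \<longleftrightarrow> i \<in> S" using b[OF S] i by simp
  next
    fix n S assume "S \<subseteq> {..<n :: nat}"
    from b_C[OF this] show "assignment N (k \<circ> b n S)" using k by (auto simp: assignment_def)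
  qed
  then show False using assms(1,3) N(1) by (simp add: NIP_theory_def)
qed

end

section \<open>Patterns in the pair\<close>

context vs_pair
begin

abbreviation "Asg \<equiv> {e. assignment M e}"

definition split_rel :: "nat set \<Rightarrow> ((nat \<Rightarrow> 'w) \<Rightarrow> bool) \<Rightarrow> (nat \<Rightarrow> 'w) \<Rightarrow> (nat \<Rightarrow> 'w) \<Rightarrow> bool" where
  "split_rel X P a b = P (override_on b a X)"

lemma assignment_override: "assignment M a \<Longrightarrow> assignment M b \<Longrightarrow> assignment M (override_on b a X)"
  by (auto simp: assignment_def override_on_def)

text \<open>Coordinate by coordinate, (a', b) equals (a, b) - (a, b') + (a', b'), and
  \<open>P\<close> defines a subgroup.\<close>

lemma pp_rectangle:
  assumes P: "pp P" and V: "assignment M a" "assignment M b" "assignment M a'" "assignment M b'"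
    and s: "split_rel X P a b" "split_rel X P a b'" "split_rel X P a' b'"
  shows "split_rel X P a' b"
proof -
  let ?e = "\<lambda>n. vadd (sub (override_on b a X n) (override_on b' a X n)) (override_on b' a' X n)"
  note as = assignment_override[of _ _ X]
  have "P ?e"
    using pp_add[OF P assignment_sub[OF as[OF V(1,2)] as[OF V(1,4)]] as[OF V(3,4)]
        pp_sub[OF P as[OF V(1,2)] as[OF V(1,4)]]] s unfolding split_rel_def by blast
  moreover have "?e = override_on b a' X"
  proof
    fix n
    have "a n \<in> V" "b n \<in> V" "a' n \<in> V" "b' n \<in> V" using V assignment_in by auto
    then show "?e n = override_on b a' X n" by (simp add: override_on_def) (metis add_sub_same commute sub_closed)
  qed
  ultimately show ?thesis by (simp add: split_rel_def)
qed

text \<open>The relation holds at (0, 1), (0, 2) and (1, 2), so the rectangle would force it at (1,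
  1).\<close>

lemma pp_not_order: "pp P \<Longrightarrow> \<not> order_len Asg (split_rel X P) 3"
proof
  assume P: "pp P" and "order_len Asg (split_rel X P) 3"
  then obtain a b where ab: "\<And>i. i < (3 :: nat) \<Longrightarrow> a i \<in> Asg" "\<And>i. i < 3 \<Longrightarrow> b i \<in> Asg"
    "\<And>i j. i < 3 \<Longrightarrow> j < 3 \<Longrightarrow> split_rel X P (a i) (b j) \<longleftrightarrow> i < j"
    by (elim order_lenE) blast
  have "split_rel X P (a 1) (b 1)"
    by (rule pp_rectangle[OF P, of "a 0" _ _ "b 2"]) (use ab in auto)
  then show False using ab(3)[of 1 1] by simp
qed

text \<open>The relation holds at (0, {0}), (0, {0, 1}) and (1, {0, 1}), so the rectangle would
  force it at (1, {0}).\<close>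

lemma pp_not_shatter: "pp P \<Longrightarrow> \<not> shatter_len Asg (split_rel X P) 2"
proof
  assume P: "pp P" and "shatter_len Asg (split_rel X P) 2"
  then obtain a b where ab: "\<And>i. i < (2 :: nat) \<Longrightarrow> a i \<in> Asg" "\<And>S. S \<subseteq> {..<2 :: nat} \<Longrightarrow> b S \<in> Asg"
    "\<And>i S. i < 2 \<Longrightarrow> S \<subseteq> {..<2} \<Longrightarrow> split_rel X P (a i) (b S) \<longleftrightarrow> i \<in> S"
    by (elim shatter_lenE) blast
  have "split_rel X P (a 1) (b {0})"
    by (rule pp_rectangle[OF P, of "a 0" _ _ "b {0, 1}"]) (use ab in auto)
  then show False using ab(3)[of 1 "{0}"] by auto
qed

lemma split_determined:
  assumes det: "\<And>e e'. assignment M e \<Longrightarrow> assignment M e' \<Longrightarrow> (\<And>B. B \<in> \<F> \<Longrightarrow> B e = B e') \<Longrightarrow> P e = P e'"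
    and V: "a \<in> Asg" "b \<in> Asg" "a' \<in> Asg" "b' \<in> Asg"
    and agree: "\<And>Q. Q \<in> split_rel X ` \<F> \<Longrightarrow> Q a b = Q a' b'"
  shows "split_rel X P a b = split_rel X P a' b'"
  unfolding split_rel_def
proof (rule det)
  show "B (override_on b a X) = B (override_on b' a' X)" if "B \<in> \<F>" for B
    using agree[of "split_rel X B"] that by (simp add: split_rel_def)
qed (use V in \<open>auto intro: assignment_override\<close>)

lemma order_len_cong:
  assumes "\<And>e. assignment M e \<Longrightarrow> P e = P' e" "order_len Asg (split_rel X P) n"
  shows "order_len Asg (split_rel X P') n"
proof -
  obtain a b where ab: "\<And>i. i < n \<Longrightarrow> a i \<in> Asg" "\<And>i. i < n \<Longrightarrow> b i \<in> Asg"
    "\<And>i j. i < n \<Longrightarrow> j < n \<Longrightarrow> split_rel X P (a i) (b j) \<longleftrightarrow> i < j"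
    by (rule order_lenE[OF assms(2)]) blast
  have "split_rel X P' (a i) (b j) \<longleftrightarrow> i < j" if "i < n" "j < n" for i j
    using ab(3)[OF that] ab(1)[OF that(1)] ab(2)[OF that(2)] assms(1) assignment_override[of "a i" "b j" X]
    by (simp add: split_rel_def)
  then show ?thesis unfolding order_len_def using ab(1,2) by (intro exI[of _ a] exI[of _ b]) simp
qed

lemma shatter_len_cong:
  assumes "\<And>e. assignment M e \<Longrightarrow> P e = P' e" "shatter_len Asg (split_rel X P) n"
  shows "shatter_len Asg (split_rel X P') n"
proof -
  obtain a b where ab: "\<And>i. i < n \<Longrightarrow> a i \<in> Asg" "\<And>S. S \<subseteq> {..<n} \<Longrightarrow> b S \<in> Asg"
    "\<And>i S. i < n \<Longrightarrow> S \<subseteq> {..<n} \<Longrightarrow> split_rel X P (a i) (b S) \<longleftrightarrow> i \<in> S"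
    by (rule shatter_lenE[OF assms(2)]) blast
  have "split_rel X P' (a i) (b S) \<longleftrightarrow> i \<in> S" if "i < n" "S \<subseteq> {..<n}" for i S
    using ab(3)[OF that] ab(1)[OF that(1)] ab(2)[OF that(2)] assms(1) assignment_override[of "a i" "b S" X]
    by (simp add: split_rel_def)
  then show ?thesis unfolding shatter_len_def using ab(1,2) by (intro exI[of _ a] exI[of _ b]) simp
qed

theorem stable_pair:
  assumes "stable_theory U L T" "wf_fm (G_lang L R) \<phi>"
  shows "\<not> order_property M \<phi> X"
proof -
  obtain \<F> where \<F>: "finite \<F>" "\<And>B. B \<in> \<F> \<Longrightarrow> basic B"
    "\<And>e e'. assignment M e \<Longrightarrow> assignment M e' \<Longrightarrow> (\<And>B. B \<in> \<F> \<Longrightarrow> B e = B e') \<Longrightarrow>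
      sat M e \<phi> = sat M e' \<phi>"
    by (rule niceE[OF nice_formula[OF assms(2)]]) blast
  have len: "\<exists>n. \<not> order_len Asg (split_rel X B) n" if B: "B \<in> \<F>" for B
  proof -
    consider "pp B" | "defin B" using \<F>(2)[OF B] by (auto simp: basic_def)
    then show ?thesis
    proof cases
      case 1
      then show ?thesis using pp_not_order by blast
    next
      case 2
      then obtain \<psi> where \<psi>: "wf_fm L \<psi>" "\<And>e. assignment M e \<Longrightarrow> B e = sat M0 e \<psi>" by (auto simp: defin_def)
      \<comment> \<open>The reduct \<open>M0\<close> has its universe in \<open>'w\<close>, whereas
        stability of \<open>T\<close> is given over \<open>'u\<close>.\<close>
      obtain n where "\<not> order_len Asg (split_rel X (\<lambda>e. sat M0 e \<psi>)) n"
        using stable_any_universe[OF assms(1) M0_model \<psi>(1), of X]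
        by (auto simp: order_property_iff split_rel_def[abs_def])
      moreover have "order_len Asg (split_rel X (\<lambda>e. sat M0 e \<psi>)) n" if "order_len Asg (split_rel X B) n"
        using \<psi>(2) that by (rule order_len_cong)
      ultimately show ?thesis by blast
    qed
  qed
  have "\<exists>n. \<not> order_len Asg (split_rel X (\<lambda>e. sat M e \<phi>)) n"
  proof (rule order_len_determined[of "split_rel X ` \<F>"])
    show "finite (split_rel X ` \<F>)" using \<F>(1) by simp
    show "\<exists>n. \<not> order_len Asg Q n" if "Q \<in> split_rel X ` \<F>" for Q using that len by (elim imageE) simp
    show "split_rel X (\<lambda>e. sat M e \<phi>) a b = split_rel X (\<lambda>e. sat M e \<phi>) a' b'"
      if "a \<in> Asg" "b \<in> Asg" "a' \<in> Asg" "b' \<in> Asg" "\<And>Q. Q \<in> split_rel X ` \<F> \<Longrightarrow> Q a b = Q a' b'"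
      for a b a' b' using split_determined[OF \<F>(3) that] .
  qed
  then show ?thesis by (simp add: order_property_iff split_rel_def[abs_def])
qed

theorem NIP_pair:
  assumes "NIP_theory U L T" "wf_fm (G_lang L R) \<phi>"
  shows "\<not> independence_property M \<phi> X"
proof -
  obtain \<F> where \<F>: "finite \<F>" "\<And>B. B \<in> \<F> \<Longrightarrow> basic B"
    "\<And>e e'. assignment M e \<Longrightarrow> assignment M e' \<Longrightarrow> (\<And>B. B \<in> \<F> \<Longrightarrow> B e = B e') \<Longrightarrow>
      sat M e \<phi> = sat M e' \<phi>"
    by (rule niceE[OF nice_formula[OF assms(2)]]) blast
  have len: "\<exists>n. \<not> shatter_len Asg (split_rel X B) n" if B: "B \<in> \<F>" for B
  proof -
    consider "pp B" | "defin B" using \<F>(2)[OF B] by (auto simp: basic_def)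
    then show ?thesis
    proof cases
      case 1
      then show ?thesis using pp_not_shatter by blast
    next
      case 2
      then obtain \<psi> where \<psi>: "wf_fm L \<psi>" "\<And>e. assignment M e \<Longrightarrow> B e = sat M0 e \<psi>" by (auto simp: defin_def)
      obtain n where "\<not> shatter_len Asg (split_rel X (\<lambda>e. sat M0 e \<psi>)) n"
        using NIP_any_universe[OF assms(1) M0_model \<psi>(1), of X]
        by (auto simp: independence_property_iff split_rel_def[abs_def])
      moreover have "shatter_len Asg (split_rel X (\<lambda>e. sat M0 e \<psi>)) n" if "shatter_len Asg (split_rel X B) n"
        using \<psi>(2) that by (rule shatter_len_cong)
      ultimately show ?thesis by blast
    qed
  qed
  have "\<exists>n. \<not> shatter_len Asg (split_rel X (\<lambda>e. sat M e \<phi>)) n"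
  proof (rule shatter_len_determined[of "split_rel X ` \<F>"])
    show "finite (split_rel X ` \<F>)" using \<F>(1) by simp
    show "\<exists>n. \<not> shatter_len Asg Q n" if "Q \<in> split_rel X ` \<F>" for Q using that len by (elim imageE) simp
    show "split_rel X (\<lambda>e. sat M e \<phi>) a b = split_rel X (\<lambda>e. sat M e \<phi>) a' b'"
      if "a \<in> Asg" "b \<in> Asg" "a' \<in> Asg" "b' \<in> Asg" "\<And>Q. Q \<in> split_rel X ` \<F> \<Longrightarrow> Q a b = Q a' b'"
      for a b a' b' using split_determined[OF \<F>(3) that] .
  qed
  then show ?thesis by (simp add: independence_property_iff split_rel_def[abs_def])
qed

end

theorem corollary2p11:
  fixes R :: "'k::field set"
    and L :: "('k msym + 'f, 'p) lang"
    and T :: "('k msym + 'f, 'p) fm set"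
  assumes "is_subring R"
    and "frac_is_everything R"
    and "extends_vs_lang L"
    and "large_type TYPE('u) L"
    and "complete_theory TYPE('u) L T"
    and "expands_vs TYPE('u) L T"
    and "has_qe TYPE('u) L T"
    and "eliminates_inf TYPE('u) L T"
    and "closures_are_span TYPE('u) L T"
  shows "(stable_theory TYPE('u) L T \<longrightarrow> stable_theory TYPE('w) (G_lang L R) (G_theory TYPE('u) L R T)) \<and>
         (NIP_theory TYPE('u) L T \<longrightarrow> NIP_theory TYPE('w) (G_lang L R) (G_theory TYPE('u) L R T))"
proof -
  have "vs_pair TYPE('u) L T R M" if "models (G_lang L R) M (G_theory TYPE('u) L R T)"
    for M :: "('k msym + 'f, ('k, 'p) grel, 'w) struc"
    using assms that by unfold_locales (auto simp: complete_theory_def)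
  then show ?thesis
    unfolding stable_theory_def[of "TYPE('w)"] NIP_theory_def[of "TYPE('w)"]
    using vs_pair.stable_pair vs_pair.NIP_pair by blast
qed

end
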